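(* Let $d\in[1,+\infty]$. The following statements hold: (i) The generalized Loewner–Kufarev ODE $$\frac{dw}{ds}=-G(w,s),\quad s\in[0,t],\qquad w(t)=z,\qquad( * )$$ establishes essentially a 1-to-1 correspondence between reverse evolution families $(\varphi_{s,t})$ of order $d$ and Herglotz vector fields $G$ of the same order. Namely, given a reverse evolution family $(\varphi_{s,t})$ of order $d$, there exists an essentially unique (i.e. unique up to a null-set on the $t$-axis) Herglotz vector field $G$ of order $d$ such that for each $t\ge0$ and $z\in\mathbb{D}$ the function $[0,t]\ni s\mapsto w(s):=\varphi_{s,t}(z)$ solves the initial value problem $( * )$. Conversely, given a Herglotz vector field $G$ of order $d$, for every $t>0$ and every $z\in\mathbb{D}$ the initial value problem $( * )$ has a unique solution $s\mapsto w=w_{z,t}(s)$ defined for all $s\in[0,t]$, and the formula $\varphi_{s,t}(z):=w_{z,t}(s)$ for all $z\in\mathbb{D}$ and all $0\le s\le t<+\infty$ defines a reverse evolution family $(\varphi_{s,t})$ of order $d$. (ii) Let $(\varphi_{s,t})$ be a reverse evolution family of order $d$ and $G$ a Herglotz vector field of order $d$ corresponding to each other as in statement (i). Then a family $(f_t)_{t\ge0}$ of holomorphic functions in $\mathbb{D}$ is the decreasing Loewner chain associated with $(\varphi_{s,t})$ if and only if the function $F:\mathbb{D}\times[0,+\infty)\to\mathbb{C}$, defined by $F(z,t):=f_t(z)$ for all $t\ge0$ and all $z\in\mathbb{D}$, is a solution to the initial value problem for the Loewner–Kufarev PDE $$\frac{\partial F}{\partial t}=\frac{\partial F}{\partial z}\,G(z,t),\quad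 t\ge0,\qquad F(\cdot,0)=\mathrm{id}_{\mathbb{D}}.$$
   Context: $\mathbb{D}=\{z\in\mathbb{C}:|z|<1\}$; $\mathrm{Hol}(\mathbb{D},\mathbb{D})$ is the set of holomorphic self-maps of $\mathbb{D}$. A null-set is a set of Lebesgue measure zero. Reverse evolution family of order $d$: a family $(\varphi_{s,t})_{0\le s\le t}$ of holomorphic self-maps of $\mathbb{D}$ such that (REF1) $\varphi_{s,s}=\mathrm{id}_{\mathbb{D}}$ for all $s\ge0$; (REF2) $\varphi_{s,t}=\varphi_{s,u}\circ\varphi_{u,t}$ for all $0\le s\le u\le t<+\infty$; (REF3) for any $z\in\mathbb{D}$ and any $T>0$ there exists a non-negative function $k_{z,T}\in L^d([0,T],\mathbb{R})$ such that $|\varphi_{s,u}(z)-\varphi_{s,t}(z)|\le\int_u^tk_{z,T}(\xi)\,d\xi$ for all $s,u,t\in[0,T]$ with $s\le u\le t$. Decreasing Loewner chain of order $d$: a family $(f_t)_{t\ge0}$ of holomorphic self-maps of $\mathbb{D}$ such that (DC1) each $f_t:\mathbb{D}\to\mathbb{D}$ is univalent; (DC2) $f_0=\mathrm{id}_{\mathbb{D}}$ and $f_t(\mathbb{D})\subset f_s(\mathbb{D})$ whenever $0\le s\le t$; (DC3) for any compact set $K\subset\mathbb{D}$ and all $T>0$ there exists a non-negative function $k_{K,T}\in L^d([0,T],\mathbb{R})$ such that $|f_s(z)-f_t(z)|\le\int_s^tk_{K,T}(\xi)\,d\xi$ for all $z\in K$ and all $0\le s\le t\le T$. Association: a decreasing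 Loewner chain $(f_t)$ of order $d$ and a reverse evolution family $(\varphi_{s,t})$ of order $d$ are associated with each other if $\varphi_{s,t}=f_s^{-1}\circ f_t$ for all $0\le s\le t$. (This is a 1-to-1 correspondence, the chain being given by $f_t=\varphi_{0,t}$.) Infinitesimal generator: a one-parametric semigroup in $\mathrm{Hol}(\mathbb{D},\mathbb{D})$ is a family $(\phi_t)_{t\ge0}$ of holomorphic self-maps of $\mathbb{D}$ with $\phi_0=\mathrm{id}_{\mathbb{D}}$, $\phi_t\circ\phi_s=\phi_{t+s}$ for all $s,t\ge0$, and $\phi_t(z)\to z$ as $t\to0^+$ for all $z\in\mathbb{D}$. Its infinitesimal generator is the holomorphic function $H:\mathbb{D}\to\mathbb{C}$ such that for each $z\in\mathbb{D}$ the function $t\mapsto\phi_t(z)$ solves $dw/dt=H(w)$, $w(0)=z$. Herglotz vector field of order $d$: a function $G:\mathbb{D}\times[0,+\infty)\to\mathbb{C}$ such that (1) for all $z\in\mathbb{D}$ the function $t\mapsto G(z,t)$ is measurable on $[0,+\infty)$; (2) for all $t\ge0$ the function $z\mapsto G(z,t)$ is holomorphic in $\mathbb{D}$; (3) for any compact set $K\subset\mathbb{D}$ and any $T>0$ there exists a non-negative function $k_{K,T}\in L^d([0,T],\mathbb{R})$ such that $|G(z,t)|\le k_{K,T}(t)$ for all $z\in K$ and a.e. $t\in[0,T]$; (4) for a.e. $t\ge0$ the function $G(\cdot,t)$ is the infinitesimal generator of a one-parametric semigroup in $\mathrm{Hol}(\mathbb{D},\mathbb{D})$. The ODE is understood in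 the sense of Carathéodory: solutions are (locally) absolutely continuous functions with values in $\mathbb{D}$ satisfying the equation almost everywhere. Solution to the PDE: a function $F:\mathbb{D}\times E\to\mathbb{C}$, where $E\subset[0,+\infty)$ is an interval (here $E=[0,+\infty)$), such that $F$ is continuous in $\mathbb{D}\times E$; $F(\cdot,t)$ is holomorphic in $\mathbb{D}$ for every $t\in E$; $F(z,\cdot)$ is locally absolutely continuous in $E$ for every $z\in\mathbb{D}$; and for every $z\in\mathbb{D}$ the equation holds for a.e. $t\in E$. *)

theory Defs
  imports "HOL-Complex_Analysis.Complex_Analysis"
begin

text \<open>
  Functions on the disc and families indexed by times in \<open>[0, \<infinity>)\<close> are total functions; every
  condition below is relativised to \<open>unit_disc\<close> and to the relevant times, so values elsewhere
  are irrelevant.  A two-parameter family \<open>\<phi>\<^bsub>s,t\<^esub>(z)\<close> is written \<open>\<phi> s t z\<close>.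
\<close>

abbreviation unit_disc :: "complex set" where
  "unit_disc \<equiv> ball 0 1"

definition hol_self_map :: "(complex \<Rightarrow> complex) \<Rightarrow> bool" where
  "hol_self_map f \<longleftrightarrow> f holomorphic_on unit_disc \<and> f ` unit_disc \<subseteq> unit_disc"

text \<open>The functions (not classes) in \<open>L\<^sup>d(M, \<real>)\<close> for an exponent \<open>d \<in> [1, \<infinity>]\<close>.\<close>

definition Lspace :: "ereal \<Rightarrow> 'a measure \<Rightarrow> ('a \<Rightarrow> real) set" where
  "Lspace d M = {k \<in> borel_measurable M.
     if d = \<infinity> then \<exists>C. AE x in M. \<bar>k x\<bar> \<le> C
     else integrable M (\<lambda>x. \<bar>k x\<bar> powr real_of_ereal d)}"

definition nonneg_Lspace :: "ereal \<Rightarrow> real \<Rightarrow> (real \<Rightarrow> real) set" where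
  "nonneg_Lspace d T = {k \<in> Lspace d (lebesgue_on {0..T}). \<forall>\<xi>\<in>{0..T}. 0 \<le> k \<xi>}"

text \<open>
  The usual \<open>\<epsilon>\<close>-\<open>\<delta>\<close> definition.  The members of a division \<open>D\<close> are finitely many nonoverlapping
  compact intervals \<open>k = {Inf k..Sup k}\<close>, here contained in \<open>S\<close> but not required to cover it.
\<close>

definition abs_continuous_on :: "real set \<Rightarrow> (real \<Rightarrow> 'a::real_normed_vector) \<Rightarrow> bool" where
  "abs_continuous_on S f \<longleftrightarrow>
     (\<forall>\<epsilon>>0. \<exists>\<delta>>0. \<forall>D. D division_of \<Union>D \<and> \<Union>D \<subseteq> S \<and> (\<Sum>k\<in>D. Sup k - Inf k) < \<delta> \<longrightarrow>
        (\<Sum>k\<in>D. norm (f (Sup k) - f (Inf k))) < \<epsilon>)"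

definition locally_abs_continuous_on ::
    "real set \<Rightarrow> (real \<Rightarrow> 'a::real_normed_vector) \<Rightarrow> bool" where
  "locally_abs_continuous_on E f \<longleftrightarrow> (\<forall>a b. {a..b} \<subseteq> E \<longrightarrow> abs_continuous_on {a..b} f)"

definition reverse_evolution_family ::
    "ereal \<Rightarrow> (real \<Rightarrow> real \<Rightarrow> complex \<Rightarrow> complex) \<Rightarrow> bool" where
  "reverse_evolution_family d \<phi> \<longleftrightarrow>
     (\<forall>s t. 0 \<le> s \<and> s \<le> t \<longrightarrow> hol_self_map (\<phi> s t)) \<and>
     (\<forall>s\<ge>0. \<forall>z\<in>unit_disc. \<phi> s s z = z) \<and>
     (\<forall>s u t. 0 \<le> s \<and> s \<le> u \<and> u \<le> t \<longrightarrow>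
        (\<forall>z\<in>unit_disc. \<phi> s t z = \<phi> s u (\<phi> u t z))) \<and>
     (\<forall>z\<in>unit_disc. \<forall>T>0. \<exists>k\<in>nonneg_Lspace d T.
        \<forall>s u t. 0 \<le> s \<and> s \<le> u \<and> u \<le> t \<and> t \<le> T \<longrightarrow>
          norm (\<phi> s u z - \<phi> s t z) \<le> (LINT \<xi>:{u..t}|lebesgue. k \<xi>))"

definition decreasing_Loewner_chain ::
    "ereal \<Rightarrow> (real \<Rightarrow> complex \<Rightarrow> complex) \<Rightarrow> bool" where
  "decreasing_Loewner_chain d f \<longleftrightarrow>
     (\<forall>t\<ge>0. hol_self_map (f t) \<and> inj_on (f t) unit_disc) \<and>
     (\<forall>z\<in>unit_disc. f 0 z = z) \<and>
     (\<forall>s t. 0 \<le> s \<and> s \<le> t \<longrightarrow> f t ` unit_disc \<subseteq> f s ` unit_disc) \<and>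
     (\<forall>K T. compact K \<and> K \<subseteq> unit_disc \<and> T > 0 \<longrightarrow> (\<exists>k\<in>nonneg_Lspace d T.
        \<forall>z\<in>K. \<forall>s t. 0 \<le> s \<and> s \<le> t \<and> t \<le> T \<longrightarrow>
          norm (f s z - f t z) \<le> (LINT \<xi>:{s..t}|lebesgue. k \<xi>)))"

definition associated ::
    "(real \<Rightarrow> complex \<Rightarrow> complex) \<Rightarrow> (real \<Rightarrow> real \<Rightarrow> complex \<Rightarrow> complex) \<Rightarrow> bool" where
  "associated f \<phi> \<longleftrightarrow>
     (\<forall>s t. 0 \<le> s \<and> s \<le> t \<longrightarrow>
        (\<forall>z\<in>unit_disc. \<phi> s t z = inv_into unit_disc (f s) (f t z)))"

definition one_param_semigroup :: "(real \<Rightarrow> complex \<Rightarrow> complex) \<Rightarrow> bool" where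
  "one_param_semigroup \<phi> \<longleftrightarrow>
     (\<forall>t\<ge>0. hol_self_map (\<phi> t)) \<and>
     (\<forall>z\<in>unit_disc. \<phi> 0 z = z) \<and>
     (\<forall>s\<ge>0. \<forall>t\<ge>0. \<forall>z\<in>unit_disc. \<phi> t (\<phi> s z) = \<phi> (t + s) z) \<and>
     (\<forall>z\<in>unit_disc. ((\<lambda>t. \<phi> t z) \<longlongrightarrow> z) (at_right 0))"

definition infinitesimal_generator ::
    "(real \<Rightarrow> complex \<Rightarrow> complex) \<Rightarrow> (complex \<Rightarrow> complex) \<Rightarrow> bool" where
  "infinitesimal_generator \<phi> H \<longleftrightarrow>
     H holomorphic_on unit_disc \<and>
     (\<forall>z\<in>unit_disc. \<phi> 0 z = z \<and>
        (\<forall>t\<ge>0. ((\<lambda>\<tau>. \<phi> \<tau> z) has_vector_derivative H (\<phi> t z)) (at t within {0..})))"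

text \<open>
  In the local bound the exceptional null set may be taken independent of \<open>z \<in> K\<close>, because
  \<open>G(\<cdot>, t)\<close> is continuous and \<open>K\<close> is separable.
\<close>

definition Herglotz_vector_field :: "ereal \<Rightarrow> (complex \<Rightarrow> real \<Rightarrow> complex) \<Rightarrow> bool" where
  "Herglotz_vector_field d G \<longleftrightarrow>
     (\<forall>z\<in>unit_disc. (\<lambda>t. G z t) \<in> borel_measurable (lebesgue_on {0..})) \<and>
     (\<forall>t\<ge>0. (\<lambda>z. G z t) holomorphic_on unit_disc) \<and>
     (\<forall>K T. compact K \<and> K \<subseteq> unit_disc \<and> T > 0 \<longrightarrow> (\<exists>k\<in>nonneg_Lspace d T.
        AE t in lebesgue_on {0..T}. \<forall>z\<in>K. norm (G z t) \<le> k t)) \<and>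
     (AE t in lebesgue_on {0..}.
        \<exists>\<phi>. one_param_semigroup \<phi> \<and> infinitesimal_generator \<phi> (\<lambda>z. G z t))"

text \<open>
  \<open>w\<close> is a Caratheodory solution on \<open>[0, t]\<close> of \<open>dw/ds = - G(w, s)\<close> with terminal value
  \<open>w(t) = z\<close>.
\<close>

definition solves_LK_ODE ::
    "(complex \<Rightarrow> real \<Rightarrow> complex) \<Rightarrow> real \<Rightarrow> complex \<Rightarrow> (real \<Rightarrow> complex) \<Rightarrow> bool" where
  "solves_LK_ODE G t z w \<longleftrightarrow>
     w ` {0..t} \<subseteq> unit_disc \<and>
     locally_abs_continuous_on {0..t} w \<and>
     (AE s in lebesgue_on {0..t}.
        (w has_vector_derivative - G (w s) s) (at s within {0..t})) \<and>
     w t = z"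

definition LK_corresponding ::
    "(real \<Rightarrow> real \<Rightarrow> complex \<Rightarrow> complex) \<Rightarrow> (complex \<Rightarrow> real \<Rightarrow> complex) \<Rightarrow> bool" where
  "LK_corresponding \<phi> G \<longleftrightarrow>
     (\<forall>t\<ge>0. \<forall>z\<in>unit_disc. solves_LK_ODE G t z (\<lambda>s. \<phi> s t z))"

text \<open>
  \<open>F\<close> solves \<open>\<partial>F/\<partial>t = (\<partial>F/\<partial>z) G(z, t)\<close> on \<open>unit_disc \<times> E\<close>; the exceptional null set of times
  may depend on \<open>z\<close>.
\<close>

definition solves_LK_PDE ::
    "(complex \<Rightarrow> real \<Rightarrow> complex) \<Rightarrow> real set \<Rightarrow> (complex \<Rightarrow> real \<Rightarrow> complex) \<Rightarrow> bool" where
  "solves_LK_PDE G E F \<longleftrightarrow>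
     continuous_on (unit_disc \<times> E) (\<lambda>(z, t). F z t) \<and>
     (\<forall>t\<in>E. (\<lambda>z. F z t) holomorphic_on unit_disc) \<and>
     (\<forall>z\<in>unit_disc. locally_abs_continuous_on E (\<lambda>t. F z t)) \<and>
     (\<forall>z\<in>unit_disc. AE t in lebesgue_on E.
        ((\<lambda>\<tau>. F z \<tau>) has_vector_derivative deriv (\<lambda>\<zeta>. F \<zeta> t) z * G z t) (at t within E))"

end

theory Submission
  imports Defs
begin

text \<open>
  Generators are handled through the Berkson-Porta inequality
  \<open>Re (cnj z * H z) \<le> (1 - (norm z)\<^sup>2) * Re (cnj z * H 0)\<close>, the infinitesimal form of the
  Schwarz-Pick lemma.  Along solutions of the ODE it bounds \<open>1 - (norm w)\<^sup>2\<close> from below, so solutions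
  never leave the disc.  For autonomous fields the ODE therefore produces a semigroup, and conversely
  every generator satisfies the inequality.

  For a reverse evolution family, the displacement \<open>\<psi> z - z\<close> of a self-map is controlled, uniformly
  on compact sets, by the displacements of \<open>0\<close> and \<open>1/2\<close>.  Hence the integral bound (REF3) is
  locally uniform in \<open>z\<close>, and for almost every \<open>t\<close> the maps \<open>f\<^sub>t = \<phi> 0 t\<close>, which are
  univalent, have a time derivative locally uniformly in the disc.  Dividing it by \<open>f\<^sub>t'\<close> gives the
  Herglotz field, and differentiating \<open>f\<^sub>s (\<phi> s t z) = f\<^sub>t z\<close> in \<open>s\<close> gives the ODE.  Solutions of the
  PDE are constant along the characteristics \<open>s \<mapsto> \<phi> s t z\<close>, hence agree with \<open>\<phi> 0 t\<close>.
\<close>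

subsection \<open>Absolutely continuous functions\<close>

text \<open>The recurring obstacle is that almost-everywhere statements are given for each
  \<open>z\<close> separately, with a null set depending on \<open>z\<close>, whereas they are
  needed at moving points such as \<open>\<phi> s t z\<close>. The remedy is always the same: one
  integrable bound valid on a whole disc makes the difference quotients in time bounded there, hence
  equi-Lipschitz on smaller discs, and then differentiability at a countable dense set of points
  gives a locally uniform derivative off a single null set. For evolution families such a bound must
  be built from pointwise ones. The points \<open>0\<close> and \<open>1/2\<close> suffice because
  the displacement of a self-map satisfies the Berkson-Porta inequality, so it is determined by its
  value at \<open>0\<close> and a function with nonnegative real part, which Harnack's inequality
  controls by its value at one further point. For solutions of the PDE the bound comes from the
  equation and Cauchy's estimate. Differentiability almost everywhere is only proved for functions
  whose increments are dominated by an integral; this is the form in which all the data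
  arrive.\<close>

lemma AE_lebesgue_on_iff_negligible:
  fixes S :: "real set"
  assumes "S \<in> sets lebesgue"
  shows "(AE x in lebesgue_on S. P x) \<longleftrightarrow> negligible {x \<in> S. \<not> P x}"
proof -
  have "(AE x in lebesgue_on S. P x) \<longleftrightarrow> (AE x in lebesgue. x \<in> S \<longrightarrow> P x)"
    using assms by (intro AE_restrict_space_iff) auto
  also have "\<dots> \<longleftrightarrow> {x \<in> S. \<not> P x} \<in> null_sets lebesgue"
    by (simp add: completion.AE_iff_null_sets)
  finally show ?thesis by (simp add: negligible_iff_null_sets)
qed

lemma AE_lebesgue_onI:
  fixes S :: "real set"
  assumes "negligible N" "\<And>x. x \<in> S \<Longrightarrow> x \<notin> N \<Longrightarrow> P x" "S \<in> sets lebesgue"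
  shows "AE x in lebesgue_on S. P x"
  unfolding AE_lebesgue_on_iff_negligible[OF assms(3)]
  by (rule negligible_subset[OF assms(1)]) (use assms(2) in blast)

lemma AE_lebesgue_onE:
  fixes S :: "real set"
  assumes "AE x in lebesgue_on S. P x" "S \<in> sets lebesgue"
  obtains N where "negligible N" "\<And>x. x \<in> S \<Longrightarrow> x \<notin> N \<Longrightarrow> P x"
  using assms that[of "{x \<in> S. \<not> P x}"] by (auto simp: AE_lebesgue_on_iff_negligible)

lemma division_member_real:
  fixes D :: "real set set"
  assumes "D division_of S" "k \<in> D"
  obtains a b where "k = {a..b}" "a \<le> b" "Inf k = a" "Sup k = b"
proof -
  obtain a b where "k = cbox a b" using division_ofD(4)[OF assms] by blast
  moreover have "k \<noteq> {}" using division_ofD(3)[OF assms] .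
  ultimately show ?thesis using that[of a b] by auto
qed

lemma division_sum_length:
  fixes D :: "real set set"
  assumes "D division_of \<Union>D"
  shows "\<Union>D \<in> lmeasurable" "(\<Sum>k\<in>D. Sup k - Inf k) = measure lebesgue (\<Union>D)"
proof -
  have *: "((\<lambda>x. 1) has_integral (Sup k - Inf k)) k" if "k \<in> D" for k
  proof -
    obtain a b where "k = {a..b}" "a \<le> b" "Inf k = a" "Sup k = b"
      using division_member_real[OF assms \<open>k \<in> D\<close>] .
    with has_integral_const_real[of "1::real" a b] show ?thesis by auto
  qed
  have **: "((\<lambda>x. 1) has_integral (\<Sum>k\<in>D. Sup k - Inf k)) (\<Union>D)"
    by (rule has_integral_combine_division[OF assms *])
  show 1: "\<Union>D \<in> lmeasurable"
    unfolding lmeasurable_iff_integrable_on using ** by (rule has_integral_integrable)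
  show "(\<Sum>k\<in>D. Sup k - Inf k) = measure lebesgue (\<Union>D)"
    using ** 1 by (simp add: lmeasure_integral integral_unique)
qed

lemma abs_continuous_onE:
  assumes "abs_continuous_on S f" "0 < e"
  obtains d where "0 < d"
    "\<And>D. D division_of \<Union>D \<Longrightarrow> \<Union>D \<subseteq> S \<Longrightarrow> (\<Sum>k\<in>D. Sup k - Inf k) < d \<Longrightarrow>
        (\<Sum>k\<in>D. norm (f (Sup k) - f (Inf k))) < e"
proof -
  from assms have "\<exists>d>0. \<forall>D. D division_of \<Union>D \<and> \<Union>D \<subseteq> S \<and> (\<Sum>k\<in>D. Sup k - Inf k) < d \<longrightarrow>
        (\<Sum>k\<in>D. norm (f (Sup k) - f (Inf k))) < e"
    unfolding abs_continuous_on_def by simp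
  then show ?thesis using that by blast
qed

lemma abs_continuous_on_subset:
  assumes "abs_continuous_on S f" "T \<subseteq> S"
  shows "abs_continuous_on T f"
  using assms unfolding abs_continuous_on_def by (meson order_trans)

text \<open>The closure properties of absolute continuity below are instances of this comparison;
  two majorants are allowed because products and moving points involve increments of two functions,
  and they may coincide.\<close>

lemma abs_continuous_on_dominated:
  assumes f: "abs_continuous_on S f" and g: "abs_continuous_on S g"
    and le: "\<And>x y. x \<in> S \<Longrightarrow> y \<in> S \<Longrightarrow> x \<le> y \<Longrightarrow>
               norm (h y - h x) \<le> C * (norm (f y - f x) + norm (g y - g x))"
  shows "abs_continuous_on S h"
  unfolding abs_continuous_on_def
proof (intro allI impI)
  fix e :: real assume e: "e > 0"
  define C' where "C' = max C 1"
  have C': "C' > 0" "C \<le> C'" by (auto simp: C'_def)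
  have "e / (2 * C') > 0" using e C' by simp
  note pos = this
  obtain d1 where d1: "d1 > 0"
    and 1: "\<And>D. D division_of \<Union>D \<Longrightarrow> \<Union>D \<subseteq> S \<Longrightarrow> (\<Sum>k\<in>D. Sup k - Inf k) < d1 \<Longrightarrow>
        (\<Sum>k\<in>D. norm (f (Sup k) - f (Inf k))) < e / (2 * C')"
    using abs_continuous_onE[OF f pos] by blast
  obtain d2 where d2: "d2 > 0"
    and 2: "\<And>D. D division_of \<Union>D \<Longrightarrow> \<Union>D \<subseteq> S \<Longrightarrow> (\<Sum>k\<in>D. Sup k - Inf k) < d2 \<Longrightarrow>
        (\<Sum>k\<in>D. norm (g (Sup k) - g (Inf k))) < e / (2 * C')"
    using abs_continuous_onE[OF g pos] by blast
  note d = d1 d2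
  show "\<exists>d>0. \<forall>D. D division_of \<Union>D \<and> \<Union>D \<subseteq> S \<and> (\<Sum>k\<in>D. Sup k - Inf k) < d \<longrightarrow>
        (\<Sum>k\<in>D. norm (h (Sup k) - h (Inf k))) < e"
  proof (intro exI conjI allI impI)
    show "min d1 d2 > 0" using d by simp
    fix D assume D: "D division_of \<Union>D \<and> \<Union>D \<subseteq> S \<and> (\<Sum>k\<in>D. Sup k - Inf k) < min d1 d2"
    have "norm (h (Sup k) - h (Inf k)) \<le> C' * (norm (f (Sup k) - f (Inf k)) + norm (g (Sup k) - g (Inf k)))"
      if "k \<in> D" for k
    proof -
      obtain a b where k: "k = {a..b}" "a \<le> b" "Inf k = a" "Sup k = b"
        using division_member_real[OF conjunct1[OF D] \<open>k \<in> D\<close>] .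
      moreover have "k \<subseteq> S" using D that by blast
      ultimately have "Inf k \<in> S" "Sup k \<in> S" "Inf k \<le> Sup k" by auto
      from le[OF this] show ?thesis
        by (rule order_trans) (use C' in \<open>auto intro!: mult_right_mono\<close>)
    qed
    then have "(\<Sum>k\<in>D. norm (h (Sup k) - h (Inf k)))
      \<le> (\<Sum>k\<in>D. C' * (norm (f (Sup k) - f (Inf k)) + norm (g (Sup k) - g (Inf k))))"
      by (rule sum_mono)
    also have "\<dots> = C' * ((\<Sum>k\<in>D. norm (f (Sup k) - f (Inf k))) + (\<Sum>k\<in>D. norm (g (Sup k) - g (Inf k))))"
      by (simp add: sum.distrib flip: sum_distrib_left)
    also have "\<dots> < C' * (e / (2 * C') + e / (2 * C'))"
      using 1[of D] 2[of D] D C' by (intro mult_strict_left_mono add_strict_mono) auto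
    also have "\<dots> = e" using C' by (simp add: field_simps)
    finally show "(\<Sum>k\<in>D. norm (h (Sup k) - h (Inf k))) < e" .
  qed
qed

lemma abs_continuous_on_imp_continuous_on:
  assumes "abs_continuous_on {a..b} f"
  shows "continuous_on {a..b} f"
  unfolding continuous_on_iff
proof (intro ballI allI impI)
  fix x e :: real assume x: "x \<in> {a..b}" and e: "e > 0"
  obtain d where d: "d > 0" and
    H: "\<And>D. D division_of \<Union>D \<Longrightarrow> \<Union>D \<subseteq> {a..b} \<Longrightarrow> (\<Sum>k\<in>D. Sup k - Inf k) < d \<Longrightarrow>
        (\<Sum>k\<in>D. norm (f (Sup k) - f (Inf k))) < e"
    using abs_continuous_onE[OF assms e] by blast
  have *: "norm (f v - f u) < e" if "u \<in> {a..b}" "v \<in> {a..b}" "u \<le> v" "v - u < d" for u v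
  proof -
    have "{{u..v}} division_of \<Union>{{u..v}}"
      using that division_of_self[of u v] by (simp add: box_real)
    then show ?thesis using H[of "{{u..v}}"] that by auto
  qed
  show "\<exists>d>0. \<forall>x'\<in>{a..b}. dist x' x < d \<longrightarrow> dist (f x') (f x) < e"
  proof (intro exI conjI ballI impI)
    fix y assume y: "y \<in> {a..b}" "dist y x < d"
    show "dist (f y) (f x) < e"
    proof (cases "x \<le> y")
      case True then show ?thesis using *[of x y] x y by (auto simp: dist_norm)
    next
      case False then show ?thesis using *[of y x] x y by (auto simp: dist_norm norm_minus_commute)
    qed
  qed (use d in auto)
qed

lemma integrable_on_subinterval_real:
  fixes f :: "real \<Rightarrow> 'a::banach"
  shows "f integrable_on {a..b} \<Longrightarrow> a \<le> c \<Longrightarrow> d \<le> b \<Longrightarrow> f integrable_on {c..d}"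
  by (rule integrable_on_subinterval) auto

text \<open>Truncation of \<open>k\<close> at height \<open>n\<close> splits the integral over a
  division into a part at most \<open>n\<close> times the total length and a remainder that, by
  dominated convergence, is below \<open>e / 2\<close> for every division at once.\<close>

lemma abs_continuous_on_integral_bound:
  fixes k :: "real \<Rightarrow> real"
  assumes k: "k integrable_on {a..b}" and k0: "\<And>x. x \<in> {a..b} \<Longrightarrow> 0 \<le> k x"
    and le: "\<And>x y. a \<le> x \<Longrightarrow> x \<le> y \<Longrightarrow> y \<le> b \<Longrightarrow> norm (f y - f x) \<le> integral {x..y} k"
  shows "abs_continuous_on {a..b} f"
  unfolding abs_continuous_on_def
proof (intro allI impI)
  fix e :: real assume e: "e > 0"
  define m where "m = (\<lambda>n::nat. \<lambda>x. min (k x) (real n))"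
  have mint: "m n integrable_on {a..b}" for n
  proof (rule measurable_bounded_by_integrable_imp_integrable[OF _ k])
    show "m n \<in> borel_measurable (lebesgue_on {a..b})"
      unfolding m_def using integrable_imp_measurable[OF k] by measurable
  qed (use k0 in \<open>auto simp: m_def\<close>)
  have "(\<lambda>n. integral {a..b} (m n)) \<longlonglongrightarrow> integral {a..b} k"
  proof (rule dominated_convergence(2)[OF mint k])
    fix x assume x: "x \<in> {a..b}"
    obtain N where N: "k x \<le> real N" using real_arch_simple by blast
    show "(\<lambda>n. m n x) \<longlonglongrightarrow> k x"
      by (rule tendsto_eventually, rule eventually_sequentiallyI[of N]) (use N in \<open>auto simp: m_def\<close>)
  qed (use k0 in \<open>auto simp: m_def\<close>)
  then obtain n where n: "\<bar>integral {a..b} (m n) - integral {a..b} k\<bar> < e / 2"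
    using e unfolding lim_sequentially dist_real_def by (meson half_gt_zero order_refl)
  show "\<exists>d>0. \<forall>D. D division_of \<Union>D \<and> \<Union>D \<subseteq> {a..b} \<and> (\<Sum>k\<in>D. Sup k - Inf k) < d \<longrightarrow>
        (\<Sum>k\<in>D. norm (f (Sup k) - f (Inf k))) < e"
  proof (intro exI conjI allI impI)
    \<comment> \<open>With this total length the truncated part contributes at most
      \<open>e / 2\<close>; the \<open>+ 1\<close> covers \<open>n = 0\<close>.\<close>
    show "e / (2 * (real n + 1)) > 0" using e by simp
    fix D assume D: "D division_of \<Union>D \<and> \<Union>D \<subseteq> {a..b} \<and> (\<Sum>k\<in>D. Sup k - Inf k) < e / (2 * (real n + 1))"
    have I: "norm (f (Sup i) - f (Inf i)) \<le> integral i k" if "i \<in> D" for i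
    proof -
      obtain u v where i: "i = {u..v}" "u \<le> v" "Inf i = u" "Sup i = v"
        using division_member_real[OF conjunct1[OF D] \<open>i \<in> D\<close>] .
      moreover have "i \<subseteq> {a..b}" using D that by blast
      ultimately show ?thesis using le[of u v] by auto
    qed
    have i1: "h integrable_on \<Union>D" "integral (\<Union>D) h = (\<Sum>i\<in>D. integral i h)"
      if "h integrable_on {a..b}" for h :: "real \<Rightarrow> real"
      using has_integral_combine_division_topdown[OF that, of D "\<Union>D"] D by (auto simp: integral_unique has_integral_integrable)
    have "(\<Sum>i\<in>D. norm (f (Sup i) - f (Inf i))) \<le> (\<Sum>i\<in>D. integral i k)"
      by (rule sum_mono[OF I])
    also have "\<dots> = integral (\<Union>D) k" using i1(2)[OF k] by simp
    also have "\<dots> = integral (\<Union>D) (m n) + integral (\<Union>D) (\<lambda>x. k x - m n x)"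
      using Henstock_Kurzweil_Integration.integral_diff[OF i1(1)[OF k] i1(1)[OF mint[of n]]] by simp
    also have "integral (\<Union>D) (\<lambda>x. k x - m n x) \<le> integral {a..b} (\<lambda>x. k x - m n x)"
      using D i1(1) k mint by (intro integral_subset_le integrable_diff) (auto simp: m_def)
    also have "\<dots> = integral {a..b} k - integral {a..b} (m n)"
      using k mint by (rule Henstock_Kurzweil_Integration.integral_diff)
    also have "integral (\<Union>D) (m n) \<le> integral (\<Union>D) (\<lambda>x. real n)"
      using D i1(1)[OF mint] i1(1)[OF integrable_const_ivl] by (intro integral_le) (auto simp: m_def)
    also have "\<dots> = real n * (\<Sum>i\<in>D. Sup i - Inf i)"
      using D division_sum_length[of D] by (simp add: lmeasure_integral flip: integral_mult_right)
    also have "\<dots> \<le> real n * (e / (2 * (real n + 1)))"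
      using D by (intro mult_left_mono) auto
    also have "\<dots> \<le> e / 2"
      using e by (simp add: field_simps)
    finally show "(\<Sum>k\<in>D. norm (f (Sup k) - f (Inf k))) < e" using n by linarith
  qed
qed

text \<open>A gauge argument: for tags outside \<open>N\<close> differentiability works as in the
  classical proof. For tags in \<open>N\<close> the integrand is set to \<open>0\<close>, so that
  only increments of \<open>f\<close> remain, over intervals of small total length, and absolute
  continuity makes their sum small.\<close>

theorem fundamental_theorem_of_calculus_abs_continuous:
  fixes f :: "real \<Rightarrow> 'a::banach"
  assumes "a \<le> b" and ac: "abs_continuous_on {a..b} f" and N: "negligible N"
    and vecd: "\<And>x. x \<in> {a..b} - N \<Longrightarrow> (f has_vector_derivative g x) (at x within {a..b})"
  shows "(g has_integral (f b - f a)) {a..b}"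
proof -
  define f' where "f' x = (if x \<in> N then 0 else g x)" for x
  have "(f' has_integral (f b - f a)) {a..b}"
    unfolding has_integral_real
  proof (intro allI impI)
    fix e :: real assume "e > 0"
    define e' where "e' = e / (2 * (b - a + 1))"
    have e': "e' > 0" "e' * (b - a) \<le> e / 2" using \<open>e > 0\<close> \<open>a \<le> b\<close>
      by (auto simp: e'_def field_simps)
    obtain \<delta> where \<delta>: "\<delta> > 0" and
      H: "\<And>D. D division_of \<Union>D \<Longrightarrow> \<Union>D \<subseteq> {a..b} \<Longrightarrow> (\<Sum>k\<in>D. Sup k - Inf k) < \<delta> \<Longrightarrow>
          (\<Sum>k\<in>D. norm (f (Sup k) - f (Inf k))) < e / 2"
      using abs_continuous_onE[OF ac half_gt_zero[OF \<open>e > 0\<close>]] by blast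
    obtain U where U: "open U" "N \<subseteq> U" "U - N \<in> lmeasurable" "emeasure lebesgue (U - N) < ennreal \<delta>"
      using sets_lebesgue_outer_open[of N \<delta>] N \<delta> negligible_imp_sets by blast
    have UN: "U = (U - N) \<union> N" using U(2) by auto
    have Um: "U \<in> lmeasurable" using U(3) N UN by (metis fmeasurable.Un negligible_imp_measurable)
    have "measure lebesgue U = measure lebesgue (U - N)"
      by (rule measure_negligible_symdiff) (use U N UN in \<open>auto intro: negligible_subset fmeasurableD\<close>)
    then have mU: "measure lebesgue U < \<delta>"
      using U(3,4) by (simp add: emeasure_eq_measure2 ennreal_less_iff)
    have "\<forall>x. \<exists>d>0. x \<in> {a..b} - N \<longrightarrow>
         (\<forall>y\<in>{a..b}. norm (y-x) < d \<longrightarrow> norm (f y - f x - (y-x) *\<^sub>R g x) \<le> e' * norm (y-x))"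
      using vecd[unfolded has_vector_derivative_def has_derivative_within_alt] e'(1)
      by (meson zero_less_one)
    then obtain d where d: "\<And>x. 0 < d x"
                   "\<And>x y. \<lbrakk>x \<in> {a..b} - N; y \<in> {a..b}; norm (y-x) < d x\<rbrakk>
                          \<Longrightarrow> norm (f y - f x - (y-x) *\<^sub>R g x) \<le> e' * norm (y-x)"
      by metis
    \<comment> \<open>All intervals of a fine division tagged in \<open>N\<close> lie in
      \<open>U\<close>, so their total length is less than \<open>\<delta>\<close>.\<close>
    define \<gamma> where "\<gamma> x = (if x \<in> N then U else ball x (d x))" for x
    show "\<exists>\<gamma>. gauge \<gamma> \<and> (\<forall>\<D>. \<D> tagged_division_of {a..b} \<and> \<gamma> fine \<D> \<longrightarrow>
        norm ((\<Sum>(x, k)\<in>\<D>. measure lborel k *\<^sub>R f' x) - (f b - f a)) < e)"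
    proof (intro exI conjI allI impI)
      show "gauge \<gamma>" unfolding gauge_def \<gamma>_def using U d(1) by auto
      fix p assume p: "p tagged_division_of {a..b} \<and> \<gamma> fine p"
      then have ptag: "p tagged_division_of {a..b}" and fine: "\<gamma> fine p" by auto
      have finp: "finite p" using ptag by blast
      define P where "P = {xk \<in> p. fst xk \<in> N}"
      define Q where "Q = {xk \<in> p. fst xk \<notin> N}"
      have PQ: "p = P \<union> Q" "P \<inter> Q = {}" "finite P" "finite Q"
        using finp by (auto simp: P_def Q_def)
      have "(\<Sum>(x, k)\<in>p. measure lborel k *\<^sub>R f' x) - (f b - f a) =
          (\<Sum>(x, k)\<in>p. measure lborel k *\<^sub>R f' x - (f (Sup k) - f (Inf k)))"
        using additive_tagged_division_1[OF \<open>a \<le> b\<close> ptag, of f]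
        by (simp add: sum_subtractf split_beta)
      also have "\<dots> = (\<Sum>(x, k)\<in>P. measure lborel k *\<^sub>R f' x - (f (Sup k) - f (Inf k))) +
          (\<Sum>(x, k)\<in>Q. measure lborel k *\<^sub>R f' x - (f (Sup k) - f (Inf k)))"
        unfolding PQ(1) by (rule sum.union_disjoint) (use PQ in auto)
      also have "norm \<dots> \<le> norm (\<Sum>(x, k)\<in>P. measure lborel k *\<^sub>R f' x - (f (Sup k) - f (Inf k))) +
          norm (\<Sum>(x, k)\<in>Q. measure lborel k *\<^sub>R f' x - (f (Sup k) - f (Inf k)))"
        by (rule norm_triangle_ineq)
      also have "norm (\<Sum>(x, k)\<in>P. measure lborel k *\<^sub>R f' x - (f (Sup k) - f (Inf k))) < e / 2"
      proof -
        have Ppart: "P tagged_partial_division_of {a..b}"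
        proof (rule tagged_partial_division_subset)
          show "p tagged_partial_division_of {a..b}" using ptag by (simp add: tagged_division_of_def)
        qed (auto simp: P_def)
        have div: "snd ` P division_of \<Union>(snd ` P)"
          by (rule partial_division_of_tagged_division[OF Ppart])
        have "\<Union>(snd ` P) \<subseteq> U"
        proof -
          have "k \<subseteq> U" if "(x, k) \<in> P" for x k
            using fine that by (fastforce simp: P_def fine_def \<gamma>_def)
          then show ?thesis by (metis Union_least imageE prod.collapse)
        qed
        then have "measure lebesgue (\<Union>(snd ` P)) \<le> measure lebesgue U"
          using division_sum_length(1)[OF div] Um by (intro measure_mono_fmeasurable) auto
        then have small: "(\<Sum>k\<in>snd ` P. Sup k - Inf k) < \<delta>"
          using division_sum_length(2)[OF div] mU by simp
        have sub: "\<Union>(snd ` P) \<subseteq> {a..b}"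
          using tagged_partial_division_ofD(3)[OF Ppart] by fastforce
        \<comment> \<open>Passing from tagged intervals to intervals requires a summand that
          vanishes on intervals with empty interior. The case distinction provides this for the
          empty set, where \<open>Inf\<close> and \<open>Sup\<close> carry no information.\<close>
        define l where "l k = (if k = {} then 0 else norm (f (Sup k) - f (Inf k)))" for k
        have "norm (\<Sum>(x, k)\<in>P. measure lborel k *\<^sub>R f' x - (f (Sup k) - f (Inf k))) \<le> (\<Sum>(x, k)\<in>P. l k)"
        proof (rule sum_norm_le, safe)
          fix x k assume "(x, k) \<in> P"
          then show "norm (measure lborel k *\<^sub>R f' x - (f (Sup k) - f (Inf k))) \<le> l k"
            using tagged_partial_division_ofD(2)[OF Ppart, of x k]
            by (auto simp: P_def f'_def l_def norm_minus_commute)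
        qed
        also have "\<dots> = (\<Sum>k\<in>snd ` P. l k)"
        proof (rule sum.over_tagged_division_lemma[OF tagged_partial_division_of_Union_self[OF Ppart]])
          fix u v :: real assume "box u v = {}"
          then have "u \<ge> v" by auto
          then show "l (cbox u v) = 0" by (cases "u = v") (auto simp: l_def)
        qed
        also have "\<dots> \<le> (\<Sum>k\<in>snd ` P. norm (f (Sup k) - f (Inf k)))"
          by (rule sum_mono) (simp add: l_def)
        also have "\<dots> < e / 2" using H[of "snd ` P"] div small sub by blast
        finally show ?thesis .
      qed
      also have "norm (\<Sum>(x, k)\<in>Q. measure lborel k *\<^sub>R f' x - (f (Sup k) - f (Inf k))) \<le> e / 2"
      proof -
        have "norm (\<Sum>(x, k)\<in>Q. measure lborel k *\<^sub>R f' x - (f (Sup k) - f (Inf k))) \<le>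
          (\<Sum>(x, k)\<in>Q. e' * (Sup k - Inf k))"
        proof (rule sum_norm_le, safe)
          fix x K assume xK: "(x, K) \<in> Q"
          then have xKp: "(x, K) \<in> p" and xN: "x \<notin> N" by (auto simp: Q_def)
          obtain u v where k: "K = cbox u v" using tagged_division_ofD(4)[OF ptag xKp] by blast
          have xk: "x \<in> K" and kab: "K \<subseteq> {a..b}"
            using tagged_division_ofD(2,3)[OF ptag xKp] by auto
          have "u \<le> v" using xk k by auto
          have "K \<subseteq> ball x (d x)" using fine xKp xN by (fastforce simp: fine_def \<gamma>_def)
          then have uv: "norm (u - x) < d x" "norm (v - x) < d x"
            using \<open>u \<le> v\<close> unfolding k by (auto simp: subset_eq dist_real_def abs_minus_commute)
          have "norm ((v - u) *\<^sub>R g x - (f v - f u)) = norm (f u - f x - (u - x) *\<^sub>R g x - (f v - f x - (v - x) *\<^sub>R g x))"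
            by (auto simp: algebra_simps)
          also have "\<dots> \<le> norm (f u - f x - (u - x) *\<^sub>R g x) + norm (f v - f x - (v - x) *\<^sub>R g x)"
            by (rule norm_triangle_ineq4)
          also have "\<dots> \<le> e' * norm (u - x) + e' * norm (v - x)"
            using kab k xk xN uv \<open>u \<le> v\<close> by (intro add_mono d(2)) auto
          also have "\<dots> = e' * (v - u)" using xk k by (auto simp: algebra_simps)
          finally show "norm (measure lborel K *\<^sub>R f' x - (f (Sup K) - f (Inf K))) \<le> e' * (Sup K - Inf K)"
            using k \<open>u \<le> v\<close> xN by (simp add: f'_def content_real)
        qed
        also have "\<dots> \<le> (\<Sum>(x, k)\<in>p. e' * (Sup k - Inf k))"
        proof (rule sum_mono2[OF finp])
          fix xk assume "xk \<in> p - Q"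
          then have xk: "(fst xk, snd xk) \<in> p" by simp
          obtain u v where "snd xk = cbox u v" using tagged_division_ofD(4)[OF ptag xk] by blast
          moreover have "snd xk \<noteq> {}" using tagged_division_ofD(2)[OF ptag xk] by blast
          ultimately have "Inf (snd xk) \<le> Sup (snd xk)" by auto
          then show "0 \<le> (case xk of (x, k) \<Rightarrow> e' * (Sup k - Inf k))"
            using e' by (auto simp: split_beta)
        qed (auto simp: Q_def)
        also have "\<dots> = e' * (b - a)"
          using additive_tagged_division_1[OF \<open>a \<le> b\<close> ptag, of "\<lambda>x. x"]
          by (simp add: sum_distrib_left[symmetric] split_beta)
        finally show ?thesis using e' by linarith
      qed
      finally show "norm ((\<Sum>(x, k)\<in>p. measure lborel k *\<^sub>R f' x) - (f b - f a)) < e" by simp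
    qed
  qed
  then show ?thesis
    by (rule has_integral_spike[OF N, rotated]) (simp add: f'_def)
qed

subsection \<open>Differentiation of indefinite integrals\<close>

lemma negligible_uminus_image:
  fixes N :: "real set"
  assumes "negligible N"
  shows "negligible (uminus ` N)"
  by (rule negligible_differentiable_image_negligible[OF _ assms]) (auto intro: derivative_intros)

text \<open>\<open>integrable_ccontinuous_explicit\<close> concerns averages over
  \<open>{x..x + h}\<close> and so gives the derivative from the right; applied to the reflected
  function it gives the one from the left. Extension by \<open>0\<close> makes the averages
  meaningful near the endpoints.\<close>

theorem indefinite_integral_differentiable_AE:
  fixes f :: "real \<Rightarrow> 'a::euclidean_space"
  assumes f: "f integrable_on {a..b}"
  obtains N where "negligible N"
    "\<And>x. x \<in> {a..b} - N \<Longrightarrow>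
      ((\<lambda>u. integral {a..u} f) has_vector_derivative f x) (at x within {a..b})"
proof -
  define g where "g x = (if x \<in> {a..b} then f x else 0)" for x
  have gU: "g integrable_on UNIV" using f integrable_restrict_UNIV[of "{a..b}" f] unfolding g_def by blast
  have g: "g integrable_on cbox c d" for c d
    by (rule integrable_on_subcbox[OF gU]) auto
  have g': "(\<lambda>x. g (- x)) integrable_on cbox c d" for c d
    using g[of "- d" "- c"] Henstock_Kurzweil_Integration.integrable_reflect_real[where f=g and a="-d" and b="-c"] by (simp add: box_real)
  obtain N1 where N1: "negligible N1"
    "\<And>x e. \<lbrakk>x \<notin> N1; 0 < e\<rbrakk> \<Longrightarrow> \<exists>d>0. \<forall>h. 0 < h \<and> h < d \<longrightarrow>
        norm (integral (cbox x (x + h *\<^sub>R One)) g /\<^sub>R h ^ DIM(real) - g x) < e"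
    using integrable_ccontinuous_explicit[OF g] by blast
  obtain N2 where N2: "negligible N2"
    "\<And>x e. \<lbrakk>x \<notin> N2; 0 < e\<rbrakk> \<Longrightarrow> \<exists>d>0. \<forall>h. 0 < h \<and> h < d \<longrightarrow>
        norm (integral (cbox x (x + h *\<^sub>R One)) (\<lambda>x. g (- x)) /\<^sub>R h ^ DIM(real) - g (- x)) < e"
    using integrable_ccontinuous_explicit[OF g'] by blast
  show ?thesis
  proof (rule that)
    show "negligible (N1 \<union> uminus ` N2)"
      by (intro negligible_Un negligible_uminus_image N1(1) N2(1))
    fix x assume x: "x \<in> {a..b} - (N1 \<union> uminus ` N2)"
    then have "x \<notin> N1" by simp
    have "- x \<notin> N2" using x image_eqI[of x uminus "- x" N2] by auto
    have gf: "integral {u..v} g = integral {u..v} f" if "a \<le> u" "v \<le> b" for u v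
      by (rule Henstock_Kurzweil_Integration.integral_cong) (use that in \<open>auto simp: g_def\<close>)
    have fi: "f integrable_on {u..v}" if "a \<le> u" "v \<le> b" for u v
      using f that by (rule integrable_on_subinterval_real)
    show "((\<lambda>u. integral {a..u} f) has_vector_derivative f x) (at x within {a..b})"
      unfolding has_vector_derivative_def has_derivative_within_alt
    proof (intro conjI allI impI)
      show "bounded_linear (\<lambda>y. y *\<^sub>R f x)" by (rule bounded_linear_scaleR_left)
      fix e :: real assume e: "e > 0"
      obtain d1 where d1: "d1 > 0" "\<And>h. 0 < h \<Longrightarrow> h < d1 \<Longrightarrow>
          norm (integral {x..x+h} g /\<^sub>R h - g x) < e"
        using N1(2)[OF \<open>x \<notin> N1\<close> e] by (auto simp: box_real)
      obtain d2 where d2: "d2 > 0" "\<And>h. 0 < h \<Longrightarrow> h < d2 \<Longrightarrow>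
          norm (integral {-x..-x+h} (\<lambda>x. g (-x)) /\<^sub>R h - g x) < e"
        using N2(2)[OF \<open>- x \<notin> N2\<close> e] by (auto simp: box_real)
      have d2': "norm (integral {x-h..x} g /\<^sub>R h - g x) < e" if "0 < h" "h < d2" for h
        using d2(2)[OF that] Henstock_Kurzweil_Integration.integral_reflect_real[of x "x-h" g] by simp
      have scale: "norm (I - h *\<^sub>R c) \<le> e * h" if "norm (I /\<^sub>R h - c) < e" "0 < h" for I c :: 'a and h
      proof -
        have "I - h *\<^sub>R c = h *\<^sub>R (I /\<^sub>R h - c)" using that by (simp add: algebra_simps)
        then have "norm (I - h *\<^sub>R c) = h * norm (I /\<^sub>R h - c)" using that by simp
        also have "\<dots> \<le> h * e" using that by (intro mult_left_mono) auto
        finally show ?thesis by (simp add: mult.commute)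
      qed
      have gx: "g x = f x" using x by (auto simp: g_def)
      show "\<exists>d>0. \<forall>y\<in>{a..b}. norm (y - x) < d \<longrightarrow>
         norm (integral {a..y} f - integral {a..x} f - (y - x) *\<^sub>R f x) \<le> e * norm (y - x)"
      proof (intro exI conjI ballI impI)
        show "min d1 d2 > 0" using d1 d2 by simp
        fix y assume y: "y \<in> {a..b}" "norm (y - x) < min d1 d2"
        consider "y = x" | "y > x" | "y < x" by linarith
        then show "norm (integral {a..y} f - integral {a..x} f - (y - x) *\<^sub>R f x) \<le> e * norm (y - x)"
        proof cases
          case 2
          have "integral {a..y} f = integral {a..x} f + integral {x..y} f"
            using Henstock_Kurzweil_Integration.integral_combine[of a x y f] fi[of a y] 2 x y by auto
          then show ?thesis
            using scale[OF d1(2)[of "y - x"]] 2 x y gx gf[of x y] by simp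
        next
          case 3
          have "integral {a..x} f = integral {a..y} f + integral {y..x} f"
            using Henstock_Kurzweil_Integration.integral_combine[of a y x f] fi[of a x] 3 x y by auto
          moreover have "norm (integral {y..x} f - (x - y) *\<^sub>R f x) \<le> e * (x - y)"
            using scale[OF d2'[of "x - y"]] 3 x y gx gf[of y x] by simp
          ultimately show ?thesis
            using 3 by (simp add: norm_minus_commute algebra_simps)
        qed simp
      qed
    qed
  qed
qed

lemma emeasure_density_Ioc:
  fixes k :: "real \<Rightarrow> real"
  assumes "k integrable_on UNIV" "\<And>x. 0 \<le> k x" "k \<in> borel_measurable borel" "x \<le> y"
  shows "emeasure (density lborel (\<lambda>x. ennreal (k x))) {x<..y} = ennreal (integral {x..y} k)"
proof -
  have ki: "(k has_integral integral {x..y} k) {x..y}"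
    using assms integrable_on_subinterval[of k UNIV x y] by (simp add: integrable_integral)
  have "(k has_integral integral {x..y} k) {x<..y}"
    by (rule iffD1[OF has_integral_spike_set_eq ki]) (auto intro: negligible_subset[of "{x}"])
  then have "(\<integral>\<^sup>+t. ennreal (k t) * indicator {x<..y} t \<partial>lborel) = ennreal (integral {x..y} k)"
    using assms by (intro nn_integral_has_integral_lebesgue') auto
  then show ?thesis using assms by (subst emeasure_density) auto
qed

text \<open>A ray is an increasing union of half-open intervals; the uniform bound \<open>C\<close>
  supplies the finiteness on rays that \<open>measure_eqI_lessThan\<close> asks for.\<close>

lemma borel_measure_eqI_Ioc:
  fixes M N :: "real measure"
  assumes sets: "sets M = sets borel" "sets N = sets borel"
    and eq: "\<And>x y. x \<le> y \<Longrightarrow> emeasure M {x<..y} = emeasure N {x<..y}"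
    and bound: "\<And>x y. x \<le> y \<Longrightarrow> emeasure M {x<..y} \<le> ennreal C"
  shows "M = N"
proof (rule measure_eqI_lessThan[OF sets])
  have SUP: "emeasure L {x<..} = (SUP n. emeasure L {x<..x + real n})" if "sets L = sets borel" for L x
  proof -
    have "{x<..} = (\<Union>n. {x<..x + real n})"
    proof safe
      fix y assume "x < y"
      obtain n where "y - x \<le> real n" using real_arch_simple by blast
      then show "y \<in> (\<Union>n. {x<..x + real n})" using \<open>x < y\<close> by (auto intro!: exI[of _ n])
    qed auto
    moreover have "(SUP n. emeasure L {x<..x + real n}) = emeasure L (\<Union>n. {x<..x + real n})"
      by (rule SUP_emeasure_incseq) (auto simp: that incseq_def)
    ultimately show ?thesis by simp
  qed
  fix x
  show "emeasure M {x<..} < \<infinity>"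
    unfolding SUP[OF sets(1)] using SUP_least[of UNIV "\<lambda>n. emeasure M {x<..x + real n}" "ennreal C"] bound
    by (simp add: order_le_less_trans)
  show "emeasure M {x<..} = emeasure N {x<..}"
    unfolding SUP[OF sets(1)] SUP[OF sets(2)] by (intro SUP_cong refl eq) simp
qed

lemma emeasure_sum_of_measures:
  fixes M N :: "'a measure"
  assumes "sets M = sets L" "sets N = sets L"
  obtains S where "sets S = sets L" "\<And>A. A \<in> sets L \<Longrightarrow> emeasure S A = emeasure M A + emeasure N A"
proof
  let ?S = "measure_of (space L) (sets L) (\<lambda>A. emeasure M A + emeasure N A)"
  show "sets ?S = sets L" by simp
  fix A assume A: "A \<in> sets L"
  show "emeasure ?S A = emeasure M A + emeasure N A"
  proof (rule emeasure_measure_of_sigma[OF _ _ _ A])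
    show "sigma_algebra (space L) (sets L)" by (rule sets.sigma_algebra_axioms)
    show "positive (sets L) (\<lambda>A. emeasure M A + emeasure N A)" by (simp add: positive_def)
    show "countably_additive (sets L) (\<lambda>A. emeasure M A + emeasure N A)"
    proof (rule countably_additiveI)
      fix A :: "nat \<Rightarrow> 'a set" assume "range A \<subseteq> sets L" "disjoint_family A" "(\<Union>i. A i) \<in> sets L"
      then show "(\<Sum>i. emeasure M (A i) + emeasure N (A i)) = emeasure M (\<Union>i. A i) + emeasure N (\<Union>i. A i)"
        using assms by (subst suminf_add[symmetric]) (auto simp: suminf_emeasure)
    qed
  qed
qed

text \<open>Stieltjes measures live on the Borel sets, so a Lebesgue measurable \<open>k\<close> has
  to be traded for a Borel density before the measures can be compared.\<close>

lemma ex_borel_nonneg_representative: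
  fixes k :: "real \<Rightarrow> real"
  assumes k: "k integrable_on UNIV" and k0: "\<And>x. 0 \<le> k x"
  obtains k' where "k' \<in> borel_measurable borel" "\<And>x. 0 \<le> k' x" "k' integrable_on UNIV"
    "\<And>x y. integral {x..y} k' = integral {x..y} k"
proof -
  have "k \<in> borel_measurable lebesgue" using integrable_imp_measurable[OF k] by simp
  then obtain g where g: "g \<in> borel_measurable lborel" "AE x in lborel. k x = g x"
    using completion_ex_borel_measurable_real by blast
  then have "AE x in lebesgue. k x = g x" using AE_completion by blast
  then have neg: "negligible {x. k x \<noteq> g x}"
    using completion.AE_iff_null_sets[of "\<lambda>x. k x = g x"] by (simp add: negligible_iff_null_sets)
  define k' where "k' x = max 0 (g x)" for x
  have eq: "k' x = k x" if "x \<notin> {x. k x \<noteq> g x}" for x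
    using that k0[of x] by (simp add: k'_def)
  show ?thesis
  proof (rule that[of k'])
    show "k' \<in> borel_measurable borel" using g by (simp add: k'_def[abs_def])
    show "0 \<le> k' x" for x by (simp add: k'_def)
    show "k' integrable_on UNIV" by (rule integrable_spike[OF k neg]) (use eq in auto)
    show "integral {x..y} k' = integral {x..y} k" for x y
      by (rule integral_spike[OF neg]) (use eq in auto)
  qed
qed

text \<open>
  With \<open>K x = integral {a..x} k\<close>, both \<open>K + f\<close> and \<open>K - f\<close> are nondecreasing and their sum is
  \<open>2 * K\<close>, so the Stieltjes measure of \<open>K + f\<close> has a Radon-Nikodym density.
\<close>

lemma integral_bounded_imp_indefinite_integral:
  fixes f k :: "real \<Rightarrow> real"
  assumes "a \<le> b" and k: "k integrable_on {a..b}" and k0: "\<And>x. x \<in> {a..b} \<Longrightarrow> 0 \<le> k x"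
    and le: "\<And>x y. a \<le> x \<Longrightarrow> x \<le> y \<Longrightarrow> y \<le> b \<Longrightarrow> \<bar>f y - f x\<bar> \<le> integral {x..y} k"
  obtains q where "q integrable_on {a..b}" "\<And>x. x \<in> {a..b} \<Longrightarrow> f x = f a + integral {a..x} q"
proof -
  \<comment> \<open>Clamping extends \<open>f\<close> and \<open>K\<close> by constants to the whole
    line, which keeps the Stieltjes measures below finite.\<close>
  define c where "c x = max a (min b x)" for x
  have cab: "a \<le> c x" "c x \<le> b" "x \<le> y \<Longrightarrow> c x \<le> c y" for x y using \<open>a \<le> b\<close> by (auto simp: c_def)
  have c_id: "c x = x" if "x \<in> {a..b}" for x using that by (auto simp: c_def)
  define k1 where "k1 x = (if x \<in> {a..b} then k x else 0)" for x
  have k1: "k1 integrable_on UNIV" using k integrable_restrict_UNIV[of "{a..b}" k] unfolding k1_def by blast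
  have k1_0: "0 \<le> k1 x" for x using k0 by (simp add: k1_def)
  have k1i: "integral {x..y} k1 = integral {c x..c y} k" if "x \<le> y" for x y
  proof -
    have "integral {x..y} k1 = integral ({x..y} \<inter> {a..b}) k"
      unfolding k1_def integral_restrict_Int by (simp only: Int_commute)
    also have "\<dots> = integral {c x..c y} k"
    proof (cases "y < a \<or> b < x")
      case True
      then have "{x..y} \<inter> {a..b} = {}" "c x = c y" using that \<open>a \<le> b\<close> by (auto simp: c_def)
      then show ?thesis by simp
    next
      case False
      then have "{x..y} \<inter> {a..b} = {c x..c y}" using that \<open>a \<le> b\<close> by (auto simp: c_def)
      then show ?thesis by (simp only:)
    qed
    finally show ?thesis .
  qed
  obtain k' where k': "k' \<in> borel_measurable borel" "\<And>x. 0 \<le> k' x" "k' integrable_on UNIV"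
    "\<And>x y. integral {x..y} k' = integral {x..y} k1"
    using ex_borel_nonneg_representative[OF k1 k1_0] by blast
  define K where "K x = integral {a..c x} k" for x
  have Kdiff: "K y - K x = integral {c x..c y} k" if "x \<le> y" for x y
    using Henstock_Kurzweil_Integration.integral_combine[of a "c x" "c y" k] cab that
      integrable_on_subinterval_real[OF k, of a "c y"] by (simp add: K_def)
  have fle: "\<bar>f (c y) - f (c x)\<bar> \<le> K y - K x" if "x \<le> y" for x y
    unfolding Kdiff[OF that] using le cab that by blast
  have contf: "continuous_on {a..b} f"
    by (rule abs_continuous_on_imp_continuous_on[OF abs_continuous_on_integral_bound[OF k k0]]) (use le in auto)
  have contK: "continuous_on {a..b} (\<lambda>x. integral {a..x} k)" by (rule indefinite_integral_continuous_1[OF k])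
  have contc: "continuous_on UNIV c" unfolding c_def by (intro continuous_intros)
  have cc: "c ` UNIV \<subseteq> {a..b}" using cab by auto
  have cont: "continuous_on UNIV (\<lambda>x. f (c x))" "continuous_on UNIV K"
    unfolding K_def using continuous_on_compose2[OF contf contc cc] continuous_on_compose2[OF contK contc cc] by auto
  define h1 h2 where "h1 x = K x + f (c x)" and "h2 x = K x - f (c x)" for x
  have h_cont: "continuous (at_right x) h1" "continuous (at_right x) h2" for x
    unfolding h1_def h2_def using cont
    by (auto intro!: continuous_intros simp: continuous_on_eq_continuous_at continuous_at_imp_continuous_at_within)
  have h_mono: "h1 x \<le> h1 y" "h2 x \<le> h2 y" if "x \<le> y" for x y
    using fle[OF that] by (auto simp: h1_def h2_def)
  define M1 M2 where "M1 = interval_measure h1" and "M2 = interval_measure h2"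
  have M1: "emeasure M1 {x<..y} = ennreal (h1 y - h1 x)" if "x \<le> y" for x y
    unfolding M1_def using that h_mono h_cont by (intro emeasure_interval_measure_Ioc) auto
  have M2: "emeasure M2 {x<..y} = ennreal (h2 y - h2 x)" if "x \<le> y" for x y
    unfolding M2_def using that h_mono h_cont by (intro emeasure_interval_measure_Ioc) auto
  obtain S where S: "sets S = sets borel" "\<And>A. A \<in> sets borel \<Longrightarrow> emeasure S A = emeasure M1 A + emeasure M2 A"
    using emeasure_sum_of_measures[of M1 borel M2] by (auto simp: M1_def M2_def)
  let ?D = "density lborel (\<lambda>x. ennreal (2 * k' x))"
  have k2: "(\<lambda>x. 2 * k' x) integrable_on UNIV" using integrable_cmul[OF k'(3), of 2] by simp
  have D: "emeasure ?D {x<..y} = ennreal (2 * (K y - K x))" if "x \<le> y" for x y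
    using emeasure_density_Ioc[OF k2 _ _ that] k' k1i[OF that] Kdiff[OF that] by simp
  have "S = ?D"
  proof (rule borel_measure_eqI_Ioc)
    fix x y :: real assume xy: "x \<le> y"
    have "emeasure S {x<..y} = ennreal (h1 y - h1 x) + ennreal (h2 y - h2 x)"
      using S(2)[of "{x<..y}"] M1[OF xy] M2[OF xy] by simp
    also have "\<dots> = ennreal ((h1 y - h1 x) + (h2 y - h2 x))"
      using h_mono[OF xy] by (intro ennreal_plus[symmetric]) auto
    also have "\<dots> = ennreal (2 * (K y - K x))" by (simp add: h1_def h2_def)
    finally have *: "emeasure S {x<..y} = ennreal (2 * (K y - K x))" .
    then show "emeasure S {x<..y} = emeasure ?D {x<..y}" using D[OF xy] by simp
    have "K y - K x \<le> integral {a..b} k"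
      unfolding Kdiff[OF xy] using cab k k0
      by (intro integral_subset_le integrable_on_subinterval_real[OF k]) (auto intro: order_trans)
    then show "emeasure S {x<..y} \<le> ennreal (2 * integral {a..b} k)"
      unfolding * by (intro ennreal_leI) simp
  qed (use S in auto)
  \<comment> \<open>Since \<open>M1\<close> is one of two summands of \<open>S\<close>, it inherits
    the null sets of \<open>?D\<close>.\<close>
  have ac: "absolutely_continuous lborel M1"
    unfolding absolutely_continuous_def
  proof
    fix A :: "real set" assume A: "A \<in> null_sets lborel"
    then have Ab: "A \<in> sets borel" by auto
    have "absolutely_continuous lborel ?D"
      by (rule absolutely_continuousI_density) (use k' in auto)
    then have "A \<in> null_sets ?D" using A by (auto simp: absolutely_continuous_def)
    then have "emeasure S A = 0" unfolding \<open>S = ?D\<close> by auto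
    then show "A \<in> null_sets M1" using S(2)[OF Ab] Ab by (auto simp: null_sets_def M1_def)
  qed
  have setsM1: "sets M1 = sets lborel" by (simp add: M1_def)
  have sf: "sigma_finite_measure M1" unfolding M1_def
    using h_mono h_cont by (intro sigma_finite_interval_measure) auto
  define p where "p = RN_deriv lborel M1"
  have pm: "p \<in> borel_measurable borel" unfolding p_def by (metis borel_measurable_RN_deriv measurable_lborel2)
  have pd: "density lborel p = M1"
    unfolding p_def by (rule sigma_finite_measure.density_RN_deriv[OF sigma_finite_lborel ac setsM1])
  have pfin: "AE x in lborel. p x \<noteq> \<infinity>"
    unfolding p_def by (rule sigma_finite_measure.RN_deriv_finite[OF sigma_finite_lborel sf ac setsM1])
  define q where "q x = enn2real (p x)" for x
  have q: "(q has_integral (h1 x - h1 a)) {a..x}" if "x \<in> {a..b}" for x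
  proof -
    have *: "(\<integral>\<^sup>+t. ennreal (q t * indicator {a<..x} t) \<partial>lborel) = ennreal (h1 x - h1 a)"
    proof -
      have "(\<integral>\<^sup>+t. ennreal (q t * indicator {a<..x} t) \<partial>lborel) = (\<integral>\<^sup>+t. p t * indicator {a<..x} t \<partial>lborel)"
        by (rule nn_integral_cong_AE) (use pfin in \<open>auto simp: q_def indicator_def less_top split: if_splits\<close>)
      also have "\<dots> = emeasure (density lborel p) {a<..x}"
        using pm by (subst emeasure_density) auto
      also have "\<dots> = ennreal (h1 x - h1 a)"
        unfolding pd using that by (intro M1) auto
      finally show ?thesis .
    qed
    have "((\<lambda>t. q t * indicator {a<..x} t) has_integral (h1 x - h1 a)) UNIV"
      by (rule nn_integral_has_integral[OF _ _ *]) (use pm h_mono that in \<open>auto simp: q_def[abs_def]\<close>)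
    also have "(\<lambda>t. q t * indicator {a<..x} t) = (\<lambda>t. if t \<in> {a<..x} then q t else 0)"
      by (auto simp: indicator_def)
    finally have "(q has_integral (h1 x - h1 a)) {a<..x}" unfolding has_integral_restrict_UNIV .
    then show ?thesis
      by (rule iffD1[OF has_integral_spike_set_eq, rotated 2]) (auto intro: negligible_subset[of "{a}"])
  qed
  \<comment> \<open>\<open>q\<close> is the density of \<open>K + f\<close> on
    \<open>{a..b}\<close>; removing the density \<open>k\<close> of \<open>K\<close> leaves that of
    \<open>f\<close>.\<close>
  show ?thesis
  proof (rule that[of "\<lambda>x. q x - k x"])
    show "(\<lambda>x. q x - k x) integrable_on {a..b}"
      using q[of b] k \<open>a \<le> b\<close> by (intro integrable_diff) auto
    fix x assume x: "x \<in> {a..b}"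
    have "integral {a..x} (\<lambda>x. q x - k x) = (h1 x - h1 a) - integral {a..x} k"
      using q[OF x] integrable_on_subinterval_real[OF k, of a x] x
      by (subst Henstock_Kurzweil_Integration.integral_diff) (auto simp: integral_unique)
    then show "f x = f a + integral {a..x} (\<lambda>x. q x - k x)"
      using x \<open>a \<le> b\<close> by (simp add: h1_def K_def c_id)
  qed
qed

lemma integral_bounded_differentiable_AE:
  fixes f :: "real \<Rightarrow> complex" and k :: "real \<Rightarrow> real"
  assumes k: "k integrable_on {a..b}" and k0: "\<And>x. x \<in> {a..b} \<Longrightarrow> 0 \<le> k x"
    and le: "\<And>x y. a \<le> x \<Longrightarrow> x \<le> y \<Longrightarrow> y \<le> b \<Longrightarrow> norm (f y - f x) \<le> integral {x..y} k"
  obtains N f' where "negligible N"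
    "\<And>x. x \<in> {a..b} - N \<Longrightarrow> (f has_vector_derivative f' x) (at x within {a..b})"
proof (cases "a \<le> b")
  case ab: True
  have R: "\<bar>Re (f y) - Re (f x)\<bar> \<le> integral {x..y} k" "\<bar>Im (f y) - Im (f x)\<bar> \<le> integral {x..y} k"
    if "a \<le> x" "x \<le> y" "y \<le> b" for x y
    using le[OF that] abs_Re_le_cmod[of "f y - f x"] abs_Im_le_cmod[of "f y - f x"] by auto
  obtain p where p: "p integrable_on {a..b}" "\<And>x. x \<in> {a..b} \<Longrightarrow> Re (f x) = Re (f a) + integral {a..x} p"
    using integral_bounded_imp_indefinite_integral[OF ab k k0 R(1)] by blast
  obtain q where q: "q integrable_on {a..b}" "\<And>x. x \<in> {a..b} \<Longrightarrow> Im (f x) = Im (f a) + integral {a..x} q"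
    using integral_bounded_imp_indefinite_integral[OF ab k k0 R(2)] by blast
  obtain N where N: "negligible N" "\<And>x. x \<in> {a..b} - N \<Longrightarrow>
      ((\<lambda>u. integral {a..u} p) has_vector_derivative p x) (at x within {a..b})"
    using indefinite_integral_differentiable_AE[OF p(1)] by blast
  obtain N' where N': "negligible N'" "\<And>x. x \<in> {a..b} - N' \<Longrightarrow>
      ((\<lambda>u. integral {a..u} q) has_vector_derivative q x) (at x within {a..b})"
    using indefinite_integral_differentiable_AE[OF q(1)] by blast
  show ?thesis
  proof (rule that[of "N \<union> N'" "\<lambda>x. of_real (p x) + \<i> * of_real (q x)"])
    show "negligible (N \<union> N')" using N N' by simp
    fix x assume x: "x \<in> {a..b} - (N \<union> N')"
    have "((\<lambda>u. f a + (complex_of_real (integral {a..u} p) + \<i> * of_real (integral {a..u} q)))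
        has_vector_derivative (0 + (of_real (p x) + \<i> * of_real (q x)))) (at x within {a..b})"
      using x by (intro has_vector_derivative_add has_vector_derivative_const has_vector_derivative_mult_right
          bounded_linear.has_vector_derivative[OF bounded_linear_of_real] N N') auto
    then have "((\<lambda>u. f a + (complex_of_real (integral {a..u} p) + \<i> * of_real (integral {a..u} q)))
        has_vector_derivative (of_real (p x) + \<i> * of_real (q x))) (at x within {a..b})" by simp
    then show "(f has_vector_derivative (of_real (p x) + \<i> * of_real (q x))) (at x within {a..b})"
    proof (rule has_vector_derivative_transform[rotated 2])
      fix y assume "y \<in> {a..b}"
      then show "f y = f a + (complex_of_real (integral {a..y} p) + \<i> * of_real (integral {a..y} q))"
        using p(2)[of y] q(2)[of y] by (simp add: complex_eq_iff)
    qed (use x in auto)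
  qed
next
  case False
  then show ?thesis using that[of "{}"] by auto
qed

subsection \<open>Holomorphic self-maps of the disc\<close>

text \<open>This identity underlies the pseudohyperbolic distance; \<open>1 - cnj a * b\<close> is
  the denominator of the disc automorphism that sends \<open>a\<close> to \<open>0\<close>,
  evaluated at \<open>b\<close>.\<close>

lemma norm_one_minus_cnj_mult:
  "(norm (1 - cnj a * b))\<^sup>2 - (norm (b - a))\<^sup>2 = (1 - (norm a)\<^sup>2) * (1 - (norm b)\<^sup>2)"
  unfolding cmod_power2 by (simp add: algebra_simps power2_eq_square)

lemma norm_one_minus_cnj_mult_pos:
  assumes "norm a < 1" "norm b < 1"
  shows "1 - cnj a * b \<noteq> 0"
proof
  assume "1 - cnj a * b = 0"
  then have "norm (cnj a * b) = 1" by simp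
  moreover have "norm a * norm b < 1 * 1"
    using assms by (intro mult_strict_mono') auto
  ultimately show False by (simp add: norm_mult)
qed

text \<open>Composing \<open>f\<close> with disc automorphisms that move \<open>w\<close> and
  \<open>f w\<close> to \<open>0\<close> reduces the claim to the Schwarz lemma. The form without
  quotients can be squared and expanded, which is how it is used below.\<close>

lemma Schwarz_Pick:
  assumes f: "hol_self_map f" and z: "z \<in> unit_disc" and w: "w \<in> unit_disc"
  shows "norm (f z - f w) * norm (1 - cnj w * z) \<le> norm (z - w) * norm (1 - cnj (f w) * f z)"
proof -
  define g where "g = Moebius_function 0 (f w) \<circ> f \<circ> Moebius_function 0 (- w)"
  have w1: "norm w < 1" "norm z < 1" using z w by auto
  have fD: "norm (f u) < 1" if "norm u < 1" for u
    using f that unfolding hol_self_map_def by (metis image_subset_iff mem_ball_0)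
  have fh: "f holomorphic_on ball 0 1" using f by (simp add: hol_self_map_def)
  define \<zeta> where "\<zeta> = Moebius_function 0 w z"
  have \<zeta>: "norm \<zeta> < 1" unfolding \<zeta>_def by (rule Moebius_function_norm_lt_1[OF w1])
  have inv: "Moebius_function 0 (- w) \<zeta> = z"
    unfolding \<zeta>_def by (rule Moebius_function_compose) (use w1 in auto)
  have m: "norm (Moebius_function 0 (- w) u) < 1" if "norm u < 1" for u
    using w1 that by (intro Moebius_function_norm_lt_1) auto
  have "g holomorphic_on ball 0 1"
    unfolding g_def
  proof (rule holomorphic_on_compose_gen)
    show "Moebius_function 0 (- w) holomorphic_on ball 0 1"
      using w1 by (intro Moebius_function_holomorphic) simp
    show "Moebius_function 0 (f w) \<circ> f holomorphic_on ball 0 1"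
      using fD w1 by (intro holomorphic_on_compose_gen[OF fh Moebius_function_holomorphic]) auto
    show "Moebius_function 0 (- w) ` ball 0 1 \<subseteq> ball 0 1" using m by auto
  qed
  moreover have "g 0 = 0"
    by (simp add: g_def Moebius_function_of_zero Moebius_function_eq_zero)
  moreover have "norm (g u) < 1" if "norm u < 1" for u
    unfolding g_def o_def using m[OF that] fD w1 by (intro Moebius_function_norm_lt_1) auto
  ultimately have "norm (g \<zeta>) \<le> norm \<zeta>" using \<zeta> by (intro Schwarz_Lemma(1)) auto
  then have "norm ((f z - f w) / (1 - cnj (f w) * f z)) \<le> norm ((z - w) / (1 - cnj w * z))"
    by (simp add: g_def inv) (simp add: \<zeta>_def Moebius_function_simple)
  then show ?thesis
    using norm_one_minus_cnj_mult_pos[OF w1] norm_one_minus_cnj_mult_pos[OF fD[OF w1(1)] fD[OF w1(2)]]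
    by (simp add: norm_divide divide_simps mult_ac)
qed

text \<open>In \<open>Schwarz_Pick\<close> the factor on the left is at least \<open>1 - r\<close>
  and the one on the right at most \<open>2\<close>. Only one of the two points is confined to a
  smaller disc; the other can be an image point over which there is no control.\<close>

lemma hol_self_map_Lipschitz:
  assumes f: "hol_self_map f" and z: "norm z \<le> r" "r < 1" and w: "w \<in> unit_disc"
  shows "norm (f z - f w) \<le> 2 / (1 - r) * norm (z - w)"
proof -
  have zD: "z \<in> unit_disc" using z by auto
  have fD: "norm (f u) < 1" if "u \<in> unit_disc" for u
    using f that unfolding hol_self_map_def by (metis image_subset_iff mem_ball_0)
  have "norm (cnj w * z) \<le> 1 * r" using z w unfolding norm_mult by (intro mult_mono) auto
  then have 1: "1 - r \<le> norm (1 - cnj w * z)"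
    using norm_triangle_ineq2[of 1 "cnj w * z"] by simp
  have "norm (cnj (f w) * f z) \<le> 1 * 1"
    using fD[OF zD] fD[OF w] unfolding norm_mult by (intro mult_mono) auto
  then have 2: "norm (1 - cnj (f w) * f z) \<le> 2"
    using norm_triangle_ineq4[of 1 "cnj (f w) * f z"] by simp
  have "norm (f z - f w) * (1 - r) \<le> norm (f z - f w) * norm (1 - cnj w * z)"
    using 1 by (rule mult_left_mono) simp
  also have "\<dots> \<le> norm (z - w) * norm (1 - cnj (f w) * f z)" by (rule Schwarz_Pick[OF f zD w])
  also have "\<dots> \<le> norm (z - w) * 2" using 2 by (rule mult_left_mono) simp
  finally show ?thesis using z by (simp add: field_simps)
qed

text \<open>With \<open>a = f 0\<close>, the Schwarz-Pick inequality bounds the ratio from below by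
  \<open>(1 - norm a) / (1 + norm a)\<close>, which is at least \<open>1 / 3\<close> when
  \<open>norm a \<le> 1 / 2\<close>. A fixed factor per map makes the estimate iterable.\<close>

lemma hol_self_map_growth:
  assumes f: "hol_self_map f" and f0: "norm (f 0) \<le> 1 / 2" and z: "z \<in> unit_disc"
  shows "1 - (norm (f z))\<^sup>2 \<ge> (1 - (norm z)\<^sup>2) / 3"
proof -
  have fz: "norm (f z) < 1"
    using f z unfolding hol_self_map_def by (metis image_subset_iff mem_ball_0)
  define a where "a = f 0"
  define A where "A = norm (1 - cnj a * f z)"
  have "norm (f z - a) \<le> norm z * A"
    using Schwarz_Pick[OF f z, of 0] by (simp add: a_def A_def)
  then have "(norm (f z - a))\<^sup>2 \<le> (norm z * A)\<^sup>2" by (intro power_mono) auto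
  then have 1: "(1 - (norm z)\<^sup>2) * A\<^sup>2 \<le> (1 - (norm a)\<^sup>2) * (1 - (norm (f z))\<^sup>2)"
    using norm_one_minus_cnj_mult[of a "f z"] by (simp add: A_def algebra_simps)
  have "norm (cnj a * f z) \<le> norm a * 1" using fz unfolding norm_mult by (intro mult_mono) auto
  then have "1 - norm a \<le> A"
    using norm_triangle_ineq2[of 1 "cnj a * f z"] by (simp add: A_def)
  then have 2: "(1 - norm a)\<^sup>2 \<le> A\<^sup>2" using f0 by (intro power_mono) (auto simp: a_def)
  have 3: "1 - (norm z)\<^sup>2 \<ge> 0" using z by (simp add: abs_square_le_1)
  have "(1 - (norm z)\<^sup>2) * (1 - norm a)\<^sup>2 \<le> (1 - (norm a)\<^sup>2) * (1 - (norm (f z))\<^sup>2)"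
    using mult_left_mono[OF 2 3] 1 by linarith
  then have "(1 - norm a) * ((1 - (norm z)\<^sup>2) * (1 - norm a)) \<le> (1 - norm a) * ((1 + norm a) * (1 - (norm (f z))\<^sup>2))"
    by (simp add: power2_eq_square algebra_simps)
  then have 4: "(1 - (norm z)\<^sup>2) * (1 - norm a) \<le> (1 + norm a) * (1 - (norm (f z))\<^sup>2)"
    by (rule mult_left_le_imp_le) (use f0 in \<open>auto simp: a_def\<close>)
  have "(1 - (norm z)\<^sup>2) * (1 / 2) \<le> (1 - (norm z)\<^sup>2) * (1 - norm a)"
    using f0 3 by (intro mult_left_mono) (auto simp: a_def)
  also note 4
  also have "(1 + norm a) * (1 - (norm (f z))\<^sup>2) \<le> (3 / 2) * (1 - (norm (f z))\<^sup>2)"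
    using f0 fz by (intro mult_right_mono) (auto simp: a_def abs_square_le_1)
  finally show ?thesis by simp
qed

text \<open>The Cayley transform sending \<open>p w\<close> to \<open>0\<close> turns
  \<open>p\<close> into a self-map of the disc, to which Schwarz-Pick at \<open>w\<close> applies;
  the triangle inequality then compares the two norms.\<close>

lemma Harnack_disc:
  assumes p: "p holomorphic_on unit_disc" and Re_p: "\<And>z. z \<in> unit_disc \<Longrightarrow> 0 \<le> Re (p z)"
    and z: "z \<in> unit_disc" and w: "w \<in> unit_disc"
  shows "norm (p z) * (norm (1 - cnj w * z) - norm (z - w)) \<le> norm (p w) * (norm (1 - cnj w * z) + norm (z - w))"
proof -
  \<comment> \<open>Adding \<open>e > 0\<close> makes the real part strictly positive, so that the
    Cayley transform has no poles and maps into the open disc; \<open>e\<close> tends to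
    \<open>0\<close> at the end.\<close>
  have *: "norm (p z + of_real e) * (norm (1 - cnj w * z) - norm (z - w)) \<le>
      norm (p w + of_real e) * (norm (1 - cnj w * z) + norm (z - w))" if e: "e > 0" for e :: real
  proof -
    define q where "q u = p u + of_real e" for u
    have q: "q holomorphic_on unit_disc" unfolding q_def by (intro holomorphic_intros p)
    have Re_q: "0 < Re (q u)" if "u \<in> unit_disc" for u
      using Re_p[OF that] e by (simp add: q_def)
    have lt: "norm (q u - q w) < norm (q u + cnj (q w))" if "u \<in> unit_disc" for u
    proof -
      have "(norm (q u + cnj (q w)))\<^sup>2 - (norm (q u - q w))\<^sup>2 = 4 * (Re (q u) * Re (q w))"
        unfolding cmod_power2 by (simp add: algebra_simps power2_eq_square)
      moreover have "0 < Re (q u) * Re (q w)" using Re_q[OF that] Re_q[OF w] by simp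
      ultimately have "(norm (q u - q w))\<^sup>2 < (norm (q u + cnj (q w)))\<^sup>2" by linarith
      then show ?thesis by (rule power2_less_imp_less) simp
    qed
    define g where "g u = (q u - q w) / (q u + cnj (q w))" for u
    have nz: "q u + cnj (q w) \<noteq> 0" if "u \<in> unit_disc" for u using lt[OF that] by force
    have g: "hol_self_map g"
      unfolding hol_self_map_def
    proof
      show "g holomorphic_on unit_disc" unfolding g_def using nz by (intro holomorphic_intros q) auto
      have "norm (g u) < 1" if "u \<in> unit_disc" for u
        using lt[OF that] by (simp add: g_def norm_divide divide_simps)
      then show "g ` unit_disc \<subseteq> unit_disc" by auto
    qed
    have "norm (g z) * norm (1 - cnj w * z) \<le> norm (z - w)"
      using Schwarz_Pick[OF g z w] by (simp add: g_def)
    then have "norm (q z - q w) * norm (1 - cnj w * z) \<le> norm (z - w) * norm (q z + cnj (q w))"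
      using nz[OF z] by (simp add: g_def norm_divide divide_simps mult_ac)
    also have "\<dots> \<le> norm (z - w) * (norm (q z) + norm (q w))"
      using norm_triangle_ineq[of "q z" "cnj (q w)"] by (intro mult_left_mono) auto
    finally have "norm (q z - q w) * norm (1 - cnj w * z) \<le> norm (z - w) * (norm (q z) + norm (q w))" .
    moreover have "(norm (q z) - norm (q w)) * norm (1 - cnj w * z) \<le> norm (q z - q w) * norm (1 - cnj w * z)"
      by (intro mult_right_mono norm_triangle_ineq2) auto
    ultimately have "norm (q z) * (norm (1 - cnj w * z) - norm (z - w)) \<le>
      norm (q w) * (norm (1 - cnj w * z) + norm (z - w))"
      by (simp add: algebra_simps)
    then show ?thesis unfolding q_def .
  qed
  have lim: "((\<lambda>e. norm (u + of_real e)) \<longlongrightarrow> norm (u + of_real 0)) (at_right 0)" for u :: complex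
    by (intro tendsto_intros)
  show ?thesis
  proof (rule tendsto_le[of "at_right (0::real)"])
    show "((\<lambda>e. norm (p w + of_real e) * (norm (1 - cnj w * z) + norm (z - w))) \<longlongrightarrow>
        norm (p w) * (norm (1 - cnj w * z) + norm (z - w))) (at_right 0)"
      using lim[of "p w"] by (intro tendsto_mult_right) simp
    show "((\<lambda>e. norm (p z + of_real e) * (norm (1 - cnj w * z) - norm (z - w))) \<longlongrightarrow>
        norm (p z) * (norm (1 - cnj w * z) - norm (z - w))) (at_right 0)"
      using lim[of "p z"] by (intro tendsto_mult_right) simp
    show "\<forall>\<^sub>F e in at_right 0. norm (p z + of_real e) * (norm (1 - cnj w * z) - norm (z - w)) \<le>
      norm (p w + of_real e) * (norm (1 - cnj w * z) + norm (z - w))"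
      using * by (auto simp: eventually_at_right_less intro: eventually_mono[OF eventually_at_right_less])
  qed simp
qed

text \<open>
  The Berkson-Porta condition: writing \<open>H z = a - cnj a * z\<^sup>2 - z * p z\<close> with \<open>a = H 0\<close>, the
  inequality says exactly that \<open>Re (p z) \<ge> 0\<close>.
\<close>

definition inward_pointing :: "(complex \<Rightarrow> complex) \<Rightarrow> bool" where
  "inward_pointing H \<longleftrightarrow>
    (\<forall>z\<in>unit_disc. Re (cnj z * H z) \<le> (1 - (norm z)\<^sup>2) * Re (cnj z * H 0))"

text \<open>The inequality for generators holds already for finite displacements. By Schwarz-Pick at
  \<open>0\<close>, \<open>f z\<close> lies in an explicit Euclidean disc, and the largest value of
  \<open>Re (cnj z * v)\<close> for \<open>v\<close> in that disc is below the required
  bound.\<close>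

lemma inward_pointing_displacement:
  assumes f: "hol_self_map f"
  shows "inward_pointing (\<lambda>z. f z - z)"
  unfolding inward_pointing_def
proof
  fix z assume z: "z \<in> unit_disc"
  have fD: "norm (f u) < 1" if "u \<in> unit_disc" for u
    using f that unfolding hol_self_map_def by (metis image_subset_iff mem_ball_0)
  define a where "a = f 0"
  define x where "x = (norm z)\<^sup>2"
  define \<alpha> where "\<alpha> = (norm a)\<^sup>2"
  define t where "t = Re (cnj z * a)"
  have a1: "norm a < 1" using fD[of 0] by (simp add: a_def)
  have x: "0 \<le> x" "x < 1" using z by (auto simp: x_def abs_square_less_1)
  have \<alpha>: "0 \<le> \<alpha>" "\<alpha> < 1" using a1 by (auto simp: \<alpha>_def abs_square_less_1)
  have \<alpha>x: "\<alpha> * x < 1" using mult_strict_mono'[of \<alpha> 1 x 1] x \<alpha> by simp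
  have t1: "t \<le> 1"
  proof -
    have "t \<le> norm (cnj z * a)" unfolding t_def by (rule complex_Re_le_cmod)
    also have "\<dots> \<le> 1 * 1" unfolding norm_mult using z a1 by (intro mult_mono) auto
    finally show ?thesis by simp
  qed
  have "norm (f z - a) \<le> norm z * norm (1 - cnj a * f z)"
    using Schwarz_Pick[OF f z, of 0] by (simp add: a_def)
  then have SP: "(norm (f z - a))\<^sup>2 \<le> x * (norm (1 - cnj a * f z))\<^sup>2"
    unfolding x_def power_mult_distrib[symmetric] by (intro power_mono) auto
  \<comment> \<open>This says that \<open>f z\<close> lies in the Euclidean disc with centre \<open>c\<close> and radius \<open>\<rho>\<close>.\<close>
  define c where "c = of_real ((1 - x) / (1 - \<alpha> * x)) * a"
  define \<rho> where "\<rho> = norm z * (1 - \<alpha>) / (1 - \<alpha> * x)"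
  have "(1 - \<alpha> * x)\<^sup>2 * (norm (f z - c))\<^sup>2 = (norm (of_real (1 - \<alpha> * x) * f z - of_real (1 - x) * a))\<^sup>2"
  proof -
    define k where "k = 1 - \<alpha> * x"
    have "k \<noteq> 0" using \<alpha>x by (simp add: k_def)
    have "of_real k * c = of_real (k * ((1 - x) / k)) * a"
      unfolding c_def k_def[symmetric] of_real_mult by (rule mult.assoc[symmetric])
    also have "k * ((1 - x) / k) = 1 - x" using \<open>k \<noteq> 0\<close> by simp
    finally have "of_real k * f z - of_real (1 - x) * a = of_real k * (f z - c)"
      by (simp only: right_diff_distrib)
    then show ?thesis
      unfolding k_def[symmetric] by (simp only: norm_mult power_mult_distrib norm_of_real power2_abs)
  qed
  \<comment> \<open>Completing the square: the bracket is the defect in \<open>SP\<close>, hence not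
    positive.\<close>
  also have "\<dots> = (1 - \<alpha> * x) * ((norm (f z - a))\<^sup>2 - x * (norm (1 - cnj a * f z))\<^sup>2) + x * (1 - \<alpha>)\<^sup>2"
    unfolding \<alpha>_def cmod_power2 by (simp add: algebra_simps power2_eq_square)
  also have "\<dots> \<le> x * (1 - \<alpha>)\<^sup>2"
    using SP \<alpha>x by (simp add: mult_nonneg_nonpos)
  also have "\<dots> = (1 - \<alpha> * x)\<^sup>2 * \<rho>\<^sup>2"
    using \<alpha>x by (simp add: \<rho>_def x_def power_mult_distrib power_divide)
  finally have "(norm (f z - c))\<^sup>2 \<le> \<rho>\<^sup>2" using \<alpha>x by (simp add: mult_le_cancel_left)
  then have fc: "norm (f z - c) \<le> \<rho>"
    by (rule power2_le_imp_le) (use \<alpha>x \<alpha> in \<open>simp add: \<rho>_def\<close>)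
  have "Re (cnj z * f z) = Re (cnj z * c) + Re (cnj z * (f z - c))" by (simp add: algebra_simps)
  also have "Re (cnj z * (f z - c)) \<le> norm (cnj z * (f z - c))" by (rule complex_Re_le_cmod)
  also have "\<dots> \<le> norm z * \<rho>" unfolding norm_mult using fc by (simp add: mult_left_mono)
  also have "Re (cnj z * c) = (1 - x) / (1 - \<alpha> * x) * t"
    unfolding c_def t_def by (simp add: algebra_simps add_divide_distrib diff_divide_distrib)
  also have "norm z * \<rho> = x * (1 - \<alpha>) / (1 - \<alpha> * x)" by (simp add: \<rho>_def x_def power2_eq_square)
  also have "(1 - x) / (1 - \<alpha> * x) * t + x * (1 - \<alpha>) / (1 - \<alpha> * x) \<le> (1 - x) * t + x"
  proof -
    \<comment> \<open>After clearing denominators the two bounds differ by a product of nonnegative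
      factors, the last one by \<open>t1\<close>.\<close>
    have "((1 - x) * t + x) * (1 - \<alpha> * x) - ((1 - x) * t + x * (1 - \<alpha>)) = \<alpha> * x * (1 - x) * (1 - t)"
      by (simp add: algebra_simps)
    moreover have "0 \<le> \<alpha> * x * (1 - x) * (1 - t)" using x \<alpha> t1 by simp
    ultimately show ?thesis using \<alpha>x by (simp add: divide_simps)
  qed
  finally have "Re (cnj z * f z) \<le> (1 - x) * t + x" by simp
  moreover have "Re (cnj z * z) = x" unfolding x_def cmod_power2 by (simp add: power2_eq_square)
  ultimately show "Re (cnj z * (f z - z)) \<le> (1 - (norm z)\<^sup>2) * Re (cnj z * (f 0 - 0))"
    by (simp add: right_diff_distrib x_def t_def a_def)
qed

text \<open>For \<open>H z = f z - z\<close>, the function \<open>p\<close> in the Berkson-Porta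
  form has nonnegative real part, so Harnack bounds \<open>p z\<close> by \<open>p (1/2)\<close>,
  and \<open>p (1/2)\<close> is a combination of \<open>H 0\<close> and \<open>H (1/2)\<close>. The
  second point must differ from \<open>0\<close>, where \<open>p\<close> involves the derivative of
  \<open>H\<close> instead of a value.\<close>

lemma hol_self_map_displacement:
  assumes f: "hol_self_map f" and z: "norm z \<le> r" "r < 1"
  shows "norm (f z - z) \<le> 38 / (1 - r\<^sup>2) * (norm (f 0) + norm (f (1/2) - 1/2))"
proof -
  define H where "H z = f z - z" for z
  define a where "a = H 0"
  have fh: "f holomorphic_on unit_disc" using f by (simp add: hol_self_map_def)
  have Hh: "H holomorphic_on unit_disc" unfolding H_def by (intro holomorphic_intros fh)
  have inw: "inward_pointing H" unfolding H_def by (rule inward_pointing_displacement[OF f])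
  define p0 where "p0 z = (if z = 0 then deriv H 0 else (H z - H 0) / (z - 0))" for z
  define p where "p z = - p0 z - cnj a * z" for z
  have p0h: "p0 holomorphic_on unit_disc"
    unfolding p0_def by (rule pole_lemma_open[OF Hh open_ball])
  have ph: "p holomorphic_on unit_disc" unfolding p_def by (intro holomorphic_intros p0h)
  have Hp: "H z = a - cnj a * z\<^sup>2 - z * p z" for z
    by (simp add: p_def p0_def a_def field_simps power2_eq_square)
  have Re_p: "0 \<le> Re (p z)" if z: "z \<in> unit_disc" "z \<noteq> 0" for z
  proof -
    have "Re (cnj z * H z) = (1 - (norm z)\<^sup>2) * Re (cnj z * a) - (norm z)\<^sup>2 * Re (p z)"
      unfolding Hp[of z] cmod_power2 by (simp add: algebra_simps power2_eq_square)
    moreover have "Re (cnj z * H z) \<le> (1 - (norm z)\<^sup>2) * Re (cnj z * a)"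
      using inw z(1) by (simp add: inward_pointing_def a_def)
    ultimately have "0 \<le> (norm z)\<^sup>2 * Re (p z)" by linarith
    then show ?thesis using z(2) by (simp add: zero_le_mult_iff)
  qed
  \<comment> \<open>The Berkson-Porta inequality is void at \<open>0\<close>, so the sign there
    comes from continuity.\<close>
  have "0 \<le> Re (p 0)"
  proof (rule tendsto_lowerbound[of _ _ "at 0"])
    have "continuous_on unit_disc p" using ph by (rule holomorphic_on_imp_continuous_on)
    then have "isCont p 0" by (simp add: continuous_on_eq_continuous_at)
    then show "((\<lambda>z. Re (p z)) \<longlongrightarrow> Re (p 0)) (at 0)" by (intro tendsto_Re) (simp add: isCont_def)
    show "\<forall>\<^sub>F z in at 0. 0 \<le> Re (p z)"
      unfolding eventually_at using Re_p by (intro exI[of _ 1]) (auto simp: dist_norm)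
  qed simp
  then have Re_p': "0 \<le> Re (p z)" if "z \<in> unit_disc" for z using Re_p[OF that] by (cases "z = 0") auto
  have zD: "z \<in> unit_disc" using z by auto
  define A where "A = norm (1 - cnj (1/2) * z)"
  define B where "B = norm (z - 1/2)"
  define S where "S = norm (f 0) + norm (f (1/2) - 1/2)"
  have r0: "0 \<le> r" using z norm_ge_zero order_trans by blast
  then have r1: "0 < 1 - r\<^sup>2" "1 - r\<^sup>2 \<le> 1" using z by (auto simp: abs_square_less_1)
  have zr: "(norm z)\<^sup>2 \<le> r\<^sup>2" using z by (intro power_mono) auto
  \<comment> \<open>\<open>A\<close> and \<open>B\<close> are the two norms in Harnack's inequality
    for the point \<open>1/2\<close>; the factor is \<open>1 - (1/2)^2\<close>. Dividing the
    difference of squares by \<open>A + B \<le> 3\<close> bounds \<open>A - B\<close> from below by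
    \<open>(1 - r^2) / 4\<close>, which produces the constant \<open>12\<close>.\<close>
  have AB: "A\<^sup>2 - B\<^sup>2 = 3 / 4 * (1 - (norm z)\<^sup>2)"
    unfolding A_def B_def norm_one_minus_cnj_mult by (simp add: norm_divide power2_eq_square)
  have AB3: "A + B \<le> 3"
  proof -
    have "A \<le> 1 + norm (cnj (1/2) * z)" unfolding A_def using norm_triangle_ineq4[of 1 "cnj (1/2) * z"] by simp
    also have "norm (cnj (1/2) * z) \<le> 1 / 2" using zD by (simp add: norm_mult norm_divide)
    finally have "A \<le> 3 / 2" by simp
    moreover have "B \<le> 3 / 2" unfolding B_def using norm_triangle_ineq4[of z "1/2"] zD by (simp add: norm_divide)
    ultimately show ?thesis by simp
  qed
  have AB0: "0 \<le> A + B" by (simp add: A_def B_def)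
  have "3 / 4 * (1 - r\<^sup>2) \<le> (A - B) * (A + B)"
  proof -
    have "3 / 4 * (1 - r\<^sup>2) \<le> A\<^sup>2 - B\<^sup>2" unfolding AB using zr by (intro mult_left_mono) auto
    then show ?thesis by (simp add: power2_eq_square algebra_simps)
  qed
  note X = this
  have "0 < A - B"
  proof (rule ccontr)
    assume "\<not> 0 < A - B"
    then have "(A - B) * (A + B) \<le> 0" using AB0 by (intro mult_nonpos_nonneg) auto
    moreover have "0 < 3 / 4 * (1 - r\<^sup>2)" using r1 by simp
    then have "0 < (A - B) * (A + B)" using X by (rule less_le_trans)
    ultimately show False by (meson leD)
  qed
  then have "(A - B) * (A + B) \<le> (A - B) * 3" using AB3 by (intro mult_left_mono) auto
  then have "3 / 4 * (1 - r\<^sup>2) \<le> (A - B) * 3" by (rule order_trans[OF X])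
  then have AmB: "(1 - r\<^sup>2) / 4 \<le> A - B" by (simp add: field_simps)
  have "norm (p z) * ((1 - r\<^sup>2) / 4) \<le> norm (p z) * (A - B)" using AmB by (rule mult_left_mono) simp
  also have "\<dots> \<le> norm (p (1/2)) * (A + B)"
    unfolding A_def B_def by (rule Harnack_disc[OF ph Re_p' zD]) (auto simp: norm_divide)
  also have "\<dots> \<le> norm (p (1/2)) * 3" using AB3 by (rule mult_left_mono) simp
  finally have pz: "norm (p z) \<le> 12 / (1 - r\<^sup>2) * norm (p (1/2))" using r1 by (simp add: field_simps)
  have aS: "norm a \<le> S" by (simp add: a_def H_def S_def)
  \<comment> \<open>The coefficients of the two displacements add up to \<open>5/2\<close> and
    \<open>2\<close>, both at most \<open>3\<close>. Hence \<open>36 = 12 * 3\<close>, and the terms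
    with \<open>a\<close> in the formula for \<open>H z\<close> raise this to
    \<open>38\<close>.\<close>
  have "p (1/2) = 2 * a - 2 * H (1/2) - cnj a * (1/2)"
    by (simp add: p_def p0_def a_def)
  also have "norm \<dots> \<le> norm (2 * a - 2 * H (1/2)) + norm (cnj a * (1/2))" by (rule norm_triangle_ineq4)
  also have "norm (2 * a - 2 * H (1/2)) \<le> norm (2 * a) + norm (2 * H (1/2))" by (rule norm_triangle_ineq4)
  finally have "norm (p (1/2)) \<le> norm (2 * a) + norm (2 * H (1/2)) + norm (cnj a * (1/2))" by simp
  also have "norm (2 * a) = 2 * norm (f 0)" unfolding norm_mult by (simp add: a_def H_def)
  also have "norm (2 * H (1/2)) = 2 * norm (f (1/2) - 1/2)" unfolding norm_mult by (simp add: H_def)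
  also have "norm (cnj a * (1/2)) = norm (f 0) / 2" unfolding norm_mult by (simp add: a_def H_def)
  finally have "norm (p (1/2)) \<le> 3 * S"
    using norm_ge_zero[of "f 0"] norm_ge_zero[of "f (1/2) - 1/2"] unfolding S_def by argo
  then have "12 / (1 - r\<^sup>2) * norm (p (1/2)) \<le> 12 / (1 - r\<^sup>2) * (3 * S)"
    using r1 by (intro mult_left_mono) auto
  with pz have pz': "norm (p z) \<le> 36 / (1 - r\<^sup>2) * S" by simp
  have "norm (H z) \<le> norm (a - cnj a * z\<^sup>2) + norm (z * p z)" unfolding Hp[of z] by (rule norm_triangle_ineq4)
  also have "norm (a - cnj a * z\<^sup>2) \<le> norm a + norm (cnj a * z\<^sup>2)" by (rule norm_triangle_ineq4)
  also have "norm (cnj a * z\<^sup>2) \<le> norm a * 1"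
    unfolding norm_mult norm_power using zD by (intro mult_mono) (auto simp: abs_square_le_1)
  also have "norm (z * p z) \<le> 1 * norm (p z)" unfolding norm_mult using zD by (intro mult_right_mono) auto
  finally have "norm (H z) \<le> 2 * S + 36 / (1 - r\<^sup>2) * S" using pz' aS by simp
  also have "2 * S \<le> 2 / (1 - r\<^sup>2) * S"
  proof (rule mult_right_mono)
    show "2 \<le> 2 / (1 - r\<^sup>2)" using r1 by (simp add: field_simps)
  qed (simp add: S_def)
  finally have "norm (H z) \<le> 2 / (1 - r\<^sup>2) * S + 36 / (1 - r\<^sup>2) * S" by simp
  also have "\<dots> = 38 / (1 - r\<^sup>2) * S" by (simp add: add_divide_distrib[symmetric] field_simps)
  finally show ?thesis by (simp add: H_def S_def)
qed

text \<open>The squared Schwarz-Pick inequality at \<open>0\<close> for \<open>\<psi> h\<close> is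
  an equality at order zero in \<open>h\<close>; after division by \<open>h\<close> the first-order
  terms give the claim. It serves both the generators of semigroups and the maps
  \<open>\<phi> t (t + h)\<close> of an evolution family.\<close>

lemma inward_pointing_limit:
  assumes self: "\<forall>\<^sub>F h in at_right 0. hol_self_map (\<psi> h)"
    and lim: "\<And>z. z \<in> unit_disc \<Longrightarrow> ((\<lambda>h. (\<psi> h z - z) /\<^sub>R h) \<longlongrightarrow> H z) (at_right 0)"
  shows "inward_pointing H"
  unfolding inward_pointing_def
proof
  fix z assume z: "z \<in> unit_disc"
  define p where "p h = (\<psi> h z - z) /\<^sub>R h" for h
  define q where "q h = (\<psi> h 0 - 0) /\<^sub>R h" for h
  have p: "(p \<longlongrightarrow> H z) (at_right 0)" unfolding p_def using lim[OF z] .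
  have q: "(q \<longlongrightarrow> H 0) (at_right 0)" unfolding q_def using lim[of 0] by simp
  have id: "((\<lambda>h. of_real h) \<longlongrightarrow> complex_of_real 0) (at_right 0)" by (intro tendsto_intros)
  have id': "((\<lambda>h. h) \<longlongrightarrow> (0::real)) (at_right 0)" by (intro tendsto_intros)
  \<comment> \<open>This is the limit of the divided inequality, with its vanishing terms kept so
    that both sides have the shape of the expressions converging to them.\<close>
  have "2 * Re (cnj z * (H z - H 0)) + 0 * (norm (H z - H 0))\<^sup>2 \<le>
     (norm z)\<^sup>2 * (- 2 * Re (cnj (H 0) * (z + of_real 0 * H z)) + 0 * (norm (cnj (H 0) * (z + of_real 0 * H z)))\<^sup>2)"
  proof (rule tendsto_le[of "at_right (0::real)"])
    show "((\<lambda>h. 2 * Re (cnj z * (p h - q h)) + h * (norm (p h - q h))\<^sup>2) \<longlongrightarrow>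
       2 * Re (cnj z * (H z - H 0)) + 0 * (norm (H z - H 0))\<^sup>2) (at_right 0)"
      by (intro tendsto_intros p q id id')
    show "((\<lambda>h. (norm z)\<^sup>2 * (- 2 * Re (cnj (q h) * (z + of_real h * p h)) + h * (norm (cnj (q h) * (z + of_real h * p h)))\<^sup>2)) \<longlongrightarrow>
       (norm z)\<^sup>2 * (- 2 * Re (cnj (H 0) * (z + of_real 0 * H z)) + 0 * (norm (cnj (H 0) * (z + of_real 0 * H z)))\<^sup>2)) (at_right 0)"
      by (intro tendsto_intros p q id id')
    show "\<forall>\<^sub>F h in at_right 0. 2 * Re (cnj z * (p h - q h)) + h * (norm (p h - q h))\<^sup>2 \<le>
       (norm z)\<^sup>2 * (- 2 * Re (cnj (q h) * (z + of_real h * p h)) + h * (norm (cnj (q h) * (z + of_real h * p h)))\<^sup>2)"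
      using self eventually_at_right_less
    proof eventually_elim
      case (elim h)
      define x where "x = p h - q h"
      define y where "y = cnj (q h) * (z + of_real h * p h)"
      have 1: "\<psi> h z - \<psi> h 0 = z + of_real h * x"
        using elim(2) by (simp add: x_def p_def q_def scaleR_conv_of_real field_simps)
      have 2: "1 - cnj (\<psi> h 0) * \<psi> h z = 1 - of_real h * y"
        using elim(2) by (simp add: y_def p_def q_def scaleR_conv_of_real field_simps)
      have "norm (z + of_real h * x) \<le> norm z * norm (1 - of_real h * y)"
        using Schwarz_Pick[OF elim(1) z, of 0] 1 2 by simp
      then have "(norm (z + of_real h * x))\<^sup>2 \<le> (norm z)\<^sup>2 * (norm (1 - of_real h * y))\<^sup>2"
        unfolding power_mult_distrib[symmetric] by (intro power_mono) auto
      moreover have "(norm (z + of_real h * x))\<^sup>2 = (norm z)\<^sup>2 + h * (2 * Re (cnj z * x) + h * (norm x)\<^sup>2)"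
        unfolding cmod_power2 by (simp add: algebra_simps power2_eq_square)
      moreover have "(norm (1 - of_real h * y))\<^sup>2 = 1 + h * (- 2 * Re y + h * (norm y)\<^sup>2)"
        unfolding cmod_power2 by (simp add: algebra_simps power2_eq_square)
      ultimately have "(norm z)\<^sup>2 + h * (2 * Re (cnj z * x) + h * (norm x)\<^sup>2) \<le>
          (norm z)\<^sup>2 * (1 + h * (- 2 * Re y + h * (norm y)\<^sup>2))"
        by simp
      then have "h * (2 * Re (cnj z * x) + h * (norm x)\<^sup>2) \<le> h * ((norm z)\<^sup>2 * (- 2 * Re y + h * (norm y)\<^sup>2))"
        by (simp only: distrib_left mult_1_right mult.left_commute)
      then show ?case using elim(2) unfolding x_def y_def by simp
    qed
  qed simp
  moreover have "Re (cnj (H 0) * z) = Re (cnj z * H 0)" by simp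
  ultimately show "Re (cnj z * H z) \<le> (1 - (norm z)\<^sup>2) * Re (cnj z * H 0)"
    by (simp add: algebra_simps)
qed

lemma holomorphic_bounded_deriv:
  assumes f: "f holomorphic_on unit_disc" and r: "r < R" "R < 1"
    and B: "\<And>z. norm z \<le> R \<Longrightarrow> norm (f z) \<le> B" and u: "norm u \<le> r"
  shows "norm (deriv f u) \<le> B / (R - r)"
proof -
  have near: "norm v \<le> R" if "norm (u - v) \<le> R - r" for v
    using norm_triangle_ineq4[of u "u - v"] that u by simp
  have sub: "cball u (R - r) \<subseteq> unit_disc" using near r by (fastforce simp: dist_norm)
  have "norm ((deriv ^^ 1) f u) \<le> fact 1 * B / (R - r) ^ 1"
  proof (rule Cauchy_inequality)
    show "continuous_on (cball u (R - r)) f"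
      using holomorphic_on_imp_continuous_on[OF holomorphic_on_subset[OF f sub]] .
    show "f holomorphic_on ball u (R - r)"
      using holomorphic_on_subset[OF f order_trans[OF ball_subset_cball sub]] .
    show "norm (f x) \<le> B" if "norm (u - x) = R - r" for x using B near that by simp
  qed (use r in auto)
  then show ?thesis by simp
qed

lemma holomorphic_bounded_Lipschitz:
  assumes f: "f holomorphic_on unit_disc" and r: "r < R" "R < 1"
    and B: "\<And>z. norm z \<le> R \<Longrightarrow> norm (f z) \<le> B"
    and z: "norm z \<le> r" and w: "norm w \<le> r"
  shows "norm (f z - f w) \<le> B / (R - r) * norm (z - w)"
proof (rule field_differentiable_bound[of "cball 0 r" f "deriv f"])
  fix u :: complex assume "u \<in> cball 0 r"
  then have u: "norm u \<le> r" by simp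
  have "u \<in> unit_disc" using u r by simp
  then show "(f has_field_derivative deriv f u) (at u within cball 0 r)"
    using f holomorphic_derivI by blast
  show "norm (deriv f u) \<le> B / (R - r)" by (rule holomorphic_bounded_deriv[OF f r B u])
qed (use z w in auto)

section \<open>Operations on absolutely continuous functions and integral equations with terminal
  value\<close>

lemma abs_continuous_on_diff:
  assumes "abs_continuous_on S f" "abs_continuous_on S g"
  shows "abs_continuous_on S (\<lambda>x. f x - g x)"
proof (rule abs_continuous_on_dominated[OF assms, of _ 1])
  fix x y
  have "f y - g y - (f x - g x) = (f y - f x) - (g y - g x)" by simp
  then show "norm (f y - g y - (f x - g x)) \<le> 1 * (norm (f y - f x) + norm (g y - g x))"
    by (simp only: norm_triangle_ineq4 mult_1)
qed

lemma abs_continuous_on_cmult: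
  fixes f :: "real \<Rightarrow> 'a::real_normed_algebra"
  assumes "abs_continuous_on S f"
  shows "abs_continuous_on S (\<lambda>x. c * f x)"
proof (rule abs_continuous_on_dominated[OF assms assms, of _ "norm c"])
  fix x y
  have "norm (c * f y - c * f x) = norm (c * (f y - f x))" by (simp add: right_diff_distrib)
  also have "\<dots> \<le> norm c * norm (f y - f x)" by (rule norm_mult_ineq)
  also have "\<dots> \<le> norm c * (norm (f y - f x) + norm (f y - f x))" by (intro mult_left_mono) auto
  finally show "norm (c * f y - c * f x) \<le> norm c * (norm (f y - f x) + norm (f y - f x))" .
qed

lemma abs_continuous_on_bounded:
  assumes "abs_continuous_on {a..b} f"
  obtains M where "0 < M" "\<And>x. x \<in> {a..b} \<Longrightarrow> norm (f x) \<le> M"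
proof -
  have "compact (f ` {a..b})"
    by (intro compact_continuous_image abs_continuous_on_imp_continuous_on assms) auto
  then have "bounded (f ` {a..b})" by (rule compact_imp_bounded)
  then show ?thesis unfolding bounded_pos using that by auto
qed

lemma abs_continuous_on_mult:
  fixes f g :: "real \<Rightarrow> 'a::real_normed_algebra"
  assumes f: "abs_continuous_on {a..b} f" and g: "abs_continuous_on {a..b} g"
  shows "abs_continuous_on {a..b} (\<lambda>x. f x * g x)"
proof -
  obtain M where M: "0 < M" "\<And>x. x \<in> {a..b} \<Longrightarrow> norm (f x) \<le> M" using abs_continuous_on_bounded[OF f] by blast
  obtain M' where M': "0 < M'" "\<And>x. x \<in> {a..b} \<Longrightarrow> norm (g x) \<le> M'" using abs_continuous_on_bounded[OF g] by blast
  show ?thesis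
  proof (rule abs_continuous_on_dominated[OF f g, of _ "M + M'"])
    fix x y assume xy: "x \<in> {a..b}" "y \<in> {a..b}"
    have "f y * g y - f x * g x = f y * (g y - g x) + (f y - f x) * g x" by (simp add: algebra_simps)
    also have "norm \<dots> \<le> norm (f y) * norm (g y - g x) + norm (f y - f x) * norm (g x)"
      by (rule norm_triangle_le[OF add_mono]) (rule norm_mult_ineq)+
    also have "\<dots> \<le> (M + M') * norm (g y - g x) + norm (f y - f x) * (M + M')"
      using M(1) M(2)[OF xy(2)] M'(1) M'(2)[OF xy(1)] by (intro add_mono mult_right_mono mult_left_mono) auto
    also have "\<dots> = (M + M') * (norm (f y - f x) + norm (g y - g x))" by (simp add: algebra_simps)
    finally show "norm (f y * g y - f x * g x) \<le> (M + M') * (norm (f y - f x) + norm (g y - g x))" .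
  qed
qed

lemma abs_continuous_on_exp:
  fixes f :: "real \<Rightarrow> 'a::{real_normed_field,banach}"
  assumes f: "abs_continuous_on {a..b} f"
  shows "abs_continuous_on {a..b} (\<lambda>x. exp (f x))"
proof -
  obtain M where M: "0 < M" "\<And>x. x \<in> {a..b} \<Longrightarrow> norm (f x) \<le> M" using abs_continuous_on_bounded[OF f] by blast
  show ?thesis
  proof (rule abs_continuous_on_dominated[OF f f, of _ "exp M"])
    fix x y assume xy: "x \<in> {a..b}" "y \<in> {a..b}"
    have "norm (exp (f y) - exp (f x)) \<le> exp M * norm (f y - f x)"
    proof (rule field_differentiable_bound[of "cball 0 M" exp exp])
      fix z :: 'a assume "z \<in> cball 0 M"
      then show "norm (exp z) \<le> exp M" by (intro order_trans[OF norm_exp]) auto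
    qed (use M xy in \<open>auto intro!: DERIV_exp has_field_derivative_at_within\<close>)
    also have "\<dots> \<le> exp M * (norm (f y - f x) + norm (f y - f x))" by (intro mult_left_mono) auto
    finally show "norm (exp (f y) - exp (f x)) \<le> exp M * (norm (f y - f x) + norm (f y - f x))" .
  qed
qed

lemma has_vector_derivative_exp_comp:
  fixes f :: "real \<Rightarrow> 'a::{real_normed_field,banach}"
  assumes "(f has_vector_derivative D) (at x within S)"
  shows "((\<lambda>x. exp (f x)) has_vector_derivative D * exp (f x)) (at x within S)"
  using field_vector_diff_chain_within[OF assms, of exp "exp (f x)"]
  by (auto intro: DERIV_exp has_field_derivative_at_within simp: o_def)

text \<open>The variable is the lower limit of integration because the ODE prescribes a value at the
  right end of the interval.\<close>

lemma tail_integral: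
  fixes g :: "real \<Rightarrow> 'a::euclidean_space" and k :: "real \<Rightarrow> real"
  assumes g: "g integrable_on {a..b}" and k: "k integrable_on {a..b}"
    and le: "\<And>x. x \<in> {a..b} \<Longrightarrow> norm (g x) \<le> k x"
  shows "\<And>x y. a \<le> x \<Longrightarrow> x \<le> y \<Longrightarrow> y \<le> b \<Longrightarrow> integral {x..b} g - integral {y..b} g = integral {x..y} g"
    and "\<And>x y. a \<le> x \<Longrightarrow> x \<le> y \<Longrightarrow> y \<le> b \<Longrightarrow> norm (integral {x..y} g) \<le> integral {x..y} k"
    and "abs_continuous_on {a..b} (\<lambda>x. integral {x..b} g)"
    and "\<exists>N. negligible N \<and> (\<forall>x\<in>{a..b} - N.
           ((\<lambda>u. integral {u..b} g) has_vector_derivative - g x) (at x within {a..b}))"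
proof -
  show 1: "integral {x..b} g - integral {y..b} g = integral {x..y} g" if "a \<le> x" "x \<le> y" "y \<le> b" for x y
    using Henstock_Kurzweil_Integration.integral_combine[of x y b g] that
      integrable_on_subinterval_real[OF g, of x b] by (auto simp: algebra_simps)
  show 2: "norm (integral {x..y} g) \<le> integral {x..y} k" if "a \<le> x" "x \<le> y" "y \<le> b" for x y
    using that by (intro integral_norm_bound_integral integrable_on_subinterval_real[OF g]
        integrable_on_subinterval_real[OF k] le) auto
  show "abs_continuous_on {a..b} (\<lambda>x. integral {x..b} g)"
  proof (rule abs_continuous_on_integral_bound[OF k])
    show "0 \<le> k x" if "x \<in> {a..b}" for x using le[OF that] norm_ge_zero order_trans by blast
    show "norm (integral {y..b} g - integral {x..b} g) \<le> integral {x..y} k" if "a \<le> x" "x \<le> y" "y \<le> b" for x y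
      using 1[OF that] 2[OF that] by (simp add: norm_minus_commute)
  qed
  obtain N where N: "negligible N" "\<And>x. x \<in> {a..b} - N \<Longrightarrow>
      ((\<lambda>u. integral {a..u} g) has_vector_derivative g x) (at x within {a..b})"
    using indefinite_integral_differentiable_AE[OF g] by blast
  show "\<exists>N. negligible N \<and> (\<forall>x\<in>{a..b} - N.
           ((\<lambda>u. integral {u..b} g) has_vector_derivative - g x) (at x within {a..b}))"
  proof (intro exI[of _ N] conjI ballI N(1))
    fix x assume x: "x \<in> {a..b} - N"
    have "((\<lambda>u. integral {a..b} g - integral {a..u} g) has_vector_derivative (0 - g x)) (at x within {a..b})"
      by (intro has_vector_derivative_diff has_vector_derivative_const N(2) x)
    then have "((\<lambda>u. integral {a..b} g - integral {a..u} g) has_vector_derivative - g x) (at x within {a..b})"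
      by simp
    then show "((\<lambda>u. integral {u..b} g) has_vector_derivative - g x) (at x within {a..b})"
    proof (rule has_vector_derivative_transform[rotated 2])
      fix u assume "u \<in> {a..b}"
      then show "integral {u..b} g = integral {a..b} g - integral {a..u} g"
        using 1[of a u] by (simp add: algebra_simps)
    qed (use x in auto)
  qed
qed

text \<open>The bridge from the integral equation to a solution in the sense of Caratheodory. It is
  stated for an arbitrary integrand so that it also covers the cut-off field in the existence
  proof.\<close>

lemma integral_equation_differentiable_AE:
  fixes g :: "real \<Rightarrow> 'a::euclidean_space" and k :: "real \<Rightarrow> real"
  assumes g: "g integrable_on {a..b}" "k integrable_on {a..b}" "\<And>x. x \<in> {a..b} \<Longrightarrow> norm (g x) \<le> k x"
    and w: "\<And>x. x \<in> {a..b} \<Longrightarrow> w x = z + integral {x..b} g"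
  shows "abs_continuous_on {a..b} w"
    and "\<exists>N. negligible N \<and> (\<forall>x\<in>{a..b} - N. (w has_vector_derivative - g x) (at x within {a..b}))"
proof -
  note tail = tail_integral[OF g]
  show "abs_continuous_on {a..b} w"
  proof (rule abs_continuous_on_dominated[OF tail(3) tail(3), of _ 1])
    fix x y assume "x \<in> {a..b}" "y \<in> {a..b}"
    then have "w y - w x = integral {y..b} g - integral {x..b} g" using w by simp
    then show "norm (w y - w x) \<le> 1 * (norm (integral {y..b} g - integral {x..b} g) +
        norm (integral {y..b} g - integral {x..b} g))" by simp
  qed
  obtain N where N: "negligible N" "\<And>x. x \<in> {a..b} - N \<Longrightarrow>
      ((\<lambda>u. integral {u..b} g) has_vector_derivative - g x) (at x within {a..b})"
    using tail(4) by auto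
  show "\<exists>N. negligible N \<and> (\<forall>x\<in>{a..b} - N. (w has_vector_derivative - g x) (at x within {a..b}))"
  proof (intro exI[of _ N] conjI ballI N(1))
    fix x assume x: "x \<in> {a..b} - N"
    have "((\<lambda>u. z + integral {u..b} g) has_vector_derivative 0 + - g x) (at x within {a..b})"
      by (intro has_vector_derivative_add has_vector_derivative_const N x)
    then have "((\<lambda>u. z + integral {u..b} g) has_vector_derivative - g x) (at x within {a..b})" by simp
    then show "(w has_vector_derivative - g x) (at x within {a..b})"
      by (rule has_vector_derivative_transform[rotated 2]) (use x w in auto)
  qed
qed

lemma abs_continuous_zero_derivative_imp_eq:
  fixes f :: "real \<Rightarrow> 'a::banach"
  assumes "a \<le> b" "abs_continuous_on {a..b} f" "negligible N"
    and "\<And>x. x \<in> {a..b} - N \<Longrightarrow> (f has_vector_derivative 0) (at x within {a..b})"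
  shows "f a = f b"
  using has_integral_unique[OF fundamental_theorem_of_calculus_abs_continuous[OF assms] has_integral_0] by simp

lemma abs_continuous_nonpos_derivative_imp_le:
  fixes f :: "real \<Rightarrow> real"
  assumes ab: "a \<le> b" and f: "abs_continuous_on {a..b} f" and N: "negligible N"
    and f': "\<And>x. x \<in> {a..b} - N \<Longrightarrow> \<exists>D\<le>0. (f has_vector_derivative D) (at x within {a..b})"
  shows "f b \<le> f a"
proof -
  from f' obtain D where D: "\<And>x. x \<in> {a..b} - N \<Longrightarrow> D x \<le> 0 \<and> (f has_vector_derivative D x) (at x within {a..b})"
    by metis
  define D' where "D' x = (if x \<in> {a..b} - N then D x else 0)" for x
  have "(D' has_integral (f b - f a)) {a..b}"
    by (rule fundamental_theorem_of_calculus_abs_continuous[OF ab f N]) (use D in \<open>simp add: D'_def\<close>)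
  from has_integral_nonneg[OF has_integral_neg[OF this]] have "0 \<le> - (f b - f a)"
    using D by (simp add: D'_def)
  then show ?thesis by simp
qed

subsection \<open>The Loewner-Kufarev ODE\<close>

text \<open>
  A Herglotz vector field whose conditions hold at every time instead of almost every time; setting
  the field to \<open>0\<close> on a null set of times reduces the ODE to this case.
\<close>

locale inward_field =
  fixes G :: "complex \<Rightarrow> real \<Rightarrow> complex"
  assumes meas: "\<And>z. z \<in> unit_disc \<Longrightarrow> (\<lambda>t. G z t) \<in> borel_measurable (lebesgue_on {0..})"
    and hol: "\<And>t. 0 \<le> t \<Longrightarrow> (\<lambda>z. G z t) holomorphic_on unit_disc"
    and bound: "\<And>r T. r < 1 \<Longrightarrow> \<exists>k. k integrable_on {0..T} \<and>
          (\<forall>t\<in>{0..T}. 0 \<le> k t \<and> (\<forall>z. norm z \<le> r \<longrightarrow> norm (G z t) \<le> k t))"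
    and inward: "\<And>t. 0 \<le> t \<Longrightarrow> inward_pointing (\<lambda>z. G z t)"
begin

lemma isCont_G: "0 \<le> t \<Longrightarrow> z \<in> unit_disc \<Longrightarrow> isCont (\<lambda>z. G z t) z"
  using holomorphic_on_imp_continuous_on[OF hol] by (simp add: continuous_on_eq_continuous_at)

text \<open>For a simple function in place of \<open>w\<close>, measurability in \<open>t\<close> at
  fixed points suffices; continuity in \<open>z\<close> then passes to the limit. Simple
  approximations may leave the disc, so they are projected back to \<open>cball 0 r\<close> by
  \<open>cp\<close>, which fixes the values of \<open>w\<close>.\<close>

lemma measurable_along:
  assumes w: "w \<in> borel_measurable (lebesgue_on {a..b})" and a: "0 \<le> a"
    and r: "0 \<le> r" "r < 1" and wr: "\<And>t. t \<in> {a..b} \<Longrightarrow> norm (w t) \<le> r"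
  shows "(\<lambda>t. G (w t) t) \<in> borel_measurable (lebesgue_on {a..b})"
proof -
  let ?M = "lebesgue_on {a..b}"
  define cp where "cp = closest_point (cball (0::complex) r)"
  have cp_in: "norm (cp z) \<le> r" for z
    using closest_point_in_set[of "cball (0::complex) r" z] r by (simp add: cp_def)
  have cp_id: "cp z = z" if "norm z \<le> r" for z unfolding cp_def using that by (simp add: closest_point_self)
  have cp_cont: "isCont cp z" for z
    unfolding cp_def using r by (intro continuous_at_closest_point) auto
  obtain F where F: "\<And>i. simple_function ?M (F i)" "\<And>x. x \<in> space ?M \<Longrightarrow> (\<lambda>i. F i x) \<longlonglongrightarrow> w x"
    using borel_measurable_implies_sequence_metric[OF w, of 0] by metis
  have "(\<lambda>t. G (cp (F i t)) t) \<in> borel_measurable ?M" for i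
  proof (rule measurable_compose_countable'[of "F i ` space ?M" "\<lambda>y t. G (cp y) t"])
    fix y
    have "(\<lambda>t. G (cp y) t) \<in> borel_measurable (lebesgue_on {0..})"
      using cp_in[of y] r by (intro meas) auto
    then show "(\<lambda>t. G (cp y) t) \<in> borel_measurable ?M"
      by (rule measurable_restrict_mono) (use a in auto)
  next
    show "F i \<in> measurable ?M (count_space (F i ` space ?M))"
      using F(1)[of i] by (subst measurable_count_space_eq2) (auto simp: simple_function_def)
    show "countable (F i ` space ?M)" using F(1)[of i] by (simp add: simple_function_def countable_finite)
  qed
  then show ?thesis
  proof (rule borel_measurable_LIMSEQ_metric)
    fix t assume "t \<in> space ?M"
    then have t: "t \<in> {a..b}" by simp
    have "(\<lambda>i. cp (F i t)) \<longlonglongrightarrow> cp (w t)"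
      by (rule isCont_tendsto_compose[OF cp_cont F(2)]) (use t in simp)
    then have 1: "(\<lambda>i. cp (F i t)) \<longlonglongrightarrow> w t" using cp_id wr[OF t] by simp
    have "isCont (\<lambda>z. G z t) (w t)" using wr[OF t] r t a by (intro isCont_G) auto
    from isCont_tendsto_compose[OF this 1] show "(\<lambda>i. G (cp (F i t)) t) \<longlonglongrightarrow> G (w t) t" .
  qed
qed

lemma integrable_along:
  assumes w: "w \<in> borel_measurable (lebesgue_on {a..b})" and a: "0 \<le> a"
    and r: "0 \<le> r" "r < 1" and wr: "\<And>t. t \<in> {a..b} \<Longrightarrow> norm (w t) \<le> r"
  shows "(\<lambda>t. G (w t) t) integrable_on {a..b}"
proof -
  obtain k where k: "k integrable_on {0..b}"
    "\<And>t. t \<in> {0..b} \<Longrightarrow> 0 \<le> k t \<and> (\<forall>z. norm z \<le> r \<longrightarrow> norm (G z t) \<le> k t)"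
    using bound[OF r(2), of b] by blast
  show ?thesis
    by (rule measurable_bounded_by_integrable_imp_integrable[OF measurable_along[OF assms], of k])
      (use k wr a in \<open>auto intro: integrable_on_subinterval_real\<close>)
qed

text \<open>On the diagonal any value would satisfy
  \<open>(a - b) * dd a b t = G a t - G b t\<close>; the derivative is the one that makes
  \<open>dd\<close> continuous there, as needed when two terminal values merge.\<close>

definition dd :: "complex \<Rightarrow> complex \<Rightarrow> real \<Rightarrow> complex" where
  "dd a b t = (if a = b then deriv (\<lambda>z. G z t) a else (G a t - G b t) / (a - b))"

lemma dd_bound:
  assumes "r < R" "R < 1" "0 \<le> t" "\<And>z. norm z \<le> R \<Longrightarrow> norm (G z t) \<le> k"
    and "norm a \<le> r" "norm b \<le> r"
  shows "norm (dd a b t) \<le> k / (R - r)"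
proof (cases "a = b")
  case True
  then show ?thesis
    using holomorphic_bounded_deriv[OF hol[OF assms(3)] assms(1,2,4,5)] by (simp add: dd_def)
next
  case False
  then show ?thesis
    using holomorphic_bounded_Lipschitz[OF hol[OF assms(3)] assms(1,2,4,5,6)]
    by (simp add: dd_def norm_divide pos_divide_le_eq)
qed

lemma tendsto_dd:
  assumes "0 \<le> t" "z \<in> unit_disc" "(b \<longlongrightarrow> z) F" "\<forall>\<^sub>F n in F. b n \<in> unit_disc"
  shows "((\<lambda>n. dd (b n) z t) \<longlongrightarrow> deriv (\<lambda>z. G z t) z) F"
proof -
  define g where "g y = (if y = z then deriv (\<lambda>z. G z t) z else (G y t - G z t) / (y - z))" for y
  have "g holomorphic_on unit_disc"
    unfolding g_def by (rule pole_lemma_open[OF hol[OF assms(1)] open_ball])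
  then have "isCont g z"
    using assms(2) holomorphic_on_imp_continuous_on[of g] continuous_on_eq_continuous_at[of unit_disc g] by auto
  from isCont_tendsto_compose[OF this assms(3)] have "((\<lambda>n. g (b n)) \<longlongrightarrow> deriv (\<lambda>z. G z t) z) F"
    by (simp add: g_def)
  moreover have "g y = dd y z t" for y by (simp add: g_def dd_def)
  ultimately show ?thesis by simp
qed

text \<open>Where the two functions coincide, the first is shifted by \<open>c n\<close>, which is
  nonzero and tends to \<open>0\<close>; so \<open>dd\<close> becomes a pointwise limit of genuine
  quotients. The shift is the reason for the larger radius \<open>R\<close>.\<close>

lemma measurable_dd:
  assumes w1: "w1 \<in> borel_measurable (lebesgue_on {a..b})" and w2: "w2 \<in> borel_measurable (lebesgue_on {a..b})"
    and a: "0 \<le> a" and r: "0 \<le> r" "r < 1"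
    and wr: "\<And>t. t \<in> {a..b} \<Longrightarrow> norm (w1 t) \<le> r" "\<And>t. t \<in> {a..b} \<Longrightarrow> norm (w2 t) \<le> r"
  shows "(\<lambda>t. dd (w1 t) (w2 t) t) \<in> borel_measurable (lebesgue_on {a..b})"
proof -
  let ?M = "lebesgue_on {a..b}"
  define R where "R = (1 + r) / 2"
  have R: "r < R" "R < 1" "0 \<le> R" using r by (auto simp: R_def)
  define c where "c n = complex_of_real ((R - r) / real (Suc n))" for n
  have c0: "c n \<noteq> 0" for n using R by (simp add: c_def del: of_real_divide of_nat_Suc)
  have cn: "norm (c n) \<le> R - r" for n
    using R by (simp add: c_def norm_of_real divide_le_eq del: of_real_divide of_real_diff)
  have clim: "c \<longlonglongrightarrow> 0"
    unfolding c_def using tendsto_of_real[OF LIMSEQ_Suc[OF lim_const_over_n[of "R - r"]], where 'a=complex] by simp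
  define b' where "b' n t = (if w1 t = w2 t then w2 t + c n else w1 t)" for n t
  have b'm: "b' n \<in> borel_measurable ?M" for n
    unfolding b'_def using w1 w2 by measurable
  have b'R: "norm (b' n t) \<le> R" if "t \<in> {a..b}" for n t
    using wr[OF that] cn[of n] R norm_triangle_ineq[of "w2 t" "c n"] by (auto simp: b'_def)
  have "(\<lambda>t. (G (b' n t) t - G (w2 t) t) / (b' n t - w2 t)) \<in> borel_measurable ?M" for n
    using measurable_along[OF b'm a R(3,2) b'R] measurable_along[OF w2 a r wr(2)] b'm[of n] w2 by measurable
  then show ?thesis
  proof (rule borel_measurable_LIMSEQ_metric)
    fix t assume "t \<in> space ?M"
    then have t: "t \<in> {a..b}" by simp
    show "(\<lambda>n. (G (b' n t) t - G (w2 t) t) / (b' n t - w2 t)) \<longlonglongrightarrow> dd (w1 t) (w2 t) t"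
    proof (cases "w1 t = w2 t")
      case True
      have lim: "(\<lambda>n. w2 t + c n) \<longlonglongrightarrow> w2 t" using tendsto_add[OF tendsto_const clim, of "w2 t"] by simp
      have "(\<lambda>n. dd (w2 t + c n) (w2 t) t) \<longlonglongrightarrow> deriv (\<lambda>z. G z t) (w2 t)"
      proof (rule tendsto_dd[OF _ _ lim])
        show "\<forall>\<^sub>F n in sequentially. w2 t + c n \<in> unit_disc"
          using b'R[OF t] R True by (intro always_eventually) (auto simp: b'_def intro: le_less_trans)
      qed (use t a wr(2)[OF t] r in auto)
      then show ?thesis using True c0 by (simp add: b'_def dd_def)
    next
      case False
      then show ?thesis by (simp add: b'_def dd_def)
    qed
  qed
qed

end

lemma solves_LK_ODE_restrict:
  assumes w: "solves_LK_ODE G t z w" and u: "0 \<le> u" "u \<le> t"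
  shows "solves_LK_ODE G u (w u) w"
  unfolding solves_LK_ODE_def
proof (intro conjI)
  have sub: "{0..u} \<subseteq> {0..t}" using u by auto
  show "w ` {0..u} \<subseteq> unit_disc" using w sub unfolding solves_LK_ODE_def by blast
  show "locally_abs_continuous_on {0..u} w"
    using w sub unfolding solves_LK_ODE_def locally_abs_continuous_on_def by (meson order_trans)
  obtain N where "negligible N"
    "\<And>s. s \<in> {0..t} \<Longrightarrow> s \<notin> N \<Longrightarrow> (w has_vector_derivative - G (w s) s) (at s within {0..t})"
    using w by (auto simp: solves_LK_ODE_def elim: AE_lebesgue_onE)
  then show "AE s in lebesgue_on {0..u}. (w has_vector_derivative - G (w s) s) (at s within {0..u})"
    by (intro AE_lebesgue_onI[of N]) (use sub in \<open>auto intro: has_vector_derivative_within_subset[OF _ sub]\<close>)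
qed simp

text \<open>A trajectory over a closed time interval is compact in the open disc, so one radius
  \<open>r < 1\<close> contains all of it.\<close>

lemma solves_LK_ODE_props:
  assumes w: "solves_LK_ODE G t z w" and t: "0 \<le> t"
  obtains r N where "0 \<le> r" "r < 1" "\<And>s. s \<in> {0..t} \<Longrightarrow> norm (w s) \<le> r"
    "abs_continuous_on {0..t} w" "continuous_on {0..t} w" "negligible N"
    "\<And>s. s \<in> {0..t} - N \<Longrightarrow> (w has_vector_derivative - G (w s) s) (at s within {0..t})"
proof -
  have ac: "abs_continuous_on {0..t} w"
    using w by (auto simp: solves_LK_ODE_def locally_abs_continuous_on_def)
  have c: "continuous_on {0..t} w" by (rule abs_continuous_on_imp_continuous_on[OF ac])
  obtain s0 where s0: "s0 \<in> {0..t}" "\<And>s. s \<in> {0..t} \<Longrightarrow> norm (w s) \<le> norm (w s0)"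
    using continuous_attains_sup[of "{0..t}" "\<lambda>s. norm (w s)"] c t by (force intro: continuous_intros)
  have "w s0 \<in> unit_disc" using w s0(1) unfolding solves_LK_ODE_def by blast
  moreover obtain N where "negligible N"
    "\<And>s. s \<in> {0..t} \<Longrightarrow> s \<notin> N \<Longrightarrow> (w has_vector_derivative - G (w s) s) (at s within {0..t})"
    using w by (auto simp: solves_LK_ODE_def elim: AE_lebesgue_onE)
  ultimately show ?thesis using s0(2) ac c by (intro that[of "norm (w s0)" N]) auto
qed

context inward_field
begin

lemma measurable_cont:
  assumes "continuous_on {a..b} (w :: real \<Rightarrow> complex)"
  shows "w \<in> borel_measurable (lebesgue_on {a..b})"
  using assms by (rule continuous_imp_measurable_on_sets_lebesgue) simp

lemma solution_integral_eq:
  assumes w: "solves_LK_ODE G t z w" and s: "0 \<le> s" "s \<le> u" "u \<le> t"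
  shows "((\<lambda>\<sigma>. G (w \<sigma>) \<sigma>) has_integral (w s - w u)) {s..u}"
proof -
  obtain r N where rN: "0 \<le> r" "r < 1" "\<And>s. s \<in> {0..t} \<Longrightarrow> norm (w s) \<le> r"
    "abs_continuous_on {0..t} w" "continuous_on {0..t} w" "negligible N"
    "\<And>s. s \<in> {0..t} - N \<Longrightarrow> (w has_vector_derivative - G (w s) s) (at s within {0..t})"
    using solves_LK_ODE_props[OF w] s by auto
  have sub: "{s..u} \<subseteq> {0..t}" using s by auto
  have "((\<lambda>\<sigma>. - G (w \<sigma>) \<sigma>) has_integral (w u - w s)) {s..u}"
  proof (rule fundamental_theorem_of_calculus_abs_continuous[OF s(2) abs_continuous_on_subset[OF rN(4) sub] rN(6)])
    fix x assume "x \<in> {s..u} - N"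
    then show "(w has_vector_derivative - G (w x) x) (at x within {s..u})"
      using sub by (intro has_vector_derivative_within_subset[OF rN(7) sub]) auto
  qed
  from has_integral_neg[OF this] show ?thesis by simp
qed

lemma solvesI:
  assumes t: "0 \<le> t" and c: "continuous_on {0..t} w" and r: "r < 1"
    and wr: "\<And>s. s \<in> {0..t} \<Longrightarrow> norm (w s) \<le> r"
    and eq: "\<And>s. s \<in> {0..t} \<Longrightarrow> w s = z + integral {s..t} (\<lambda>\<sigma>. G (w \<sigma>) \<sigma>)"
  shows "solves_LK_ODE G t z w"
proof -
  have r0: "0 \<le> r" using wr[of 0] t norm_ge_zero order_trans by (metis atLeastAtMost_iff order_refl)
  have g: "(\<lambda>\<sigma>. G (w \<sigma>) \<sigma>) integrable_on {0..t}"
    by (rule integrable_along[OF measurable_cont[OF c] _ r0 r wr]) simp_all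
  obtain k where k: "k integrable_on {0..t}"
    "\<And>s. s \<in> {0..t} \<Longrightarrow> 0 \<le> k s \<and> (\<forall>z. norm z \<le> r \<longrightarrow> norm (G z s) \<le> k s)"
    using bound[OF r, of t] by blast
  have le: "norm (G (w s) s) \<le> k s" if "s \<in> {0..t}" for s using k(2)[OF that] wr[OF that] by blast
  note ac = integral_equation_differentiable_AE(1)[OF g k(1) le eq]
  obtain N where N: "negligible N"
    "\<And>s. s \<in> {0..t} - N \<Longrightarrow> (w has_vector_derivative - G (w s) s) (at s within {0..t})"
    using integral_equation_differentiable_AE(2)[OF g k(1) le eq] by auto
  show ?thesis
    unfolding solves_LK_ODE_def
  proof (intro conjI)
    show "w ` {0..t} \<subseteq> unit_disc" using wr r by fastforce
    show "locally_abs_continuous_on {0..t} w"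
      using ac by (auto simp: locally_abs_continuous_on_def intro: abs_continuous_on_subset)
    show "AE s in lebesgue_on {0..t}. (w has_vector_derivative - G (w s) s) (at s within {0..t})"
      by (rule AE_lebesgue_onI[OF N(1)]) (use N(2) in auto)
    show "w t = z" using eq[of t] t by simp
  qed
qed

text \<open>
  The difference \<open>q\<close> of two solutions satisfies the linear equation \<open>q' = - Q * q\<close>, where \<open>Q\<close> is the
  difference quotient \<open>dd\<close>.  This gives uniqueness, and holomorphy in the terminal value by letting
  \<open>z1 \<longlongrightarrow> z2\<close>.
\<close>

lemma difference_formula:
  assumes w1: "solves_LK_ODE G t z1 w1" and w2: "solves_LK_ODE G t z2 w2" and s: "0 \<le> s" "s \<le> t"
  shows "w1 s - w2 s = (z1 - z2) * exp (integral {s..t} (\<lambda>\<sigma>. dd (w1 \<sigma>) (w2 \<sigma>) \<sigma>))"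
proof -
  have t: "0 \<le> t" using s by simp
  obtain r1 N1 where p1: "0 \<le> r1" "r1 < 1" "\<And>s. s \<in> {0..t} \<Longrightarrow> norm (w1 s) \<le> r1"
    "abs_continuous_on {0..t} w1" "continuous_on {0..t} w1" "negligible N1"
    "\<And>s. s \<in> {0..t} - N1 \<Longrightarrow> (w1 has_vector_derivative - G (w1 s) s) (at s within {0..t})"
    using solves_LK_ODE_props[OF w1 t] by blast
  obtain r2 N2 where p2: "0 \<le> r2" "r2 < 1" "\<And>s. s \<in> {0..t} \<Longrightarrow> norm (w2 s) \<le> r2"
    "abs_continuous_on {0..t} w2" "continuous_on {0..t} w2" "negligible N2"
    "\<And>s. s \<in> {0..t} - N2 \<Longrightarrow> (w2 has_vector_derivative - G (w2 s) s) (at s within {0..t})"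
    using solves_LK_ODE_props[OF w2 t] by blast
  define r where "r = max r1 r2"
  define R where "R = (1 + r) / 2"
  have r: "0 \<le> r" "r < 1" "r < R" "R < 1" using p1(1,2) p2(1,2) by (auto simp: r_def R_def)
  have wr: "norm (w1 s) \<le> r" "norm (w2 s) \<le> r" if "s \<in> {0..t}" for s
    using p1(3)[OF that] p2(3)[OF that] by (auto simp: r_def)
  obtain k where k: "k integrable_on {0..t}"
    "\<And>s. s \<in> {0..t} \<Longrightarrow> 0 \<le> k s \<and> (\<forall>z. norm z \<le> R \<longrightarrow> norm (G z s) \<le> k s)"
    using bound[OF r(4), of t] by blast
  define Q where "Q \<sigma> = dd (w1 \<sigma>) (w2 \<sigma>) \<sigma>" for \<sigma>
  define L where "L \<sigma> = k \<sigma> / (R - r)" for \<sigma>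
  have Lint: "L integrable_on {0..t}" unfolding L_def using integrable_on_divide[OF k(1)] by blast
  have QL: "norm (Q s) \<le> L s" if "s \<in> {0..t}" for s
    unfolding Q_def L_def using r(3,4) that k(2)[OF that] wr[OF that] by (intro dd_bound) auto
  have "Q \<in> borel_measurable (lebesgue_on {0..t})"
    unfolding Q_def using measurable_dd[OF measurable_cont[OF p1(5)] measurable_cont[OF p2(5)] _ r(1,2) wr] by simp
  then have Qint: "Q integrable_on {0..t}"
    by (rule measurable_bounded_by_integrable_imp_integrable[OF _ Lint QL]) auto
  note tail = tail_integral[OF Qint Lint QL]
  obtain N3 where N3: "negligible N3" "\<And>s. s \<in> {0..t} - N3 \<Longrightarrow>
      ((\<lambda>u. integral {u..t} Q) has_vector_derivative - Q s) (at s within {0..t})"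
    using tail(4) by auto
  define I where "I u = - integral {u..t} Q" for u
  have Iac: "abs_continuous_on {0..t} I"
    unfolding I_def using abs_continuous_on_cmult[OF tail(3), of "-1"] by simp
  \<comment> \<open>\<open>exp (I u)\<close> is the integrating factor of the linear equation for
    the difference: its logarithmic derivative \<open>Q\<close> cancels the coefficient
    \<open>- Q\<close>, so \<open>E\<close> is constant.\<close>
  define E where "E u = (w1 u - w2 u) * exp (I u)" for u
  have sub: "{s..t} \<subseteq> {0..t}" using s by auto
  have "E s = E t"
  proof (rule abs_continuous_zero_derivative_imp_eq[OF s(2)])
    show "abs_continuous_on {s..t} E"
      unfolding E_def
      by (intro abs_continuous_on_subset[OF _ sub] abs_continuous_on_mult abs_continuous_on_diff
          abs_continuous_on_exp p1 p2 Iac)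
    show "negligible (N1 \<union> N2 \<union> N3)" using p1 p2 N3 by simp
    fix x assume "x \<in> {s..t} - (N1 \<union> N2 \<union> N3)"
    then have x: "x \<in> {0..t}" "x \<notin> N1" "x \<notin> N2" "x \<notin> N3" using sub by auto
    have q: "((\<lambda>u. w1 u - w2 u) has_vector_derivative - G (w1 x) x - (- G (w2 x) x)) (at x within {0..t})"
      using x by (intro has_vector_derivative_diff p1 p2) auto
    have "(I has_vector_derivative - (- Q x)) (at x within {0..t})"
      unfolding I_def using x by (intro has_vector_derivative_minus N3) auto
    then have e: "((\<lambda>u. exp (I u)) has_vector_derivative - (- Q x) * exp (I x)) (at x within {0..t})"
      by (rule has_vector_derivative_exp_comp)
    have "(E has_vector_derivative ((w1 x - w2 x) * (Q x * exp (I x)) + (- G (w1 x) x - (- G (w2 x) x)) * exp (I x)))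
      (at x within {0..t})"
      unfolding E_def using has_vector_derivative_mult[OF q e] by simp
    moreover have "(w1 x - w2 x) * Q x = G (w1 x) x - G (w2 x) x" by (simp add: Q_def dd_def)
    moreover have "(w1 x - w2 x) * (Q x * exp (I x)) + (- G (w1 x) x - (- G (w2 x) x)) * exp (I x) =
        ((w1 x - w2 x) * Q x - (G (w1 x) x - G (w2 x) x)) * exp (I x)"
      by (simp add: algebra_simps)
    ultimately have "(E has_vector_derivative 0) (at x within {0..t})" by simp
    then show "(E has_vector_derivative 0) (at x within {s..t})"
      by (rule has_vector_derivative_within_subset) (rule sub)
  qed
  moreover have "E t = z1 - z2" using w1 w2 by (simp add: E_def I_def solves_LK_ODE_def)
  ultimately have "(w1 s - w2 s) * exp (- integral {s..t} Q) * exp (integral {s..t} Q) = (z1 - z2) * exp (integral {s..t} Q)"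
    by (simp add: E_def I_def)
  then show ?thesis by (simp add: Q_def[abs_def] exp_minus_inverse mult.assoc flip: exp_add)
qed

corollary solution_unique:
  assumes "solves_LK_ODE G t z w1" "solves_LK_ODE G t z w2" "0 \<le> s" "s \<le> t"
  shows "w1 s = w2 s"
  using difference_formula[OF assms] by simp

lemma norm_G0_integrable: "0 \<le> a \<Longrightarrow> (\<lambda>\<sigma>. norm (G 0 \<sigma>)) integrable_on {a..b}"
proof -
  assume a: "0 \<le> a"
  obtain k where k: "k integrable_on {0..b}"
    "\<And>t. t \<in> {0..b} \<Longrightarrow> 0 \<le> k t \<and> (\<forall>z. norm z \<le> 0 \<longrightarrow> norm (G z t) \<le> k t)"
    using bound[of 0 b] by auto
  have "(\<lambda>\<sigma>. G 0 \<sigma>) \<in> borel_measurable (lebesgue_on {a..b})"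
    by (rule measurable_restrict_mono[OF meas]) (use a in auto)
  then have "(\<lambda>\<sigma>. norm (G 0 \<sigma>)) \<in> borel_measurable (lebesgue_on {a..b})"
    by measurable
  then show ?thesis
    by (rule measurable_bounded_by_integrable_imp_integrable[where g=k])
      (use a k in \<open>auto intro: integrable_on_subinterval_real\<close>)
qed

text \<open>A Gronwall estimate for \<open>n = 1 - (norm w)^2\<close>: the Berkson-Porta inequality
  bounds its logarithmic derivative above by \<open>2 * norm (G 0 s)\<close>, so \<open>n\<close>
  times the exponential of the tail integral is nonincreasing in \<open>s\<close>. Only
  \<open>G 0\<close> enters, which makes the bound independent of the trajectory. The left end
  \<open>a\<close> is free because in the existence proof the equation is first known only near
  \<open>t\<close>.\<close>

lemma no_escape:
  assumes a: "0 \<le> a" "a \<le> t" and ac: "abs_continuous_on {a..t} w" and N: "negligible N"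
    and w1: "\<And>s. s \<in> {a..t} \<Longrightarrow> norm (w s) < 1"
    and der: "\<And>s. s \<in> {a..t} - N \<Longrightarrow> (w has_vector_derivative - G (w s) s) (at s within {a..t})"
  shows "(1 - (norm (w t))\<^sup>2) * exp (- 2 * integral {a..t} (\<lambda>\<sigma>. norm (G 0 \<sigma>))) \<le> 1 - (norm (w a))\<^sup>2"
proof -
  define g where "g \<sigma> = norm (G 0 \<sigma>)" for \<sigma>
  have g: "g integrable_on {a..t}" unfolding g_def by (rule norm_G0_integrable[OF a(1)])
  note tail = tail_integral[OF g g, unfolded g_def real_norm_def abs_norm_cancel, OF order_refl, folded g_def]
  obtain N' where N': "negligible N'" "\<And>s. s \<in> {a..t} - N' \<Longrightarrow>
      ((\<lambda>u. integral {u..t} g) has_vector_derivative - g s) (at s within {a..t})"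
    using tail(4) by auto
  define J where "J s = 2 * integral {s..t} g" for s
  define n where "n s = 1 - w s \<bullet> w s" for s
  have Jac: "abs_continuous_on {a..t} J" unfolding J_def by (rule abs_continuous_on_cmult[OF tail(3)])
  have nac: "abs_continuous_on {a..t} n"
  proof (rule abs_continuous_on_dominated[OF ac ac, of _ 1])
    fix x y assume xy: "x \<in> {a..t}" "y \<in> {a..t}"
    have "n y - n x = - ((w y - w x) \<bullet> (w y + w x))"
      by (simp add: n_def inner_diff_left inner_diff_right inner_add_right inner_commute)
    then have "norm (n y - n x) \<le> norm (w y - w x) * norm (w y + w x)"
      using Cauchy_Schwarz_ineq2[of "w y - w x" "w y + w x"] by simp
    also have "norm (w y + w x) \<le> 2" using norm_triangle_ineq[of "w y" "w x"] w1[OF xy(1)] w1[OF xy(2)] by simp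
    finally show "norm (n y - n x) \<le> 1 * (norm (w y - w x) + norm (w y - w x))"
      by (simp add: mult_left_mono)
  qed
  have "n t * exp (J t) \<le> n a * exp (J a)"
  proof (rule abs_continuous_nonpos_derivative_imp_le[OF a(2), where N="N \<union> N'"])
    show "abs_continuous_on {a..t} (\<lambda>s. n s * exp (J s))"
      by (intro abs_continuous_on_mult abs_continuous_on_exp nac Jac)
    fix x assume x: "x \<in> {a..t} - (N \<union> N')"
    let ?w' = "- G (w x) x"
    have w': "(w has_vector_derivative ?w') (at x within {a..t})" using x by (intro der) auto
    have n': "(n has_vector_derivative 0 - (w x \<bullet> ?w' + ?w' \<bullet> w x)) (at x within {a..t})"
      unfolding n_def
      by (intro has_vector_derivative_diff has_vector_derivative_const
          bounded_bilinear.has_vector_derivative[OF bounded_bilinear_inner] w')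
    have J': "(J has_vector_derivative 2 * (- g x)) (at x within {a..t})"
      unfolding J_def using x by (intro has_vector_derivative_mult_right N') auto
    have "((\<lambda>s. n s * exp (J s)) has_vector_derivative
        (n x * ((2 * (- g x)) * exp (J x)) + (0 - (w x \<bullet> ?w' + ?w' \<bullet> w x)) * exp (J x))) (at x within {a..t})"
      by (rule has_vector_derivative_mult[OF n' has_vector_derivative_exp_comp[OF J']])
    moreover have "n x * ((2 * (- g x)) * exp (J x)) + (0 - (w x \<bullet> ?w' + ?w' \<bullet> w x)) * exp (J x) =
        2 * exp (J x) * (Re (cnj (w x) * G (w x) x) - g x * n x)"
      by (simp add: inner_complex_def algebra_simps)
    moreover have "Re (cnj (w x) * G (w x) x) \<le> g x * n x"
    proof -
      have wx: "norm (w x) < 1" using x w1 by auto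
      have "Re (cnj (w x) * G (w x) x) \<le> (1 - (norm (w x))\<^sup>2) * Re (cnj (w x) * G 0 x)"
        using inward[of x] wx x a unfolding inward_pointing_def by auto
      also have "\<dots> \<le> (1 - (norm (w x))\<^sup>2) * (1 * g x)"
      proof (rule mult_left_mono)
        have "Re (cnj (w x) * G 0 x) \<le> norm (cnj (w x) * G 0 x)" by (rule complex_Re_le_cmod)
        also have "\<dots> \<le> 1 * g x" unfolding norm_mult g_def using wx by (intro mult_right_mono) auto
        finally show "Re (cnj (w x) * G 0 x) \<le> 1 * g x" .
      qed (use wx in \<open>simp add: abs_square_le_1\<close>)
      finally show ?thesis by (simp add: n_def power2_norm_eq_inner mult.commute)
    qed
    ultimately show "\<exists>D\<le>0. ((\<lambda>s. n s * exp (J s)) has_vector_derivative D) (at x within {a..t})"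
      by (intro exI[of _ "2 * exp (J x) * (Re (cnj (w x) * G (w x) x) - g x * n x)"])
        (auto intro: mult_nonneg_nonpos)
  qed (use N N' in simp)
  then have "n t * exp (- J a) \<le> n a * exp (J a) * exp (- J a)"
    by (intro mult_right_mono) (auto simp: J_def)
  also have "\<dots> = n a" by (simp add: mult.assoc flip: exp_add)
  finally show ?thesis by (simp add: n_def J_def g_def[abs_def] power2_norm_eq_inner)
qed

text \<open>In \<open>no_escape\<close> the loss depends only on the integral of
  \<open>norm (G 0 \<sigma>)\<close>, so one radius serves all terminal times up to \<open>T\<close>
  and all terminal values in \<open>cball 0 \<rho>\<close>.\<close>

lemma uniform_radius:
  assumes "\<rho> < 1"
  obtains r where "0 \<le> r" "r < 1"
    "\<And>t z w s. solves_LK_ODE G t z w \<Longrightarrow> norm z \<le> \<rho> \<Longrightarrow> 0 \<le> s \<Longrightarrow> s \<le> t \<Longrightarrow> t \<le> T \<Longrightarrow> norm (w s) \<le> r"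
proof -
  define \<rho>' where "\<rho>' = max 0 \<rho>"
  have \<rho>': "0 \<le> \<rho>'" "\<rho>' < 1" "\<rho> \<le> \<rho>'" using assms by (auto simp: \<rho>'_def)
  define I where "I = integral {0..T} (\<lambda>\<sigma>. norm (G 0 \<sigma>))"
  define e where "e = (1 - \<rho>'\<^sup>2) * exp (- 2 * I)"
  have 1: "0 < 1 - \<rho>'\<^sup>2" using \<rho>' by (simp add: abs_square_less_1)
  have I0: "0 \<le> I" unfolding I_def by (rule integral_nonneg[OF norm_G0_integrable]) auto
  have e: "0 < e" "e \<le> 1"
    using 1 I0 mult_mono[of "1 - \<rho>'\<^sup>2" 1 "exp (-2 * I)" 1] by (auto simp: e_def)
  show ?thesis
  proof (rule that[of "sqrt (1 - e)"])
    show "0 \<le> sqrt (1 - e)" "sqrt (1 - e) < 1" using e by auto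
    fix t z w s assume w: "solves_LK_ODE G t z w" and z: "norm z \<le> \<rho>" and s: "0 \<le> s" "s \<le> t" "t \<le> T"
    obtain r N where rN: "0 \<le> r" "r < 1" "\<And>s. s \<in> {0..t} \<Longrightarrow> norm (w s) \<le> r"
      "abs_continuous_on {0..t} w" "continuous_on {0..t} w" "negligible N"
      "\<And>s. s \<in> {0..t} - N \<Longrightarrow> (w has_vector_derivative - G (w s) s) (at s within {0..t})"
      using solves_LK_ODE_props[OF w] s by auto
    have sub: "{s..t} \<subseteq> {0..t}" using s by auto
    have "(1 - (norm (w t))\<^sup>2) * exp (- 2 * integral {s..t} (\<lambda>\<sigma>. norm (G 0 \<sigma>))) \<le> 1 - (norm (w s))\<^sup>2"
    proof (rule no_escape[OF s(1,2) abs_continuous_on_subset[OF rN(4) sub] rN(6)])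
      show "norm (w x) < 1" if "x \<in> {s..t}" for x
        using rN(3)[of x] rN(2) that sub by (meson le_less_trans subsetD)
      show "(w has_vector_derivative - G (w x) x) (at x within {s..t})" if "x \<in> {s..t} - N" for x
        using that sub by (intro has_vector_derivative_within_subset[OF rN(7) sub]) auto
    qed
    moreover have "e \<le> (1 - (norm (w t))\<^sup>2) * exp (- 2 * integral {s..t} (\<lambda>\<sigma>. norm (G 0 \<sigma>)))"
      unfolding e_def
    proof (rule mult_mono)
      have "w t = z" using w by (simp add: solves_LK_ODE_def)
      moreover have "(norm z)\<^sup>2 \<le> \<rho>'\<^sup>2" using z \<rho>' by (intro power_mono) auto
      ultimately show "1 - \<rho>'\<^sup>2 \<le> 1 - (norm (w t))\<^sup>2" by simp
      then show "0 \<le> 1 - (norm (w t))\<^sup>2" using 1 by linarith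
      have "integral {s..t} (\<lambda>\<sigma>. norm (G 0 \<sigma>)) \<le> I"
        unfolding I_def using s by (intro integral_subset_le norm_G0_integrable) auto
      then show "exp (- 2 * I) \<le> exp (- 2 * integral {s..t} (\<lambda>\<sigma>. norm (G 0 \<sigma>)))" by simp
    qed simp
    ultimately have "(norm (w s))\<^sup>2 \<le> 1 - e" by linarith
    then show "norm (w s) \<le> sqrt (1 - e)" by (rule real_le_rsqrt)
  qed
qed

end

context inward_field
begin

text \<open>The field is Lipschitz only on smaller discs, with an integrable constant
  \<open>L\<close> of arbitrary size. Cutting off makes it globally Lipschitz, and a weighted norm
  makes the Picard iteration contract on the whole interval, so no subdivision of
  \<open>{0..t}\<close> is needed; the a priori bound afterwards removes the cut-off.\<close>

lemma solution_exists:
  assumes t: "0 \<le> t" and z: "z \<in> unit_disc"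
  obtains w where "solves_LK_ODE G t z w"
proof -
  define J where "J = integral {0..t} (\<lambda>\<sigma>. norm (G 0 \<sigma>))"
  define e where "e = (1 - (norm z)\<^sup>2) * exp (- 2 * J)"
  have z1: "0 < 1 - (norm z)\<^sup>2" using z by (simp add: abs_square_less_1)
  have J0: "0 \<le> J" unfolding J_def by (rule integral_nonneg[OF norm_G0_integrable]) auto
  have e12: "0 < e" "e \<le> 1 - (norm z)\<^sup>2"
    using z1 J0 mult_left_mono[of "exp (- 2 * J)" 1 "1 - (norm z)\<^sup>2"] by (auto simp: e_def)
  moreover have "1 - (norm z)\<^sup>2 \<le> 1" by simp
  ultimately have e: "0 < e" "e \<le> 1 - (norm z)\<^sup>2" "e \<le> 1" by (auto intro: order_trans)
  define R0 where "R0 = sqrt (1 - e)"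
  have R0: "0 \<le> R0" "R0 < 1" "norm z \<le> R0" using e by (auto simp: R0_def intro: real_le_rsqrt)
  \<comment> \<open>\<open>R0\<close> is the a priori radius given by \<open>no_escape\<close>,
    \<open>R\<close> the larger radius of the cut-off, and \<open>R'\<close> leaves room for the
    Cauchy estimate on \<open>cball 0 R\<close>.\<close>
  define R where "R = (1 + R0) / 2"
  define R' where "R' = (1 + R) / 2"
  have R: "0 \<le> R" "R0 < R" "R < R'" "R' < 1" "R < 1" using R0 by (auto simp: R_def R'_def)
  obtain k where k: "k integrable_on {0..t}"
    "\<And>s. s \<in> {0..t} \<Longrightarrow> 0 \<le> k s \<and> (\<forall>z. norm z \<le> R' \<longrightarrow> norm (G z s) \<le> k s)"
    using bound[OF R(4), of t] by blast
  define L where "L \<sigma> = k \<sigma> / (R' - R)" for \<sigma>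
  have L: "L integrable_on {0..t}" unfolding L_def using integrable_on_divide[OF k(1)] by blast
  have L0: "0 \<le> L s" if "s \<in> {0..t}" for s using k(2)[OF that] R by (simp add: L_def)
  \<comment> \<open>Picard iteration for the field cut off outside \<open>cball 0 R\<close>; by \<open>no_escape\<close> the solution
    stays in \<open>cball 0 R0\<close>, where the cut-off has no effect.\<close>
  define cp where "cp = closest_point (cball (0::complex) R)"
  have cp_in: "norm (cp v) \<le> R" for v
    using closest_point_in_set[of "cball (0::complex) R" v] R by (simp add: cp_def)
  have cp_id: "cp v = v" if "norm v \<le> R" for v unfolding cp_def using that by (simp add: closest_point_self)
  have cp_lip: "norm (cp v - cp u) \<le> norm (v - u)" for u v
    using closest_point_lipschitz[of "cball (0::complex) R" v u] R by (simp add: cp_def dist_norm)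
  have cp_cont: "continuous_on UNIV cp"
    unfolding cp_def using R by (intro continuous_on_closest_point) auto
  define h where "h v \<sigma> = G (cp v) \<sigma>" for v \<sigma>
  have h_le: "norm (h v s) \<le> k s" if "s \<in> {0..t}" for v s
    using k(2)[OF that] cp_in[of v] R by (simp add: h_def)
  have h_lip: "norm (h v s - h u s) \<le> L s * norm (v - u)" if s: "s \<in> {0..t}" for u v s
  proof -
    have "norm (h v s - h u s) \<le> k s / (R' - R) * norm (cp v - cp u)"
      unfolding h_def by (rule holomorphic_bounded_Lipschitz[OF hol R(3,4) _ cp_in cp_in]) (use s k(2) in auto)
    also have "\<dots> \<le> L s * norm (v - u)" using mult_left_mono[OF cp_lip L0[OF s]] by (simp only: L_def)
    finally show ?thesis .
  qed
  have h_int: "(\<lambda>\<sigma>. h (w \<sigma>) \<sigma>) integrable_on {0..t}" if "continuous_on {0..t} w" for w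
    unfolding h_def
  proof (rule integrable_along[where r=R])
    show "(\<lambda>\<sigma>. cp (w \<sigma>)) \<in> borel_measurable (lebesgue_on {0..t})"
      by (rule measurable_cont[OF continuous_on_compose2[OF cp_cont that]]) simp
  qed (use R cp_in in auto)
  define W where "W = rec_nat (\<lambda>s. z) (\<lambda>n w s. z + integral {s..t} (\<lambda>\<sigma>. h (w \<sigma>) \<sigma>))"
  have W0: "W 0 s = z" and WS: "W (Suc n) s = z + integral {s..t} (\<lambda>\<sigma>. h (W n \<sigma>) \<sigma>)" for n s
    by (simp_all add: W_def)
  have W_cont: "continuous_on {0..t} (W n)" for n
  proof (induction n)
    case 0
    then show ?case using W0 by (simp add: fun_eq_iff[symmetric] cong: continuous_on_cong)
  next
    case (Suc n)
    have "continuous_on {0..t} (\<lambda>s. z + integral {s..t} (\<lambda>\<sigma>. h (W n \<sigma>) \<sigma>))"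
      by (intro continuous_intros abs_continuous_on_imp_continuous_on
          tail_integral(3)[OF h_int[OF Suc] k(1)] h_le)
    then show ?case by (simp add: WS cong: continuous_on_cong)
  qed
  define \<Lambda> where "\<Lambda> s = integral {s..t} L" for s
  \<comment> \<open>The weight of the norm: the integral of \<open>L * E\<close> over
    \<open>{s..t}\<close> is \<open>(E s - 1) / 2\<close>, so every Picard step gains the factor
    \<open>1/2\<close> relative to \<open>E\<close>.\<close>
  define E where "E s = exp (2 * \<Lambda> s)" for s
  note Ltail = tail_integral[OF L L, unfolded real_norm_def, OF eq_refl, OF abs_of_nonneg, OF L0]
  have \<Lambda>ac: "abs_continuous_on {0..t} \<Lambda>" unfolding \<Lambda>_def by (rule Ltail(3))
  have \<Lambda>0: "0 \<le> \<Lambda> s" "\<Lambda> s \<le> \<Lambda> 0" if "s \<in> {0..t}" for s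
  proof -
    show "0 \<le> \<Lambda> s" unfolding \<Lambda>_def
      using that by (intro integral_nonneg integrable_on_subinterval_real[OF L] L0) auto
    show "\<Lambda> s \<le> \<Lambda> 0" unfolding \<Lambda>_def
      using that by (intro integral_subset_le integrable_on_subinterval_real[OF L] ballI L0) auto
  qed
  have E1: "1 \<le> E s" "E s \<le> E 0" if "s \<in> {0..t}" for s using \<Lambda>0[OF that] by (auto simp: E_def)
  have LE: "((\<lambda>\<sigma>. L \<sigma> * E \<sigma>) has_integral (E s - 1) / 2) {s..t}" if s: "s \<in> {0..t}" for s
  proof -
    obtain N where N: "negligible N" "\<And>x. x \<in> {0..t} - N \<Longrightarrow> (\<Lambda> has_vector_derivative - L x) (at x within {0..t})"
      using Ltail(4) unfolding \<Lambda>_def[abs_def] by auto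
    have sub: "{s..t} \<subseteq> {0..t}" using s by auto
    have "((\<lambda>\<sigma>. L \<sigma> * E \<sigma>) has_integral ((-1/2) * E t - (-1/2) * E s)) {s..t}"
    proof (rule fundamental_theorem_of_calculus_abs_continuous[OF _ _ N(1)])
      show "abs_continuous_on {s..t} (\<lambda>x. (-1/2) * E x)"
        unfolding E_def
        by (intro abs_continuous_on_subset[OF _ sub] abs_continuous_on_cmult abs_continuous_on_exp \<Lambda>ac)
      fix x assume x: "x \<in> {s..t} - N"
      have "((\<lambda>x. 2 * \<Lambda> x) has_vector_derivative 2 * (- L x)) (at x within {0..t})"
        using x sub by (intro has_vector_derivative_mult_right N) auto
      then have "((\<lambda>x. (-1/2) * E x) has_vector_derivative (-1/2) * ((2 * (- L x)) * exp (2 * \<Lambda> x))) (at x within {0..t})"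
        unfolding E_def by (rule has_vector_derivative_mult_right[OF has_vector_derivative_exp_comp])
      then show "((\<lambda>x. (-1/2) * E x) has_vector_derivative L x * E x) (at x within {s..t})"
        by (intro has_vector_derivative_within_subset[OF _ sub]) (simp add: E_def)
    qed (use s in auto)
    then show ?thesis by (simp add: E_def \<Lambda>_def diff_divide_distrib)
  qed
  define C where "C = integral {0..t} k"
  have C0: "0 \<le> C" unfolding C_def using k by (intro integral_nonneg) auto
  have diff: "norm (W (Suc n) s - W n s) \<le> C * (1/2)^n * E s" if "s \<in> {0..t}" for n s
    using that
  proof (induction n arbitrary: s)
    case 0
    have "norm (W (Suc 0) s - W 0 s) \<le> integral {s..t} k"
      using tail_integral(2)[OF h_int[OF W_cont[of 0]] k(1) h_le, of s t] 0 by (simp add: WS W0)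
    also have "\<dots> \<le> C" unfolding C_def
      using 0 k by (intro integral_subset_le integrable_on_subinterval_real[OF k(1)]) auto
    also have "\<dots> \<le> C * E s" using E1[OF 0] C0 mult_left_mono[of 1 "E s" C] by simp
    finally show ?case by simp
  next
    case (Suc n)
    have hi: "(\<lambda>\<sigma>. h (W m \<sigma>) \<sigma>) integrable_on {s..t}" for m
      using Suc.prems by (intro integrable_on_subinterval_real[OF h_int[OF W_cont]]) auto
    have "W (Suc (Suc n)) s - W (Suc n) s = integral {s..t} (\<lambda>\<sigma>. h (W (Suc n) \<sigma>) \<sigma> - h (W n \<sigma>) \<sigma>)"
      unfolding Henstock_Kurzweil_Integration.integral_diff[OF hi hi] WS[of "Suc n" s] WS[of n s] by simp
    also have "norm \<dots> \<le> integral {s..t} (\<lambda>\<sigma>. C * (1/2)^n * (L \<sigma> * E \<sigma>))"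
    proof (rule integral_norm_bound_integral)
      show "(\<lambda>\<sigma>. h (W (Suc n) \<sigma>) \<sigma> - h (W n \<sigma>) \<sigma>) integrable_on {s..t}" by (intro integrable_diff hi)
      show "(\<lambda>\<sigma>. C * (1/2)^n * (L \<sigma> * E \<sigma>)) integrable_on {s..t}"
        using LE[OF Suc.prems] by (intro integrable_on_mult_right) auto
      fix x assume "x \<in> {s..t}"
      then have x: "x \<in> {0..t}" using Suc.prems by auto
      have "norm (h (W (Suc n) x) x - h (W n x) x) \<le> L x * norm (W (Suc n) x - W n x)" by (rule h_lip[OF x])
      also have "\<dots> \<le> L x * (C * (1/2)^n * E x)" by (rule mult_left_mono[OF Suc.IH[OF x] L0[OF x]])
      finally show "norm (h (W (Suc n) x) x - h (W n x) x) \<le> C * (1/2)^n * (L x * E x)" by (simp add: mult_ac)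
    qed
    also have "\<dots> = C * (1/2)^n * ((E s - 1) / 2)" using LE[OF Suc.prems] by (simp add: integral_unique)
    also have "\<dots> \<le> C * (1/2)^n * (E s / 2)" using C0 by (intro mult_left_mono) auto
    finally show ?case by simp
  qed
  have tele: "(\<Sum>i<n. W (Suc i) s - W i s) = W n s - z" for n s
    using sum_lessThan_telescope[of "\<lambda>i. W i s" n] by (simp add: W0)
  have "uniform_limit {0..t} (\<lambda>n s. \<Sum>i<n. W (Suc i) s - W i s) (\<lambda>s. \<Sum>i. W (Suc i) s - W i s) sequentially"
  proof (rule Weierstrass_m_test)
    show "norm (W (Suc n) s - W n s) \<le> C * E 0 * (1/2)^n" if "s \<in> {0..t}" for n s
    proof -
      have "C * (1/2)^n * E s \<le> C * (1/2)^n * E 0" using E1[OF that] C0 by (intro mult_left_mono) auto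
      then show ?thesis using diff[OF that, of n] by (simp add: mult_ac)
    qed
    show "summable (\<lambda>n. C * E 0 * (1/2)^n)" by (intro summable_mult summable_geometric) auto
  qed
  then have ul: "uniform_limit {0..t} (\<lambda>n s. W n s - z) (\<lambda>s. \<Sum>i. W (Suc i) s - W i s) sequentially"
    unfolding tele .
  define w where "w s = z + (\<Sum>i. W (Suc i) s - W i s)" for s
  have w_cont: "continuous_on {0..t} w"
    unfolding w_def
    by (intro continuous_intros uniform_limit_theorem[OF _ ul] always_eventually allI W_cont) simp
  have w_lim: "(\<lambda>n. W n s) \<longlonglongrightarrow> w s" if "s \<in> {0..t}" for s
    using tendsto_add[OF tendsto_const[of z] tendsto_uniform_limitI[OF ul that]] by (simp add: w_def)
  have w_eq: "w s = z + integral {s..t} (\<lambda>\<sigma>. h (w \<sigma>) \<sigma>)" if s: "s \<in> {0..t}" for s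
  proof -
    have "(\<lambda>n. integral {s..t} (\<lambda>\<sigma>. h (W n \<sigma>) \<sigma>)) \<longlonglongrightarrow> integral {s..t} (\<lambda>\<sigma>. h (w \<sigma>) \<sigma>)"
    proof (rule dominated_convergence(2)[where h=k])
      show "(\<lambda>\<sigma>. h (W n \<sigma>) \<sigma>) integrable_on {s..t}" for n
        using s by (intro integrable_on_subinterval_real[OF h_int[OF W_cont]]) auto
      show "k integrable_on {s..t}" using s by (intro integrable_on_subinterval_real[OF k(1)]) auto
      show "norm (h (W n x) x) \<le> k x" if "x \<in> {s..t}" for n x using h_le that s by auto
      fix x assume "x \<in> {s..t}"
      then have x: "x \<in> {0..t}" using s by auto
      show "(\<lambda>n. h (W n x) x) \<longlonglongrightarrow> h (w x) x"
      proof (rule LIM_zero_cancel, rule Lim_null_comparison)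
        show "\<forall>\<^sub>F n in sequentially. norm (h (W n x) x - h (w x) x) \<le> L x * norm (W n x - w x)"
          using h_lip[OF x] by simp
        show "(\<lambda>n. L x * norm (W n x - w x)) \<longlonglongrightarrow> 0"
          using tendsto_mult_right_zero[OF tendsto_norm_zero[OF LIM_zero[OF w_lim[OF x]]]] by simp
      qed
    qed
    then have "(\<lambda>n. W (Suc n) s) \<longlonglongrightarrow> z + integral {s..t} (\<lambda>\<sigma>. h (w \<sigma>) \<sigma>)"
      unfolding WS by (intro tendsto_intros)
    moreover have "(\<lambda>n. W (Suc n) s) \<longlonglongrightarrow> w s" by (rule LIMSEQ_Suc[OF w_lim[OF s]])
    ultimately show ?thesis using LIMSEQ_unique by blast
  qed
  have hw: "(\<lambda>\<sigma>. h (w \<sigma>) \<sigma>) integrable_on {0..t}" by (rule h_int[OF w_cont])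
  note w_ac = integral_equation_differentiable_AE(1)[OF hw k(1) h_le w_eq]
  obtain N where N: "negligible N"
    and w_der: "\<And>x. x \<in> {0..t} - N \<Longrightarrow> (w has_vector_derivative - h (w x) x) (at x within {0..t})"
    using integral_equation_differentiable_AE(2)[OF hw k(1) h_le w_eq] by auto
  have wt: "w t = z" using w_eq[of t] t by simp
  have wR0: "norm (w s) \<le> R0" if s: "s \<in> {0..t}" and lt: "\<And>x. x \<in> {s..t} \<Longrightarrow> norm (w x) < R" for s
  proof -
    have sub: "{s..t} \<subseteq> {0..t}" using s by auto
    have "(1 - (norm (w t))\<^sup>2) * exp (- 2 * integral {s..t} (\<lambda>\<sigma>. norm (G 0 \<sigma>))) \<le> 1 - (norm (w s))\<^sup>2"
    proof (rule no_escape[OF _ _ abs_continuous_on_subset[OF w_ac sub] N])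
      show "norm (w x) < 1" if "x \<in> {s..t}" for x using lt[OF that] R by simp
      fix x assume x: "x \<in> {s..t} - N"
      have "h (w x) x = G (w x) x" using lt[of x] x by (simp add: h_def cp_id)
      then show "(w has_vector_derivative - G (w x) x) (at x within {s..t})"
        using w_der[of x] x sub by (auto intro: has_vector_derivative_within_subset)
    qed (use s in auto)
    moreover have "integral {s..t} (\<lambda>\<sigma>. norm (G 0 \<sigma>)) \<le> J"
      unfolding J_def using s by (intro integral_subset_le norm_G0_integrable) auto
    then have "e \<le> (1 - (norm (w t))\<^sup>2) * exp (- 2 * integral {s..t} (\<lambda>\<sigma>. norm (G 0 \<sigma>)))"
      unfolding e_def wt using z1 by (intro mult_left_mono) auto
    ultimately have "(norm (w s))\<^sup>2 \<le> 1 - e" by linarith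
    then show ?thesis unfolding R0_def by (rule real_le_rsqrt)
  qed
  have wR: "norm (w s) < R" if "s \<in> {0..t}" for s
  proof (rule ccontr)
    assume "\<not> norm (w s) < R"
    \<comment> \<open>Continuation argument at the last time \<open>s1\<close> where the cut-off
      could act: above \<open>s1\<close> the equation is the true one, so \<open>wR0\<close> and
      continuity give \<open>norm (w s1) \<le> R0\<close>, against \<open>R0 < R\<close>.\<close>
    define S where "S = {x \<in> {0..t}. R \<le> norm (w x)}"
    have "closed S" unfolding S_def
      by (intro continuous_on_closed_Collect_le continuous_intros w_cont)
    have ne: "S \<noteq> {}" using \<open>\<not> norm (w s) < R\<close> that by (auto simp: S_def)
    have bdd: "bdd_above S" by (rule bdd_aboveI[of _ t]) (auto simp: S_def)
    define s1 where "s1 = Sup S"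
    have s1: "s1 \<in> S" unfolding s1_def by (rule closed_contains_Sup[OF ne bdd \<open>closed S\<close>])
    then have "s1 \<noteq> t" using wt R0 R by (auto simp: S_def)
    then have s1t: "0 \<le> s1" "s1 < t" using s1 by (auto simp: S_def)
    have lt: "norm (w x) < R" if "x \<in> {s1<..t}" for x
      using cSup_upper[OF _ bdd, of x] that s1t by (force simp: S_def s1_def)
    have "norm (w s1) \<le> R0"
    proof (rule continuous_on_closure_norm_le[of "{s1<..t}" w])
      show "continuous_on (closure {s1<..t}) w"
        using s1t by (intro continuous_on_subset[OF w_cont]) auto
      show "\<forall>y\<in>{s1<..t}. norm (w y) \<le> R0" using s1t lt by (auto intro!: wR0)
    qed (use s1t in auto)
    then show False using s1 R by (simp add: S_def)
  qed
  show ?thesis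
  proof (rule that, rule solvesI[OF t w_cont R(5)])
    show "norm (w s) \<le> R" if "s \<in> {0..t}" for s using wR[OF that] by simp
    fix s assume s: "s \<in> {0..t}"
    have "integral {s..t} (\<lambda>\<sigma>. h (w \<sigma>) \<sigma>) = integral {s..t} (\<lambda>\<sigma>. G (w \<sigma>) \<sigma>)"
      by (rule Henstock_Kurzweil_Integration.integral_cong) (use wR s in \<open>auto simp: h_def cp_id less_imp_le\<close>)
    then show "w s = z + integral {s..t} (\<lambda>\<sigma>. G (w \<sigma>) \<sigma>)" using w_eq[OF s] by simp
  qed
qed

lemma solution_holomorphic:
  assumes w: "\<And>z. z \<in> unit_disc \<Longrightarrow> solves_LK_ODE G t z (w z)" and s: "0 \<le> s" "s \<le> t"
  shows "(\<lambda>z. w z s) holomorphic_on unit_disc"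
proof -
  have "(\<lambda>z. w z s) field_differentiable (at z0)" if z0: "z0 \<in> unit_disc" for z0
  proof -
    obtain \<rho> where \<rho>: "norm z0 < \<rho>" "\<rho> < 1" using z0 dense[of "norm z0" 1] by auto
    obtain r where r: "0 \<le> r" "r < 1"
      "\<And>u z w s. solves_LK_ODE G u z w \<Longrightarrow> norm z \<le> \<rho> \<Longrightarrow> 0 \<le> s \<Longrightarrow> s \<le> u \<Longrightarrow> u \<le> t \<Longrightarrow> norm (w s) \<le> r"
      using uniform_radius[OF \<rho>(2), of t] by blast
    define R where "R = (1 + r) / 2"
    have R: "r < R" "R < 1" using r by (auto simp: R_def)
    obtain k where k: "k integrable_on {0..t}"
      "\<And>s. s \<in> {0..t} \<Longrightarrow> 0 \<le> k s \<and> (\<forall>z. norm z \<le> R \<longrightarrow> norm (G z s) \<le> k s)"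
      using bound[OF R(2), of t] by blast
    define L where "L \<sigma> = k \<sigma> / (R - r)" for \<sigma>
    have Lint: "L integrable_on {s..t}" unfolding L_def
      using s by (intro integrable_on_divide integrable_on_subinterval_real[OF k(1)]) auto
    have wr: "norm (w z \<sigma>) \<le> r" if "norm z < \<rho>" "\<sigma> \<in> {s..t}" for z \<sigma>
      using r(3)[OF w, of z \<sigma>] that \<rho> s by auto
    have QL: "norm (dd (w z \<sigma>) (w z0 \<sigma>) \<sigma>) \<le> L \<sigma>" if "norm z < \<rho>" "\<sigma> \<in> {s..t}" for z \<sigma>
      unfolding L_def using R that k(2)[of \<sigma>] wr \<rho> s by (intro dd_bound) auto
    have cont: "continuous_on {s..t} (w z)" if "z \<in> unit_disc" for z
    proof -
      have "abs_continuous_on {0..t} (w z)"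
        using w[OF that] by (auto simp: solves_LK_ODE_def locally_abs_continuous_on_def)
      then show ?thesis
        using s by (intro continuous_on_subset[OF abs_continuous_on_imp_continuous_on]) auto
    qed
    have Qint: "(\<lambda>\<sigma>. dd (w z \<sigma>) (w z0 \<sigma>) \<sigma>) integrable_on {s..t}" if z: "norm z < \<rho>" for z
    proof -
      have "(\<lambda>\<sigma>. dd (w z \<sigma>) (w z0 \<sigma>) \<sigma>) \<in> borel_measurable (lebesgue_on {s..t})"
        by (rule measurable_dd[OF measurable_cont[OF cont] measurable_cont[OF cont] s(1) r(1,2)])
          (use z \<rho> wr in auto)
      then show ?thesis by (rule measurable_bounded_by_integrable_imp_integrable[OF _ Lint QL[OF z]]) auto
    qed
    define I where "I = integral {s..t} (\<lambda>\<sigma>. deriv (\<lambda>z. G z \<sigma>) (w z0 \<sigma>))"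
    \<comment> \<open>Sequences are used for the sake of dominated convergence.
      \<open>difference_formula\<close> is applied twice: the bound \<open>L\<close> on
      \<open>dd\<close> gives convergence of the trajectories, and that in turn gives convergence of
      \<open>dd\<close> to the derivative of the field.\<close>
    have "((\<lambda>y. (w y s - w z0 s) / (y - z0)) \<longlongrightarrow> exp I) (at z0 within ball 0 \<rho>)"
      unfolding tendsto_at_iff_sequentially
    proof (intro allI impI)
      fix X assume X: "\<forall>i. X i \<in> ball 0 \<rho> - {z0}" and Xlim: "X \<longlonglongrightarrow> z0"
      have X\<rho>: "norm (X i) < \<rho>" "X i \<noteq> z0" "X i \<in> unit_disc" for i using spec[OF X, of i] \<rho> by auto
      have quot: "(w (X i) \<sigma> - w z0 \<sigma>) = (X i - z0) * exp (integral {\<sigma>..t} (\<lambda>\<sigma>. dd (w (X i) \<sigma>) (w z0 \<sigma>) \<sigma>))"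
        if "\<sigma> \<in> {s..t}" for i \<sigma>
        using difference_formula[OF w[OF X\<rho>(3)] w[OF z0], of \<sigma>] that s by auto
      have wlim: "(\<lambda>i. w (X i) \<sigma>) \<longlonglongrightarrow> w z0 \<sigma>" if \<sigma>: "\<sigma> \<in> {s..t}" for \<sigma>
      proof (rule LIM_zero_cancel, rule Lim_null_comparison)
        show "\<forall>\<^sub>F i in sequentially. norm (w (X i) \<sigma> - w z0 \<sigma>) \<le> norm (X i - z0) * exp (integral {s..t} L)"
        proof (intro always_eventually allI)
          fix i
          have "norm (integral {\<sigma>..t} (\<lambda>\<sigma>. dd (w (X i) \<sigma>) (w z0 \<sigma>) \<sigma>)) \<le> integral {\<sigma>..t} L"
            using tail_integral(2)[OF Qint[OF X\<rho>(1)] Lint QL[OF X\<rho>(1)], of \<sigma> t] \<sigma> by auto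
          also have "\<dots> \<le> integral {s..t} L"
            using \<sigma> Lint by (intro integral_subset_le integrable_on_subinterval_real[OF Lint])
              (auto intro: order_trans[OF norm_ge_zero QL[OF X\<rho>(1)]])
          finally show "norm (w (X i) \<sigma> - w z0 \<sigma>) \<le> norm (X i - z0) * exp (integral {s..t} L)"
            unfolding quot[OF \<sigma>] norm_mult by (intro mult_left_mono order_trans[OF norm_exp]) auto
        qed
        show "(\<lambda>i. norm (X i - z0) * exp (integral {s..t} L)) \<longlonglongrightarrow> 0"
          by (intro tendsto_mult_left_zero tendsto_norm_zero LIM_zero Xlim)
      qed
      have "(\<lambda>i. integral {s..t} (\<lambda>\<sigma>. dd (w (X i) \<sigma>) (w z0 \<sigma>) \<sigma>)) \<longlonglongrightarrow> I"
        unfolding I_def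
      proof (rule dominated_convergence(2)[OF Qint[OF X\<rho>(1)] Lint QL[OF X\<rho>(1)]])
        fix \<sigma> assume \<sigma>: "\<sigma> \<in> {s..t}"
        have inD: "w (X i) \<sigma> \<in> unit_disc" "w z0 \<sigma> \<in> unit_disc" for i
          using wr[OF X\<rho>(1) \<sigma>, of i] wr[OF \<rho>(1) \<sigma>] r by auto
        show "(\<lambda>i. dd (w (X i) \<sigma>) (w z0 \<sigma>) \<sigma>) \<longlonglongrightarrow> deriv (\<lambda>z. G z \<sigma>) (w z0 \<sigma>)"
          by (rule tendsto_dd[OF _ inD(2) wlim[OF \<sigma>]]) (use s \<sigma> inD in auto)
      qed auto
      then have "(\<lambda>i. exp (integral {s..t} (\<lambda>\<sigma>. dd (w (X i) \<sigma>) (w z0 \<sigma>) \<sigma>))) \<longlonglongrightarrow> exp I" by (rule tendsto_exp)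
      moreover have "((\<lambda>y. (w y s - w z0 s) / (y - z0)) \<circ> X) i = exp (integral {s..t} (\<lambda>\<sigma>. dd (w (X i) \<sigma>) (w z0 \<sigma>) \<sigma>))" for i
        using quot[of s i] X\<rho>(2)[of i] s by simp
      ultimately show "((\<lambda>y. (w y s - w z0 s) / (y - z0)) \<circ> X) \<longlonglongrightarrow> exp I" by presburger
    qed
    then have "((\<lambda>z. w z s) has_field_derivative exp I) (at z0 within ball 0 \<rho>)"
      by (simp add: has_field_derivative_iff)
    then have "((\<lambda>z. w z s) has_field_derivative exp I) (at z0)"
      using \<rho> by (subst (asm) at_within_open) auto
    then show ?thesis unfolding field_differentiable_def by blast
  qed
  then show ?thesis by (simp add: holomorphic_on_def field_differentiable_at_within)
qed

end

subsection \<open>One-parameter semigroups and Herglotz vector fields\<close>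

lemma holomorphic_on_disc_bounded:
  assumes "f holomorphic_on unit_disc" "r < 1"
  obtains B where "0 \<le> B" "\<And>z. norm z \<le> r \<Longrightarrow> norm (f z) \<le> B"
proof -
  have "cball 0 r \<subseteq> unit_disc" using assms by auto
  then have "compact (f ` cball 0 r)"
    using assms by (intro compact_continuous_image holomorphic_on_imp_continuous_on holomorphic_on_subset[OF assms(1)]) auto
  then obtain B where "0 < B" "\<forall>x\<in>f ` cball 0 r. norm x \<le> B"
    using compact_imp_bounded bounded_pos by metis
  then show ?thesis using that[of B] by auto
qed

lemma compact_subset_disc:
  assumes "compact K" "K \<subseteq> unit_disc"
  obtains r where "r < 1" "\<And>z. z \<in> K \<Longrightarrow> norm z \<le> r"
proof (cases "K = {}")
  case False
  then obtain z0 where "z0 \<in> K" "\<And>z. z \<in> K \<Longrightarrow> norm z \<le> norm z0"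
    using continuous_attains_sup[OF assms(1), of norm] by (auto intro: continuous_intros)
  then show ?thesis using that[of "norm z0"] assms(2) by auto
qed (use that[of 0] in auto)

lemma inward_field_const:
  assumes H: "H holomorphic_on unit_disc" "inward_pointing H"
  shows "inward_field (\<lambda>z t. H z)"
proof
  fix r T :: real assume "r < 1"
  then obtain B where "0 \<le> B" "\<And>z. norm z \<le> r \<Longrightarrow> norm (H z) \<le> B"
    using holomorphic_on_disc_bounded[OF H(1)] by blast
  then show "\<exists>k. k integrable_on {0..T} \<and> (\<forall>t\<in>{0..T}. 0 \<le> k t \<and> (\<forall>z. norm z \<le> r \<longrightarrow> norm (H z) \<le> k t))"
    by (intro exI[of _ "\<lambda>_. B"]) auto
qed (use H in auto)

text \<open>For an autonomous field the solution depends only on the elapsed time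
  \<open>T - s\<close>, as \<open>shift\<close> expresses. Reading the backward ODE in the variable
  \<open>\<tau> = T - s\<close> turns it into the forward equation of a semigroup.\<close>

lemma inward_pointing_imp_generator:
  assumes H: "H holomorphic_on unit_disc" "inward_pointing H"
  obtains \<phi> where "one_param_semigroup \<phi>" "infinitesimal_generator \<phi> H"
proof -
  interpret inward_field "\<lambda>z t. H z" by (rule inward_field_const[OF H])
  let ?S = "solves_LK_ODE (\<lambda>z t. H z)"
  have "\<forall>t z. \<exists>w. 0 \<le> t \<longrightarrow> z \<in> unit_disc \<longrightarrow> ?S t z w"
    using solution_exists by metis
  then obtain W where W: "\<And>t z. 0 \<le> t \<Longrightarrow> z \<in> unit_disc \<Longrightarrow> ?S t z (W t z)" by metis
  have WD: "W t z s \<in> unit_disc" if "0 \<le> s" "s \<le> t" "z \<in> unit_disc" for t z s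
    using W[of t z] that unfolding solves_LK_ODE_def by force
  define \<phi> where "\<phi> t z = W t z 0" for t z
  have shift: "W T z (T - \<tau>) = \<phi> \<tau> z" if z: "z \<in> unit_disc" and T: "0 \<le> \<tau>" "\<tau> \<le> T" for T \<tau> z
  proof -
    have T0: "0 \<le> T" using T by simp
    obtain r N where rN: "0 \<le> r" "r < 1" "\<And>s. s \<in> {0..T} \<Longrightarrow> norm (W T z s) \<le> r"
      "abs_continuous_on {0..T} (W T z)" "continuous_on {0..T} (W T z)"
      using solves_LK_ODE_props[OF W[OF T0 z] T0] by metis
    define v where "v s = W T z (s + (T - \<tau>))" for s
    have "?S \<tau> z v"
    proof (rule solvesI[OF T(1) _ rN(2)])
      show "continuous_on {0..\<tau>} v" unfolding v_def
        using T by (intro continuous_on_compose2[OF rN(5)] continuous_intros) auto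
      show "norm (v s) \<le> r" if "s \<in> {0..\<tau>}" for s unfolding v_def using that T by (intro rN(3)) auto
      fix s assume s: "s \<in> {0..\<tau>}"
      have "((\<lambda>\<sigma>. H (W T z \<sigma>)) has_integral (W T z (s + (T - \<tau>)) - W T z T)) {s + (T - \<tau>)..T}"
        using s T by (intro solution_integral_eq[OF W[OF T0 z]]) auto
      then have "((\<lambda>\<sigma>. H (W T z \<sigma>)) \<circ> (+) (T - \<tau>) has_integral (W T z (s + (T - \<tau>)) - W T z T)) {s..\<tau>}"
        unfolding has_integral_shift_Icc_real by simp
      then have "((\<lambda>\<sigma>. H (W T z (\<sigma> + (T - \<tau>)))) has_integral (W T z (s + (T - \<tau>)) - W T z T)) {s..\<tau>}"
        by (simp only: o_def add.commute[of "T - \<tau>"])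
      moreover have "W T z T = z" using W[OF T0 z] by (simp only: solves_LK_ODE_def)
      ultimately show "v s = z + integral {s..\<tau>} (\<lambda>\<sigma>. H (v \<sigma>))"
        by (simp add: v_def integral_unique)
    qed
    then have "v 0 = W \<tau> z 0" by (rule solution_unique[OF _ W[OF T(1) z]]) (use T in auto)
    then show ?thesis by (simp add: v_def \<phi>_def)
  qed
  have der: "((\<lambda>\<tau>. \<phi> \<tau> z) has_vector_derivative H (\<phi> t z)) (at t within {0..})"
    if z: "z \<in> unit_disc" and t: "0 \<le> t" for t z
  proof -
    \<comment> \<open>A terminal time beyond \<open>t\<close> leaves room on the right of
      \<open>t\<close>, so derivatives within \<open>{0..T}\<close> and within \<open>{0..}\<close>
      agree there.\<close>
    define T where "T = t + 1"
    have T: "0 \<le> T" "t < T" using t by (auto simp: T_def)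
    define w where "w = W T z"
    have w: "?S T z w" unfolding w_def by (rule W[OF T(1) z])
    have wc: "continuous_on {0..T} w"
      using w by (auto simp: solves_LK_ODE_def locally_abs_continuous_on_def intro: abs_continuous_on_imp_continuous_on)
    have wD: "w ` {0..T} \<subseteq> unit_disc" using w by (simp add: solves_LK_ODE_def)
    \<comment> \<open>The integrand is continuous because the field does not depend on time; hence
      the derivative exists at every time and not merely almost everywhere.\<close>
    have Hc: "continuous_on {0..T} (\<lambda>\<sigma>. H (w \<sigma>))"
      by (rule continuous_on_compose2[OF holomorphic_on_imp_continuous_on[OF H(1)] wc wD])
    have w_eq: "w s = w 0 - integral {0..s} (\<lambda>\<sigma>. H (w \<sigma>))" if "s \<in> {0..T}" for s
      using solution_integral_eq[OF w, of 0 s] that by (auto simp: integral_unique)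
    have wder: "(w has_vector_derivative - H (w s)) (at s within {0..T})" if s: "s \<in> {0..T}" for s
    proof -
      have "((\<lambda>s. w 0 - integral {0..s} (\<lambda>\<sigma>. H (w \<sigma>))) has_vector_derivative 0 - H (w s)) (at s within {0..T})"
        by (intro has_vector_derivative_diff has_vector_derivative_const integral_has_vector_derivative Hc s)
      then have "((\<lambda>s. w 0 - integral {0..s} (\<lambda>\<sigma>. H (w \<sigma>))) has_vector_derivative - H (w s)) (at s within {0..T})"
        by simp
      then show ?thesis
      proof (rule has_vector_derivative_transform[rotated 2])
        show "w y = w 0 - integral {0..y} (\<lambda>\<sigma>. H (w \<sigma>))" if "y \<in> {0..T}" for y by (rule w_eq[OF that])
      qed (rule s)
    qed
    have "((w \<circ> (\<lambda>\<tau>. T - \<tau>)) has_vector_derivative (0 - 1) *\<^sub>R (- H (w (T - t)))) (at t within {0..T})"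
    proof (rule vector_diff_chain_within)
      show "((\<lambda>\<tau>. T - \<tau>) has_vector_derivative 0 - 1) (at t within {0..T})"
        by (intro has_vector_derivative_diff has_vector_derivative_const has_vector_derivative_id)
      have "(\<lambda>\<tau>. T - \<tau>) ` {0..T} = {0..T}" by (auto intro: image_eqI[of _ _ "T - _"])
      then show "(w has_vector_derivative - H (w (T - t))) (at (T - t) within (\<lambda>\<tau>. T - \<tau>) ` {0..T})"
        using wder[of "T - t"] T t by simp
    qed
    then have 1: "((\<lambda>\<tau>. w (T - \<tau>)) has_vector_derivative H (\<phi> t z)) (at t within {0..T})"
      using shift[OF z, of t T] T t by (simp add: o_def w_def)
    have "((\<lambda>\<tau>. \<phi> \<tau> z) has_vector_derivative H (\<phi> t z)) (at t within {0..T})"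
      by (rule has_vector_derivative_transform[OF _ _ 1]) (use shift[OF z] T t in \<open>auto simp: w_def\<close>)
    moreover have "at t within {0..T} = at t within {0..}"
      by (rule at_within_nhd[of t "{..<T}"]) (use T t in auto)
    ultimately show ?thesis by simp
  qed
  have gen: "infinitesimal_generator \<phi> H"
    unfolding infinitesimal_generator_def
  proof (intro conjI ballI allI impI)
    show "H holomorphic_on unit_disc" by (rule H(1))
    show "\<phi> 0 z = z" if "z \<in> unit_disc" for z
      using W[of 0 z] that by (simp add: \<phi>_def solves_LK_ODE_def)
  qed (use der in auto)
  moreover have "one_param_semigroup \<phi>"
    unfolding one_param_semigroup_def
  proof (intro conjI ballI allI impI)
    show "\<phi> 0 z = z" if "z \<in> unit_disc" for z using gen that by (simp add: infinitesimal_generator_def)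
    show "hol_self_map (\<phi> t)" if t: "0 \<le> t" for t
      unfolding hol_self_map_def
    proof
      show "\<phi> t holomorphic_on unit_disc"
        using solution_holomorphic[OF W[OF t], of 0] t by (simp add: \<phi>_def[abs_def])
      show "\<phi> t ` unit_disc \<subseteq> unit_disc" using WD[of 0 t] t by (auto simp: \<phi>_def)
    qed
    fix s t :: real and z assume st: "0 \<le> s" "0 \<le> t" and z: "z \<in> unit_disc"
    have st': "0 \<le> t + s" using st by simp
    have eq: "W (t + s) z t = \<phi> s z" using shift[OF z, of s "t + s"] st by simp
    then have "\<phi> s z \<in> unit_disc" using WD[of t "t + s" z] st z by simp
    moreover have "?S t (\<phi> s z) (W (t + s) z)"
      using solves_LK_ODE_restrict[OF W[OF st' z], of t] st eq by simp
    ultimately show "\<phi> t (\<phi> s z) = \<phi> (t + s) z"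
      unfolding \<phi>_def[of t] \<phi>_def[of "t + s"] using st by (intro solution_unique[OF W]) auto
  next
    fix z assume z: "z \<in> unit_disc"
    have "continuous (at 0 within {0..}) (\<lambda>\<tau>. \<phi> \<tau> z)"
      by (rule has_vector_derivative_continuous[OF der[OF z]]) simp
    then have "((\<lambda>\<tau>. \<phi> \<tau> z) \<longlongrightarrow> \<phi> 0 z) (at 0 within {0..})" by (simp add: continuous_within)
    then have "((\<lambda>\<tau>. \<phi> \<tau> z) \<longlongrightarrow> \<phi> 0 z) (at_right 0)" by (rule tendsto_within_subset) auto
    moreover have "\<phi> 0 z = z" using gen z by (simp add: infinitesimal_generator_def)
    ultimately show "((\<lambda>\<tau>. \<phi> \<tau> z) \<longlongrightarrow> z) (at_right 0)" by simp
  qed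
  ultimately show ?thesis using that by blast
qed

lemma has_vector_derivative_iff_slope:
  "(f has_vector_derivative D) (at x within S) \<longleftrightarrow>
    ((\<lambda>y. (f y - f x) /\<^sub>R (y - x)) \<longlongrightarrow> D) (at x within S)"
proof -
  have "(f has_vector_derivative D) (at x within S) \<longleftrightarrow>
      ((\<lambda>y. norm ((f y - f x) - (y - x) *\<^sub>R D) / norm (y - x)) \<longlongrightarrow> 0) (at x within S)"
    by (simp add: has_vector_derivative_def has_derivative_iff_norm bounded_linear_scaleR_left)
  also have "\<dots> \<longleftrightarrow> ((\<lambda>y. norm ((f y - f x) /\<^sub>R (y - x) - D)) \<longlongrightarrow> 0) (at x within S)"
  proof (rule tendsto_cong)
    have "norm ((f y - f x) - (y - x) *\<^sub>R D) / norm (y - x) = norm ((f y - f x) /\<^sub>R (y - x) - D)" if "y \<noteq> x" for y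
    proof -
      have "(f y - f x) /\<^sub>R (y - x) - D = ((f y - f x) - (y - x) *\<^sub>R D) /\<^sub>R (y - x)"
        using that by (simp add: scaleR_diff_right)
      then show ?thesis by (simp add: divide_inverse mult.commute)
    qed
    then show "\<forall>\<^sub>F y in at x within S. norm ((f y - f x) - (y - x) *\<^sub>R D) / norm (y - x) =
        norm ((f y - f x) /\<^sub>R (y - x) - D)"
      by (auto simp: eventually_at_filter)
  qed
  also have "\<dots> \<longleftrightarrow> ((\<lambda>y. (f y - f x) /\<^sub>R (y - x)) \<longlongrightarrow> D) (at x within S)"
    by (simp add: tendsto_norm_zero_iff LIM_zero_iff)
  finally show ?thesis .
qed

lemma generator_inward_pointing:
  assumes sg: "one_param_semigroup \<phi>" and gen: "infinitesimal_generator \<phi> H"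
  shows "inward_pointing H"
proof (rule inward_pointing_limit[of \<phi>])
  show "\<forall>\<^sub>F h in at_right 0. hol_self_map (\<phi> h)"
    using eventually_at_right_less by eventually_elim (use sg in \<open>simp add: one_param_semigroup_def\<close>)
  fix z assume z: "z \<in> unit_disc"
  have 0: "\<phi> 0 z = z" using gen z by (simp add: infinitesimal_generator_def)
  have "((\<lambda>\<tau>. \<phi> \<tau> z) has_vector_derivative H (\<phi> 0 z)) (at 0 within {0..})"
    using gen z unfolding infinitesimal_generator_def by blast
  then have "((\<lambda>\<tau>. (\<phi> \<tau> z - z) /\<^sub>R (\<tau> - 0)) \<longlongrightarrow> H z) (at 0 within {0..})"
    unfolding has_vector_derivative_iff_slope 0 .
  then have "((\<lambda>h. (\<phi> h z - z) /\<^sub>R h) \<longlongrightarrow> H z) (at 0 within {0..})" by simp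
  then show "((\<lambda>h. (\<phi> h z - z) /\<^sub>R h) \<longlongrightarrow> H z) (at_right 0)"
    by (rule tendsto_within_subset) auto
qed

section \<open>Functions of class \<open>L^d\<close> and the exceptional times of Herglotz vector
  fields\<close>

lemma nonneg_Lspace_integrable:
  assumes k: "k \<in> nonneg_Lspace d T" and d: "1 \<le> d"
  shows "k integrable_on {0..T}" "\<And>t. t \<in> {0..T} \<Longrightarrow> 0 \<le> k t"
    "\<And>a b. 0 \<le> a \<Longrightarrow> b \<le> T \<Longrightarrow> (LINT \<xi>:{a..b}|lebesgue. k \<xi>) = integral {a..b} k"
proof -
  let ?M = "lebesgue_on {0..T}"
  show k0: "0 \<le> k t" if "t \<in> {0..T}" for t using k that by (simp add: nonneg_Lspace_def)
  have km: "k \<in> borel_measurable ?M" using k by (simp add: nonneg_Lspace_def Lspace_def)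
  have fin: "finite_measure ?M" by (rule finite_measure_lebesgue_on) auto
  have "integrable ?M k"
  proof (cases "d = \<infinity>")
    case True
    then obtain C where "AE x in ?M. \<bar>k x\<bar> \<le> C" using k by (auto simp: nonneg_Lspace_def Lspace_def)
    then show ?thesis using finite_measure.integrable_const_bound[OF fin, of k C] km by simp
  next
    case False
    define p where "p = real_of_ereal d"
    have p: "1 \<le> p" using d False unfolding p_def by (cases d) auto
    have ip: "integrable ?M (\<lambda>x. \<bar>k x\<bar> powr p)" using k False by (simp add: nonneg_Lspace_def Lspace_def p_def)
    \<comment> \<open>On a space of finite measure \<open>L^p\<close> is contained in
      \<open>L^1\<close> because \<open>\<bar>k\<bar> \<le> 1 + \<bar>k\<bar> powr p\<close> for
      \<open>p \<ge> 1\<close>. All the calculus uses integrability only; the exponent matters just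
      for membership of the bounds.\<close>
    show ?thesis
    proof (rule Bochner_Integration.integrable_bound[OF _ km])
      show "integrable ?M (\<lambda>x. 1 + \<bar>k x\<bar> powr p)"
        by (intro Bochner_Integration.integrable_add ip finite_measure.integrable_const[OF fin])
      have "norm (k x) \<le> norm (1 + \<bar>k x\<bar> powr p)" for x
      proof (cases "\<bar>k x\<bar> \<le> 1")
        case True
        then show ?thesis by (simp add: add_increasing2)
      next
        case False
        then have "\<bar>k x\<bar> powr 1 \<le> \<bar>k x\<bar> powr p" using p by (intro powr_mono) auto
        then show ?thesis using False by simp
      qed
      then show "AE x in ?M. norm (k x) \<le> norm (1 + \<bar>k x\<bar> powr p)" by simp
    qed
  qed
  then have ki: "k absolutely_integrable_on {0..T}"
    by (simp add: integrable_restrict_space set_integrable_def)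
  then show "k integrable_on {0..T}" using set_lebesgue_integral_eq_integral(1) by blast
  fix a b :: real assume "0 \<le> a" "b \<le> T"
  then have "k absolutely_integrable_on {a..b}"
    using set_integrable_subset[OF ki, of "{a..b}"] by auto
  then show "(LINT \<xi>:{a..b}|lebesgue. k \<xi>) = integral {a..b} k"
    by (rule set_lebesgue_integral_eq_integral(2))
qed

lemma nonneg_Lspace_cmult_add:
  assumes k: "k \<in> nonneg_Lspace d T" and l: "l \<in> nonneg_Lspace d T" and d: "1 \<le> d" and c: "0 \<le> c"
  shows "(\<lambda>x. c * (k x + l x)) \<in> nonneg_Lspace d T"
proof -
  let ?M = "lebesgue_on {0..T}"
  have m: "k \<in> borel_measurable ?M" "l \<in> borel_measurable ?M"
    using k l by (simp_all add: nonneg_Lspace_def Lspace_def)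
  have k0: "0 \<le> k x" "0 \<le> l x" if "x \<in> {0..T}" for x using k l that by (simp_all add: nonneg_Lspace_def)
  have "(\<lambda>x. c * (k x + l x)) \<in> Lspace d ?M"
  proof (cases "d = \<infinity>")
    case True
    then obtain C C' where "AE x in ?M. \<bar>k x\<bar> \<le> C" "AE x in ?M. \<bar>l x\<bar> \<le> C'"
      using k l by (auto simp: nonneg_Lspace_def Lspace_def)
    then have "AE x in ?M. \<bar>c * (k x + l x)\<bar> \<le> c * (C + C')"
    proof eventually_elim
      case (elim x)
      then have "\<bar>k x + l x\<bar> \<le> C + C'" by linarith
      then show ?case using c by (simp add: abs_mult mult_left_mono)
    qed
    then show ?thesis using True m by (auto simp: Lspace_def)
  next
    case False
    define p where "p = real_of_ereal d"
    have p: "1 \<le> p" using d False unfolding p_def by (cases d) auto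
    have ip: "integrable ?M (\<lambda>x. \<bar>k x\<bar> powr p)" "integrable ?M (\<lambda>x. \<bar>l x\<bar> powr p)"
      using k l False by (simp_all add: nonneg_Lspace_def Lspace_def p_def)
    have "integrable ?M (\<lambda>x. \<bar>c * (k x + l x)\<bar> powr p)"
    proof (rule Bochner_Integration.integrable_bound)
      show "integrable ?M (\<lambda>x. (2 * c) powr p * (\<bar>k x\<bar> powr p + \<bar>l x\<bar> powr p))"
        by (intro integrable_mult_right Bochner_Integration.integrable_add ip)
      have "norm (\<bar>c * (k x + l x)\<bar> powr p) \<le> norm ((2 * c) powr p * (\<bar>k x\<bar> powr p + \<bar>l x\<bar> powr p))" for x
      proof -
        have "\<bar>c * (k x + l x)\<bar> \<le> (2 * c) * max \<bar>k x\<bar> \<bar>l x\<bar>"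
        proof -
          have "\<bar>k x + l x\<bar> \<le> 2 * max \<bar>k x\<bar> \<bar>l x\<bar>" by linarith
          then show ?thesis using mult_left_mono[OF _ c] c by (fastforce simp: abs_mult)
        qed
        then have "\<bar>c * (k x + l x)\<bar> powr p \<le> ((2 * c) * max \<bar>k x\<bar> \<bar>l x\<bar>) powr p"
          using p by (intro powr_mono2) auto
        also have "\<dots> = (2 * c) powr p * (max \<bar>k x\<bar> \<bar>l x\<bar>) powr p" by (rule powr_mult)
        also have "\<dots> \<le> (2 * c) powr p * (\<bar>k x\<bar> powr p + \<bar>l x\<bar> powr p)"
          by (intro mult_left_mono) (auto simp: max_def)
        finally show ?thesis by simp
      qed
      then show "AE x in ?M. norm (\<bar>c * (k x + l x)\<bar> powr p) \<le> norm ((2 * c) powr p * (\<bar>k x\<bar> powr p + \<bar>l x\<bar> powr p))"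
        by simp
      note m[measurable]
      show "(\<lambda>x. \<bar>c * (k x + l x)\<bar> powr p) \<in> borel_measurable ?M" by measurable
    qed
    then show ?thesis using False m by (auto simp: Lspace_def p_def)
  qed
  then show ?thesis using k0 c by (simp add: nonneg_Lspace_def)
qed

lemma zero_nonneg_Lspace: "1 \<le> d \<Longrightarrow> (\<lambda>x. 0) \<in> nonneg_Lspace d T"
  by (auto simp: nonneg_Lspace_def Lspace_def)

lemma Herglotz_bound:
  assumes G: "Herglotz_vector_field d G" and "0 < T" "r < 1"
  obtains k N where "k \<in> nonneg_Lspace d T" "negligible N"
    "\<And>t z. t \<in> {0..T} \<Longrightarrow> t \<notin> N \<Longrightarrow> norm z \<le> r \<Longrightarrow> norm (G z t) \<le> k t"
proof -
  have "\<forall>K T. compact K \<and> K \<subseteq> unit_disc \<and> T > 0 \<longrightarrow> (\<exists>k\<in>nonneg_Lspace d T.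
      AE t in lebesgue_on {0..T}. \<forall>z\<in>K. norm (G z t) \<le> k t)"
    using G by (simp add: Herglotz_vector_field_def)
  moreover have "compact (cball (0::complex) r)" "cball 0 r \<subseteq> unit_disc" using assms by auto
  ultimately have "\<exists>k\<in>nonneg_Lspace d T. AE t in lebesgue_on {0..T}. \<forall>z\<in>cball 0 r. norm (G z t) \<le> k t"
    using assms(2) by meson
  then obtain k where k: "k \<in> nonneg_Lspace d T"
    "AE t in lebesgue_on {0..T}. \<forall>z\<in>cball 0 r. norm (G z t) \<le> k t" by (rule bexE)
  obtain N where "negligible N" "\<And>t. t \<in> {0..T} \<Longrightarrow> t \<notin> N \<Longrightarrow> \<forall>z\<in>cball 0 r. norm (G z t) \<le> k t"
    using AE_lebesgue_onE[OF k(2)] by auto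
  then show ?thesis using that[OF k(1), of N] by auto
qed

text \<open>Countably many radii increasing to \<open>1\<close> and integer times exhaust all local
  bounds, so their exceptional sets, together with the times at which no semigroup exists, form one
  null set \<open>N\<close>. The zero field used on \<open>N\<close> is trivially inward
  pointing.\<close>

lemma Herglotz_inward_field:
  assumes d: "1 \<le> d" and G: "Herglotz_vector_field d G"
  obtains N where "negligible N" "inward_field (\<lambda>z t. if t \<in> N then 0 else G z t)"
proof -
  define r where "r n = 1 - 1 / real (Suc n)" for n
  have r1: "r n < 1" for n by (simp add: r_def)
  define P where "P n m k N \<longleftrightarrow> k integrable_on {0..real (Suc m)} \<and> (\<forall>t\<in>{0..real (Suc m)}. 0 \<le> k t) \<and> negligible N \<and>
     (\<forall>t z. t \<in> {0..real (Suc m)} - N \<and> norm z \<le> r n \<longrightarrow> norm (G z t) \<le> k t)" for n m k N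
  have "\<exists>k N. P n m k N" for n m
  proof -
    obtain k N where kN: "k \<in> nonneg_Lspace d (real (Suc m))" "negligible N"
      "\<And>t z. t \<in> {0..real (Suc m)} \<Longrightarrow> t \<notin> N \<Longrightarrow> norm z \<le> r n \<Longrightarrow> norm (G z t) \<le> k t"
      using Herglotz_bound[OF G _ r1, of "real (Suc m)"] by auto
    have "P n m k N" unfolding P_def using kN nonneg_Lspace_integrable(1,2)[OF kN(1) d] by auto
    then show ?thesis by blast
  qed
  then obtain K M where P: "\<And>n m. P n m (K n m) (M n m)" by metis
  then have K: "\<And>n m. K n m integrable_on {0..real (Suc m)}"
    "\<And>n m t. t \<in> {0..real (Suc m)} \<Longrightarrow> 0 \<le> K n m t" "\<And>n m. negligible (M n m)"
    "\<And>n m t z. t \<in> {0..real (Suc m)} \<Longrightarrow> t \<notin> M n m \<Longrightarrow> norm z \<le> r n \<Longrightarrow> norm (G z t) \<le> K n m t"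
    unfolding P_def by auto
  define N1 where "N1 = (\<Union>n. \<Union>m. M n m)"
  define N2 where "N2 = {t \<in> {0..}. \<not> (\<exists>\<phi>. one_param_semigroup \<phi> \<and> infinitesimal_generator \<phi> (\<lambda>z. G z t))}"
  have N1: "negligible N1" unfolding N1_def by (intro negligible_Union_nat K)
  have "AE t in lebesgue_on {0..}. \<exists>\<phi>. one_param_semigroup \<phi> \<and> infinitesimal_generator \<phi> (\<lambda>z. G z t)"
    using G by (simp add: Herglotz_vector_field_def)
  then have N2: "negligible N2" unfolding N2_def by (simp add: AE_lebesgue_on_iff_negligible)
  define N where "N = N1 \<union> N2"
  have N: "negligible N" using N1 N2 by (simp add: N_def)
  have "inward_field (\<lambda>z t. if t \<in> N then 0 else G z t)"
  proof
    fix z :: complex assume "z \<in> unit_disc"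
    then have Gm: "(\<lambda>t. G z t) \<in> borel_measurable (lebesgue_on {0..})" using G by (simp add: Herglotz_vector_field_def)
    have "{t \<in> space (lebesgue_on {0..}). t \<in> N} = N \<inter> {0..}" by auto
    also have "\<dots> \<in> sets (lebesgue_on {0..})"
      using negligible_imp_sets[OF N] by (auto simp: sets_restrict_space image_iff Int_commute)
    finally show "(\<lambda>t. if t \<in> N then 0 else G z t) \<in> borel_measurable (lebesgue_on {0..})"
      using Gm by (intro measurable_If) auto
  next
    fix t :: real assume t: "0 \<le> t"
    have Gh: "(\<lambda>z. G z t) holomorphic_on unit_disc" using G t by (simp add: Herglotz_vector_field_def)
    then show "(\<lambda>z. if t \<in> N then 0 else G z t) holomorphic_on unit_disc" by (cases "t \<in> N") auto
    show "inward_pointing (\<lambda>z. if t \<in> N then 0 else G z t)"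
    proof (cases "t \<in> N")
      case False
      then have "t \<notin> N2" by (simp add: N_def)
      then have "inward_pointing (\<lambda>z. G z t)" using t generator_inward_pointing by (auto simp: N2_def)
      then show ?thesis using False by simp
    qed (simp add: inward_pointing_def)
  next
    fix \<rho> T :: real assume \<rho>: "\<rho> < 1"
    obtain m where m: "T \<le> real (Suc m)" using real_arch_simple[of T] by (metis le_SucI of_nat_le_iff order_refl order_trans)
    obtain n where "inverse (real (Suc n)) < 1 - \<rho>" using reals_Archimedean[of "1 - \<rho>"] \<rho> by auto
    then have n: "\<rho> \<le> r n" by (simp add: r_def inverse_eq_divide)
    show "\<exists>k. k integrable_on {0..T} \<and> (\<forall>t\<in>{0..T}. 0 \<le> k t \<and>
        (\<forall>z. norm z \<le> \<rho> \<longrightarrow> norm (if t \<in> N then 0 else G z t) \<le> k t))"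
    proof (intro exI[of _ "K n m"] conjI ballI allI impI)
      show "K n m integrable_on {0..T}" by (rule integrable_on_subinterval_real[OF K(1)]) (use m in auto)
      fix t assume t: "t \<in> {0..T}"
      then have t': "t \<in> {0..real (Suc m)}" using m by simp
      show "0 \<le> K n m t" by (rule K(2)[OF t'])
      fix z :: complex assume z: "norm z \<le> \<rho>"
      show "norm (if t \<in> N then 0 else G z t) \<le> K n m t"
      proof (cases "t \<in> N")
        case False
        then have "t \<notin> M n m" by (auto simp: N_def N1_def)
        then show ?thesis using False z n K(4)[OF t'] by simp
      qed (simp add: K(2)[OF t'])
    qed
  qed
  then show ?thesis using that N by blast
qed

subsection \<open>Differentiation of families of holomorphic functions\<close>

text \<open>A Vitali-type argument: where the indefinite integrals of the bounds \<open>k n\<close>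
  are differentiable, the difference quotients at \<open>t\<close> are locally bounded and hence
  Lipschitz in \<open>z\<close>. Convergence at a finite net of dense points then controls them
  uniformly on a disc, and the exceptional set stays a countable union.\<close>

lemma locally_uniform_derivative_AE:
  fixes F :: "real \<Rightarrow> complex \<Rightarrow> complex"
  assumes hol: "\<And>t. t \<in> {0..T} \<Longrightarrow> F t holomorphic_on unit_disc"
    and bd: "\<And>r. r < 1 \<Longrightarrow> \<exists>k. k integrable_on {0..T} \<and> (\<forall>t\<in>{0..T}. 0 \<le> k t) \<and>
      (\<forall>z s t. norm z \<le> r \<and> 0 \<le> s \<and> s \<le> t \<and> t \<le> T \<longrightarrow> norm (F t z - F s z) \<le> integral {s..t} k)"
  obtains N g where "negligible N" "T \<in> N"
    "\<And>t. t \<in> {0..T} - N \<Longrightarrow> g t holomorphic_on unit_disc"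
    "\<And>t r. t \<in> {0..T} - N \<Longrightarrow> r < 1 \<Longrightarrow>
      uniform_limit (cball 0 r) (\<lambda>\<tau> z. (F \<tau> z - F t z) /\<^sub>R (\<tau> - t)) (g t) (at t within {0..T})"
proof -
  obtain D0 :: "complex set" where D0: "countable D0" "\<And>X. open X \<Longrightarrow> X \<noteq> {} \<Longrightarrow> \<exists>d\<in>D0. d \<in> X"
    using countable_dense_setE by blast
  define r where "r n = 1 - 1 / real (n + 2)" for n :: nat
  have r: "0 \<le> r n" "r n < 1" "r n < r (Suc n)" for n by (auto simp: r_def field_simps)
  define P where "P n k \<longleftrightarrow> k integrable_on {0..T} \<and> (\<forall>t\<in>{0..T}. 0 \<le> k t) \<and>
      (\<forall>z s t. norm z \<le> r n \<and> 0 \<le> s \<and> s \<le> t \<and> t \<le> T \<longrightarrow> norm (F t z - F s z) \<le> integral {s..t} k)" for n k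
  have "\<exists>k. P n k" for n unfolding P_def by (rule bd[OF r(2)])
  then obtain k where "\<And>n. P n (k n)" by metis
  then have k: "\<And>n. k n integrable_on {0..T}" "\<And>n t. t \<in> {0..T} \<Longrightarrow> 0 \<le> k n t"
    "\<And>n z s t. norm z \<le> r n \<Longrightarrow> 0 \<le> s \<Longrightarrow> s \<le> t \<Longrightarrow> t \<le> T \<Longrightarrow> norm (F t z - F s z) \<le> integral {s..t} (k n)"
    unfolding P_def by auto
  have "\<exists>N. negligible N \<and> (\<forall>x\<in>{0..T} - N.
      ((\<lambda>u. integral {0..u} (k n)) has_vector_derivative k n x) (at x within {0..T}))" for n
    using indefinite_integral_differentiable_AE[OF k(1)[of n]] by metis
  then obtain N1 where N1: "\<And>n. negligible (N1 n)" "\<And>n x. x \<in> {0..T} - N1 n \<Longrightarrow>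
      ((\<lambda>u. integral {0..u} (k n)) has_vector_derivative k n x) (at x within {0..T})" by metis
  have "\<exists>N f'. negligible N \<and> (\<forall>x\<in>{0..T} - N. ((\<lambda>t. F t z) has_vector_derivative f' x) (at x within {0..T}))"
    if z: "z \<in> unit_disc" for z
  proof -
    obtain n :: nat where "inverse (real (Suc n)) < 1 - norm z" using reals_Archimedean[of "1 - norm z"] z by auto
    moreover have "1 / real (n + 2) \<le> inverse (real (Suc n))" by (simp add: field_simps)
    ultimately have n: "norm z \<le> r n" by (simp add: r_def)
    show ?thesis
      using integral_bounded_differentiable_AE[OF k(1)[of n] k(2), of "\<lambda>t. F t z"] k(3)[OF n] by metis
  qed
  then obtain N2 f' where N2: "\<And>z. z \<in> unit_disc \<Longrightarrow> negligible (N2 z)"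
    "\<And>z x. z \<in> unit_disc \<Longrightarrow> x \<in> {0..T} - N2 z \<Longrightarrow> ((\<lambda>t. F t z) has_vector_derivative f' z x) (at x within {0..T})"
    by metis
  \<comment> \<open>\<open>T\<close> is added so that every remaining \<open>t\<close> has times to
    its right in \<open>{0..T}\<close>, as the sequence \<open>x t\<close> requires.\<close>
  define N where "N = insert T ((\<Union>n. N1 n) \<union> (\<Union>z\<in>D0 \<inter> unit_disc. N2 z))"
  have N: "negligible N"
    unfolding N_def using N1 N2 D0(1)
    by (intro negligible_insert[THEN iffD2] negligible_Un negligible_Union_nat negligible_countable_Union) auto
  define q where "q t \<tau> z = (F \<tau> z - F t z) /\<^sub>R (\<tau> - t)" for t \<tau> z
  \<comment> \<open>A uniform Cauchy condition in disguise: \<open>c\<close> is a step function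
    whose values are derivatives at the net points, and it may depend on \<open>e\<close>.\<close>
  have key: "\<exists>c. \<forall>\<^sub>F \<tau> in at t within {0..T}. \<forall>z\<in>cball 0 (r n). norm (q t \<tau> z - c z) \<le> e"
    if t: "t \<in> {0..T} - N" and e: "0 < e" for t n e
  proof -
    \<comment> \<open>Two radii are spent: the quotients are bounded for \<open>Suc (Suc n)\<close>,
      hence Lipschitz for \<open>Suc n\<close>, where the net points lie that approximate the points
      of \<open>cball 0 (r n)\<close>.\<close>
    let ?m = "Suc (Suc n)"
    define B where "B = \<bar>k ?m t\<bar> + 1"
    have "((\<lambda>u. integral {0..u} (k ?m)) has_vector_derivative k ?m t) (at t within {0..T})"
      using t by (intro N1) (auto simp: N_def)
    then have "((\<lambda>\<tau>. (integral {0..\<tau>} (k ?m) - integral {0..t} (k ?m)) /\<^sub>R (\<tau> - t)) \<longlongrightarrow> k ?m t) (at t within {0..T})"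
      by (simp add: has_vector_derivative_iff_slope)
    from tendstoD[OF this zero_less_one]
    have evB: "\<forall>\<^sub>F \<tau> in at t within {0..T}. \<bar>(integral {0..\<tau>} (k ?m) - integral {0..t} (k ?m)) / (\<tau> - t)\<bar> \<le> B"
      by eventually_elim (auto simp: B_def dist_real_def divide_inverse mult.commute)
    have evq: "\<forall>\<^sub>F \<tau> in at t within {0..T}. \<tau> \<in> {0..T} \<and> (\<forall>z. norm z \<le> r ?m \<longrightarrow> norm (q t \<tau> z) \<le> B)"
    proof -
      have "\<forall>\<^sub>F \<tau> in at t within {0..T}. \<tau> \<in> {0..T}" by (simp add: eventually_at_filter)
      with evB show ?thesis
      proof eventually_elim
      case (elim \<tau>)
      note 2 = elim
      have int: "integral {0..b} (k ?m) - integral {0..a} (k ?m) = integral {a..b} (k ?m)" if "0 \<le> a" "a \<le> b" "b \<le> T" for a b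
        using Henstock_Kurzweil_Integration.integral_combine[of 0 a b "k ?m"] that
          integrable_on_subinterval_real[OF k(1)[of ?m], of 0 b] by simp
      have "norm (F \<tau> z - F t z) \<le> \<bar>integral {0..\<tau>} (k ?m) - integral {0..t} (k ?m)\<bar>" if "norm z \<le> r ?m" for z
      proof (cases "t \<le> \<tau>")
        case True
        then show ?thesis using k(3)[OF that, of t \<tau>] int[of t \<tau>] 2 t by auto
      next
        case False
        then show ?thesis using k(3)[OF that, of \<tau> t] int[of \<tau> t] 2 t by (auto simp: norm_minus_commute abs_minus_commute)
      qed
      then have "norm (q t \<tau> z) \<le> \<bar>(integral {0..\<tau>} (k ?m) - integral {0..t} (k ?m)) / (\<tau> - t)\<bar>" if "norm z \<le> r ?m" for z
        using that by (simp add: q_def divide_inverse mult.commute abs_mult mult_left_mono)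
      then show ?case using 2 by (meson order_trans)
      qed
    qed
    define M where "M = B / (r ?m - r (Suc n))"
    have M: "0 < M" using r(3)[of "Suc n"] by (simp add: M_def B_def)
    have lip: "norm (q t \<tau> z - q t \<tau> w) \<le> M * norm (z - w)"
      if "\<tau> \<in> {0..T}" "\<forall>z. norm z \<le> r ?m \<longrightarrow> norm (q t \<tau> z) \<le> B" "norm z \<le> r (Suc n)" "norm w \<le> r (Suc n)" for \<tau> z w
      unfolding M_def
    proof (rule holomorphic_bounded_Lipschitz[OF _ r(3) r(2)])
      show "q t \<tau> holomorphic_on unit_disc"
        unfolding q_def scaleR_conv_of_real using that(1) t hol by (intro holomorphic_intros) auto
    qed (use that in auto)
    define \<eta> where "\<eta> = min (e / (2 * M)) (r (Suc n) - r n)"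
    have \<eta>: "0 < \<eta>" "M * \<eta> \<le> e / 2" "r n + \<eta> \<le> r (Suc n)"
    proof -
      show "0 < \<eta>" using e M r(3)[of n] by (simp add: \<eta>_def)
      have "M * \<eta> \<le> M * (e / (2 * M))" using M by (intro mult_left_mono) (auto simp: \<eta>_def)
      then show "M * \<eta> \<le> e / 2" using M by simp
    qed (auto simp: \<eta>_def min_def)
    have cover: "cball 0 (r n) \<subseteq> (\<Union>d\<in>D0. ball d \<eta>)"
    proof
      fix z :: complex
      obtain d where "d \<in> D0" "d \<in> ball z \<eta>" using D0(2)[of "ball z \<eta>"] \<eta>(1) by auto
      then show "z \<in> (\<Union>d\<in>D0. ball d \<eta>)" by (auto simp: dist_commute)
    qed
    obtain D1 where D1: "D1 \<subseteq> D0" "finite D1" "cball 0 (r n) \<subseteq> (\<Union>d\<in>D1. ball d \<eta>)"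
      using compactE_image[of "cball (0::complex) (r n)" D0 "\<lambda>d. ball d \<eta>"] cover by auto
    define D2 where "D2 = {d \<in> D1. norm d \<le> r (Suc n)}"
    have "\<forall>\<^sub>F \<tau> in at t within {0..T}. norm (q t \<tau> d - f' d t) \<le> e / 2" if "d \<in> D2" for d
    proof -
      have d: "d \<in> D0 \<inter> unit_disc" using that D1 r(2)[of "Suc n"] by (auto simp: D2_def)
      then have "((\<lambda>t. F t d) has_vector_derivative f' d t) (at t within {0..T})"
        using t by (intro N2) (auto simp: N_def)
      then have "((\<lambda>\<tau>. q t \<tau> d) \<longlongrightarrow> f' d t) (at t within {0..T})"
        by (simp add: has_vector_derivative_iff_slope q_def)
      from tendstoD[OF this, of "e / 2"] e show ?thesis
        by (auto simp: dist_norm elim: eventually_mono)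
    qed
    then have ev2: "\<forall>\<^sub>F \<tau> in at t within {0..T}. \<forall>d\<in>D2. norm (q t \<tau> d - f' d t) \<le> e / 2"
      using D1(2) by (intro eventually_ball_finite) (auto simp: D2_def)
    have "\<forall>z\<in>cball 0 (r n). \<exists>d\<in>D2. norm (z - d) < \<eta>"
    proof
      fix z :: complex assume z: "z \<in> cball 0 (r n)"
      then obtain d where d: "d \<in> D1" "z \<in> ball d \<eta>" using D1(3) by blast
      then have "norm (z - d) < \<eta>" by (simp add: dist_norm norm_minus_commute)
      moreover have "norm d \<le> norm z + norm (z - d)" using norm_triangle_ineq4[of z "z - d"] by simp
      ultimately have "norm d \<le> r (Suc n)" using z \<eta>(3) by simp
      then show "\<exists>d\<in>D2. norm (z - d) < \<eta>" using d \<open>norm (z - d) < \<eta>\<close> by (auto simp: D2_def)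
    qed
    then obtain \<delta> where \<delta>: "\<And>z. z \<in> cball 0 (r n) \<Longrightarrow> \<delta> z \<in> D2 \<and> norm (z - \<delta> z) < \<eta>" by metis
    have "\<forall>\<^sub>F \<tau> in at t within {0..T}. \<forall>z\<in>cball 0 (r n). norm (q t \<tau> z - f' (\<delta> z) t) \<le> e"
      using ev2 evq
    proof eventually_elim
      case (elim \<tau>)
      show ?case
      proof
        fix z :: complex assume z: "z \<in> cball 0 (r n)"
        have "norm (q t \<tau> z - q t \<tau> (\<delta> z)) \<le> M * norm (z - \<delta> z)"
          using z \<delta>[OF z] r(3)[of n] elim(2) by (intro lip) (auto simp: D2_def)
        also have "\<dots> \<le> M * \<eta>" using \<delta>[OF z] M by (intro mult_left_mono) auto
        also have "\<dots> \<le> e / 2" by (rule \<eta>(2))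
        finally have "norm (q t \<tau> z - q t \<tau> (\<delta> z)) \<le> e / 2" .
        moreover have "norm (q t \<tau> (\<delta> z) - f' (\<delta> z) t) \<le> e / 2" using elim(1) \<delta>[OF z] by blast
        ultimately show "norm (q t \<tau> z - f' (\<delta> z) t) \<le> e"
          using norm_triangle_ineq[of "q t \<tau> z - q t \<tau> (\<delta> z)" "q t \<tau> (\<delta> z) - f' (\<delta> z) t"] by simp
      qed
    qed
    then show ?thesis by (intro exI[of _ "\<lambda>z. f' (\<delta> z) t"])
  qed
  \<comment> \<open>One fixed sequence tending to \<open>t\<close> suffices to define the limit
    \<open>g\<close>; \<open>key\<close> shows that the quotients for all nearby times have the same
    limit.\<close>
  define x where "x t j = t + (T - t) / real (Suc (Suc j))" for t and j :: nat
  define g where "g t z = lim (\<lambda>j. q t (x t j) z)" for t z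
  have x: "filterlim (x t) (at t within {0..T}) sequentially" if t: "t \<in> {0..T} - N" for t
    unfolding filterlim_at
  proof
    have tT: "0 \<le> t" "t < T" using t by (auto simp: N_def)
    show "\<forall>\<^sub>F j in sequentially. x t j \<in> {0..T} \<and> x t j \<noteq> t"
    proof (intro always_eventually allI conjI)
      fix j
      have "(T - t) / real (Suc (Suc j)) \<le> (T - t) / 1" using tT by (intro divide_left_mono) auto
      then show "x t j \<in> {0..T}" using tT by (auto simp: x_def)
      show "x t j \<noteq> t" using tT by (simp add: x_def)
    qed
    have "(\<lambda>j. t + (T - t) / real (Suc (Suc j))) \<longlonglongrightarrow> t + 0"
      by (intro tendsto_add tendsto_const LIMSEQ_Suc[OF LIMSEQ_Suc[OF lim_const_over_n]])
    then show "(x t) \<longlonglongrightarrow> t" by (simp add: x_def[abs_def])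
  qed
  have x_ev: "\<forall>\<^sub>F j in sequentially. P (x t j)" if "t \<in> {0..T} - N" "eventually P (at t within {0..T})" for t P
    using x[OF that(1)] that(2) by (simp add: filterlim_iff)
  have lim: "(\<lambda>j. q t (x t j) z) \<longlonglongrightarrow> g t z" if t: "t \<in> {0..T} - N" and z: "norm z \<le> r n" for t z n
  proof -
    have "Cauchy (\<lambda>j. q t (x t j) z)"
    proof (rule CauchyI')
      fix e :: real assume e: "0 < e"
      obtain c where "\<forall>\<^sub>F \<tau> in at t within {0..T}. \<forall>z\<in>cball 0 (r n). norm (q t \<tau> z - c z) \<le> e / 3"
        using key[OF t, of "e / 3"] e by auto
      then have "\<forall>\<^sub>F j in sequentially. \<forall>z\<in>cball 0 (r n). norm (q t (x t j) z - c z) \<le> e / 3"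
        by (rule x_ev[OF t])
      then obtain J where J: "\<And>j. J \<le> j \<Longrightarrow> norm (q t (x t j) z - c z) \<le> e / 3"
        using z unfolding eventually_sequentially by (metis mem_cball_0)
      show "\<exists>M. \<forall>m\<ge>M. \<forall>n>m. dist (q t (x t m) z) (q t (x t n) z) < e"
      proof (intro exI[of _ J] allI impI)
        fix m n assume "J \<le> m" "m < n"
        then show "dist (q t (x t m) z) (q t (x t n) z) < e"
          using J[of m] J[of n] e norm_triangle_ineq4[of "q t (x t m) z - c z" "q t (x t n) z - c z"]
          by (simp add: dist_norm)
      qed
    qed
    then show ?thesis unfolding g_def by (simp add: Cauchy_convergent convergent_LIMSEQ_iff[symmetric])
  qed
  have ul: "uniform_limit (cball 0 (r n)) (q t) (g t) (at t within {0..T})" if t: "t \<in> {0..T} - N" for t n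
  proof (rule uniform_limitI)
    fix e :: real assume e: "0 < e"
    obtain c where c: "\<forall>\<^sub>F \<tau> in at t within {0..T}. \<forall>z\<in>cball 0 (r n). norm (q t \<tau> z - c z) \<le> e / 3"
      using key[OF t, of "e / 3"] e by auto
    then have cx: "\<forall>\<^sub>F j in sequentially. \<forall>z\<in>cball 0 (r n). norm (q t (x t j) z - c z) \<le> e / 3"
      by (rule x_ev[OF t])
    have gc: "norm (g t z - c z) \<le> e / 3" if z: "z \<in> cball 0 (r n)" for z
    proof (rule tendsto_upperbound)
      show "(\<lambda>j. norm (q t (x t j) z - c z)) \<longlonglongrightarrow> norm (g t z - c z)"
        using z by (intro tendsto_intros lim[OF t]) auto
      show "\<forall>\<^sub>F j in sequentially. norm (q t (x t j) z - c z) \<le> e / 3"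
        using cx by eventually_elim (use z in blast)
    qed simp
    show "\<forall>\<^sub>F \<tau> in at t within {0..T}. \<forall>z\<in>cball 0 (r n). dist (q t \<tau> z) (g t z) < e"
      using c
    proof eventually_elim
      case (elim \<tau>)
      show ?case
      proof
        fix z :: complex assume z: "z \<in> cball 0 (r n)"
        then show "dist (q t \<tau> z) (g t z) < e"
          using elim gc[OF z] e norm_triangle_ineq4[of "q t \<tau> z - c z" "g t z - c z"] by (force simp: dist_norm)
      qed
    qed
  qed
  have big: "\<exists>n. \<rho> \<le> r n" if "\<rho> < 1" for \<rho>
  proof -
    obtain n :: nat where "inverse (real (Suc n)) < 1 - \<rho>" using reals_Archimedean[of "1 - \<rho>"] \<open>\<rho> < 1\<close> by auto
    moreover have "1 / real (n + 2) \<le> inverse (real (Suc n))" by (simp add: field_simps)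
    ultimately show ?thesis by (intro exI[of _ n]) (simp add: r_def)
  qed
  have ul': "uniform_limit (cball 0 \<rho>) (q t) (g t) (at t within {0..T})" if t: "t \<in> {0..T} - N" and "\<rho> < 1" for t \<rho>
  proof -
    obtain n where "\<rho> \<le> r n" using big[OF \<open>\<rho> < 1\<close>] by blast
    then show ?thesis by (intro uniform_limit_on_subset[OF ul[OF t, of n]]) auto
  qed
  show ?thesis
  proof (rule that[OF N, of g])
    show "T \<in> N" by (simp add: N_def)
    show "uniform_limit (cball 0 \<rho>) (\<lambda>\<tau> z. (F \<tau> z - F t z) /\<^sub>R (\<tau> - t)) (g t) (at t within {0..T})"
      if "t \<in> {0..T} - N" "\<rho> < 1" for t \<rho> using ul'[OF that] by (simp add: q_def[abs_def])
    fix t assume t: "t \<in> {0..T} - N"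
    then have tT: "0 \<le> t" "t < T" by (auto simp: N_def)
    show "g t holomorphic_on unit_disc"
    proof (rule holomorphic_uniform_sequence[OF open_ball, of "\<lambda>j. q t (x t j)"])
      fix j
      have "(T - t) / real (Suc (Suc j)) \<le> (T - t) / 1" using tT by (intro divide_left_mono) auto
      then have "x t j \<in> {0..T}" using tT by (auto simp: x_def)
      then show "q t (x t j) holomorphic_on unit_disc"
        unfolding q_def scaleR_conv_of_real using t hol by (intro holomorphic_intros) auto
    next
      fix z :: complex assume z: "z \<in> unit_disc"
      define d where "d = (1 - norm z) / 2"
      have d: "0 < d" "norm z + d < 1" using z by (auto simp: d_def field_simps)
      have sub: "cball z d \<subseteq> cball 0 (norm z + d)"
      proof
        fix y assume "y \<in> cball z d"
        then show "y \<in> cball 0 (norm z + d)"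
          using norm_triangle_ineq4[of z "z - y"] by (simp add: dist_norm)
      qed
      have "uniform_limit (cball z d) (q t) (g t) (at t within {0..T})"
        by (rule uniform_limit_on_subset[OF ul'[OF t d(2)] sub])
      then have "uniform_limit (cball z d) (\<lambda>j. q t (x t j)) (g t) sequentially"
        using x[OF t] by (rule filterlim_compose)
      moreover have "cball z d \<subseteq> unit_disc" using sub d by auto
      ultimately show "\<exists>d>0. cball z d \<subseteq> unit_disc \<and> uniform_limit (cball z d) (\<lambda>j. q t (x t j)) (g t) sequentially"
        using d by blast
    qed
  qed
qed

subsection \<open>Reverse evolution families\<close>

locale reverse_evolution =
  fixes d :: ereal and \<phi> :: "real \<Rightarrow> real \<Rightarrow> complex \<Rightarrow> complex"
  assumes d: "1 \<le> d" and ref: "reverse_evolution_family d \<phi>"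
begin

lemma self: "0 \<le> s \<Longrightarrow> s \<le> t \<Longrightarrow> hol_self_map (\<phi> s t)"
  using conjunct1[OF ref[unfolded reverse_evolution_family_def]] by blast

lemma refl: "0 \<le> s \<Longrightarrow> z \<in> unit_disc \<Longrightarrow> \<phi> s s z = z"
  using conjunct1[OF conjunct2[OF ref[unfolded reverse_evolution_family_def]]] by blast

lemma comp: "0 \<le> s \<Longrightarrow> s \<le> u \<Longrightarrow> u \<le> t \<Longrightarrow> z \<in> unit_disc \<Longrightarrow> \<phi> s t z = \<phi> s u (\<phi> u t z)"
  using conjunct1[OF conjunct2[OF conjunct2[OF ref[unfolded reverse_evolution_family_def]]]] by blast

lemma holo: "0 \<le> s \<Longrightarrow> s \<le> t \<Longrightarrow> \<phi> s t holomorphic_on unit_disc"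
  using self by (simp add: hol_self_map_def)

lemma in_disc: "0 \<le> s \<Longrightarrow> s \<le> t \<Longrightarrow> z \<in> unit_disc \<Longrightarrow> \<phi> s t z \<in> unit_disc"
  using self[of s t] unfolding hol_self_map_def by blast

lemma pointwise_bound:
  assumes "z \<in> unit_disc" "0 < T"
  obtains k where "k \<in> nonneg_Lspace d T"
    "\<And>s u t. 0 \<le> s \<Longrightarrow> s \<le> u \<Longrightarrow> u \<le> t \<Longrightarrow> t \<le> T \<Longrightarrow> norm (\<phi> s u z - \<phi> s t z) \<le> integral {u..t} k"
proof -
  have "\<forall>z\<in>unit_disc. \<forall>T>0. \<exists>k\<in>nonneg_Lspace d T. \<forall>s u t. 0 \<le> s \<and> s \<le> u \<and> u \<le> t \<and> t \<le> T \<longrightarrow>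
          norm (\<phi> s u z - \<phi> s t z) \<le> (LINT \<xi>:{u..t}|lebesgue. k \<xi>)"
    using ref by (simp add: reverse_evolution_family_def)
  then have "\<exists>k\<in>nonneg_Lspace d T. \<forall>s u t. 0 \<le> s \<and> s \<le> u \<and> u \<le> t \<and> t \<le> T \<longrightarrow>
          norm (\<phi> s u z - \<phi> s t z) \<le> (LINT \<xi>:{u..t}|lebesgue. k \<xi>)"
    using assms by meson
  then obtain k where k: "k \<in> nonneg_Lspace d T" and le: "\<forall>s u t. 0 \<le> s \<and> s \<le> u \<and> u \<le> t \<and> t \<le> T \<longrightarrow>
          norm (\<phi> s u z - \<phi> s t z) \<le> (LINT \<xi>:{u..t}|lebesgue. k \<xi>)" by (rule bexE)
  show ?thesis
  proof (rule that[OF k])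
    fix s u t assume st: "0 \<le> s" "s \<le> u" "u \<le> t" "t \<le> T"
    then have "norm (\<phi> s u z - \<phi> s t z) \<le> (LINT \<xi>:{u..t}|lebesgue. k \<xi>)" using le by simp
    also have "\<dots> = integral {u..t} k" using st by (intro nonneg_Lspace_integrable(3)[OF k d]) auto
    finally show "norm (\<phi> s u z - \<phi> s t z) \<le> integral {u..t} k" .
  qed
qed

text \<open>The composition rule turns the increment into that of \<open>\<phi> s u\<close> between
  \<open>z\<close> and \<open>\<phi> u t z\<close>, so Schwarz-Pick reduces it to the displacement
  of \<open>z\<close> under \<open>\<phi> u t\<close>. The pointwise bounds at \<open>0\<close> and
  \<open>1/2\<close>, taken with \<open>s = u\<close>, control this displacement, and their weighted
  sum remains in the class of order \<open>d\<close>.\<close>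

lemma uniform_bound:
  assumes T: "0 < T" and r: "r < 1"
  obtains k where "k \<in> nonneg_Lspace d T"
    "\<And>z s u t. norm z \<le> r \<Longrightarrow> 0 \<le> s \<Longrightarrow> s \<le> u \<Longrightarrow> u \<le> t \<Longrightarrow> t \<le> T \<Longrightarrow>
       norm (\<phi> s u z - \<phi> s t z) \<le> integral {u..t} k"
proof -
  define r' where "r' = max 0 r"
  have r': "0 \<le> r'" "r' < 1" "r \<le> r'" using r by (auto simp: r'_def)
  obtain k0 where k0: "k0 \<in> nonneg_Lspace d T"
    "\<And>s u t. 0 \<le> s \<Longrightarrow> s \<le> u \<Longrightarrow> u \<le> t \<Longrightarrow> t \<le> T \<Longrightarrow> norm (\<phi> s u 0 - \<phi> s t 0) \<le> integral {u..t} k0"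
    using pointwise_bound[of 0 T] T by auto
  obtain k1 where k1: "k1 \<in> nonneg_Lspace d T"
    "\<And>s u t. 0 \<le> s \<Longrightarrow> s \<le> u \<Longrightarrow> u \<le> t \<Longrightarrow> t \<le> T \<Longrightarrow> norm (\<phi> s u (1/2) - \<phi> s t (1/2)) \<le> integral {u..t} k1"
    using pointwise_bound[of "1/2" T] T by (auto simp: norm_divide)
  define c where "c = 2 / (1 - r') * (38 / (1 - r'\<^sup>2))"
  have r2: "0 < 1 - r'\<^sup>2" using r' by (simp add: abs_square_less_1)
  then have c: "0 \<le> c" using r' by (simp add: c_def)
  show ?thesis
  proof (rule that[OF nonneg_Lspace_cmult_add[OF k0(1) k1(1) d c]])
    fix z :: complex and s u t :: real assume z: "norm z \<le> r" and st: "0 \<le> s" "s \<le> u" "u \<le> t" "t \<le> T"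
    have zD: "z \<in> unit_disc" and zr: "norm z \<le> r'" using z r r' by auto
    have u0: "0 \<le> u" using st by simp
    have ut: "hol_self_map (\<phi> u t)" using st by (intro self) auto
    have "norm (\<phi> s u z - \<phi> s t z) = norm (\<phi> s u z - \<phi> s u (\<phi> u t z))" using comp[OF st(1-3) zD] by simp
    also have "\<dots> \<le> 2 / (1 - r') * norm (z - \<phi> u t z)"
      using st zD by (intro hol_self_map_Lipschitz[OF self zr r'(2) in_disc]) auto
    also have "norm (z - \<phi> u t z) \<le> 38 / (1 - r'\<^sup>2) * (norm (\<phi> u t 0) + norm (\<phi> u t (1/2) - 1/2))"
      using hol_self_map_displacement[OF ut zr r'(2)] by (simp add: norm_minus_commute)
    also have "norm (\<phi> u t 0) \<le> integral {u..t} k0"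
      using k0(2)[OF u0 order_refl st(3,4)] refl[OF u0, of 0] by simp
    also have "norm (\<phi> u t (1/2) - 1/2) \<le> integral {u..t} k1"
      using k1(2)[OF u0 order_refl st(3,4)] refl[OF u0, of "1/2"] by (simp add: norm_minus_commute norm_divide)
    also have "integral {u..t} k0 + integral {u..t} k1 = integral {u..t} (\<lambda>x. k0 x + k1 x)"
    proof (rule Henstock_Kurzweil_Integration.integral_add[symmetric])
      show "k0 integrable_on {u..t}" "k1 integrable_on {u..t}"
        using st nonneg_Lspace_integrable(1)[OF k0(1) d] nonneg_Lspace_integrable(1)[OF k1(1) d]
        by (auto intro: integrable_on_subinterval_real[of _ 0 T])
    qed
    also have "2 / (1 - r') * (38 / (1 - r'\<^sup>2) * integral {u..t} (\<lambda>x. k0 x + k1 x)) = integral {u..t} (\<lambda>x. c * (k0 x + k1 x))"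
      by (simp only: c_def Henstock_Kurzweil_Integration.integral_mult_right mult.assoc)
    finally show "norm (\<phi> s u z - \<phi> s t z) \<le> integral {u..t} (\<lambda>x. c * (k0 x + k1 x))"
      using r' r2 by (simp add: mult_left_mono divide_right_mono)
  qed
qed

text \<open>Over time steps shorter than \<open>\<delta>\<close> the maps move \<open>0\<close> by
  at most \<open>1/2\<close>, so by \<open>hol_self_map_growth\<close> each step costs a factor
  \<open>3\<close> in \<open>1 - (norm z)^2\<close>. The interval \<open>{0..T}\<close> is covered
  by a fixed number \<open>n\<close> of such steps.\<close>

lemma uniform_radius:
  assumes T: "0 < T" and \<rho>: "\<rho> < 1"
  obtains r where "0 \<le> r" "r < 1"
    "\<And>z u t. norm z \<le> \<rho> \<Longrightarrow> 0 \<le> u \<Longrightarrow> u \<le> t \<Longrightarrow> t \<le> T \<Longrightarrow> norm (\<phi> u t z) \<le> r"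
proof -
  define \<rho>' where "\<rho>' = max 0 \<rho>"
  have \<rho>': "0 \<le> \<rho>'" "\<rho>' < 1" "\<rho> \<le> \<rho>'" using \<rho> by (auto simp: \<rho>'_def)
  obtain k where k: "k \<in> nonneg_Lspace d T"
    "\<And>s u t. 0 \<le> s \<Longrightarrow> s \<le> u \<Longrightarrow> u \<le> t \<Longrightarrow> t \<le> T \<Longrightarrow> norm (\<phi> s u 0 - \<phi> s t 0) \<le> integral {u..t} k"
    using pointwise_bound[of 0 T] T by auto
  note ki = nonneg_Lspace_integrable(1)[OF k(1) d]
  have "uniformly_continuous_on {0..T} (\<lambda>x. integral {0..x} k)"
    by (intro compact_uniformly_continuous indefinite_integral_continuous_1 ki) auto
  then obtain \<delta> where \<delta>: "0 < \<delta>" "\<And>x y. x \<in> {0..T} \<Longrightarrow> y \<in> {0..T} \<Longrightarrow> dist y x < \<delta> \<Longrightarrow>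
      dist (integral {0..y} k) (integral {0..x} k) < 1/2"
    unfolding uniformly_continuous_on_def by (meson half_gt_zero zero_less_one)
  have small: "norm (\<phi> u v 0) \<le> 1/2" if "0 \<le> u" "u \<le> v" "v \<le> T" "v - u < \<delta>" for u v
  proof -
    have "norm (\<phi> u v 0) \<le> integral {u..v} k" using k(2)[of u u v] refl[of u 0] that by simp
    also have "\<dots> = integral {0..v} k - integral {0..u} k"
      using Henstock_Kurzweil_Integration.integral_combine[of 0 u v k] that
        integrable_on_subinterval_real[OF ki, of 0 v] by simp
    also have "\<dots> \<le> 1/2"
    proof -
      have "dist (integral {0..v} k) (integral {0..u} k) < 1/2" using that by (intro \<delta>(2)) (auto simp: dist_real_def)
      then show ?thesis unfolding dist_real_def by linarith
    qed
    finally show ?thesis .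
  qed
  have grow: "(1 - \<rho>'\<^sup>2) / 3 ^ n \<le> 1 - (norm (\<phi> u t z))\<^sup>2"
    if "norm z \<le> \<rho>" "0 \<le> u" "u \<le> t" "t \<le> T" "t - u \<le> real n * (\<delta> / 2)" for n u t z
    using that
  proof (induction n arbitrary: u)
    case 0
    then have "u = t" "z \<in> unit_disc" using \<rho> by auto
    then have "\<phi> u t z = z" using refl 0 by simp
    moreover have "(norm z)\<^sup>2 \<le> \<rho>'\<^sup>2" using 0 \<rho>' by (intro power_mono) auto
    ultimately show ?case by simp
  next
    case (Suc n)
    define v where "v = min t (u + \<delta> / 2)"
    have v: "u \<le> v" "v \<le> t" "v - u < \<delta>" "t - v \<le> real n * (\<delta> / 2)"
      using Suc.prems \<delta>(1) by (auto simp: v_def min_def algebra_simps)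
    have zD: "z \<in> unit_disc" using Suc.prems \<rho> by auto
    have wD: "\<phi> v t z \<in> unit_disc" using v Suc.prems zD by (intro in_disc) auto
    have IH: "(1 - \<rho>'\<^sup>2) / 3 ^ n \<le> 1 - (norm (\<phi> v t z))\<^sup>2"
      using Suc.prems v by (intro Suc.IH) auto
    have "(1 - (norm (\<phi> v t z))\<^sup>2) / 3 \<le> 1 - (norm (\<phi> u v (\<phi> v t z)))\<^sup>2"
      using v Suc.prems by (intro hol_self_map_growth[OF self small wD]) auto
    also have "\<phi> u v (\<phi> v t z) = \<phi> u t z" using comp[of u v t z] v Suc.prems zD by simp
    finally have "(1 - (norm (\<phi> v t z))\<^sup>2) / 3 \<le> 1 - (norm (\<phi> u t z))\<^sup>2" .
    moreover have "(1 - \<rho>'\<^sup>2) / 3 ^ Suc n \<le> (1 - (norm (\<phi> v t z))\<^sup>2) / 3"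
      using divide_right_mono[OF IH, of 3] by (simp add: mult.commute)
    ultimately show ?case by linarith
  qed
  obtain n :: nat where n: "T / (\<delta> / 2) \<le> real n" using real_arch_simple by blast
  then have nT: "T \<le> real n * (\<delta> / 2)" using \<delta>(1) by (simp add: field_simps)
  define e where "e = (1 - \<rho>'\<^sup>2) / 3 ^ n"
  have "0 < 1 - \<rho>'\<^sup>2" using \<rho>' by (simp add: abs_square_less_1)
  moreover have "(1 - \<rho>'\<^sup>2) / 3 ^ n \<le> 1 / 1" using \<rho>' by (intro frac_le) auto
  ultimately have e: "0 < e" "e \<le> 1" by (auto simp: e_def)
  show ?thesis
  proof (rule that[of "sqrt (1 - e)"])
    show "0 \<le> sqrt (1 - e)" "sqrt (1 - e) < 1" using e by auto
    fix z :: complex and u t :: real assume "norm z \<le> \<rho>" "0 \<le> u" "u \<le> t" "t \<le> T"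
    then have "e \<le> 1 - (norm (\<phi> u t z))\<^sup>2" unfolding e_def using nT by (intro grow) auto
    then show "norm (\<phi> u t z) \<le> sqrt (1 - e)" by (intro real_le_rsqrt) simp
  qed
qed

text \<open>The defining bound concerns the second time. An increment in the first time is a
  displacement of the point \<open>\<phi> u t z\<close> under \<open>\<phi> s u\<close>, and
  \<open>uniform_radius\<close> keeps that point in a disc where \<open>uniform_bound\<close>
  applies.\<close>

lemma bound_in_s:
  assumes T: "0 < T" and \<rho>: "\<rho> < 1"
  obtains k where "k integrable_on {0..T}" "\<And>x. x \<in> {0..T} \<Longrightarrow> 0 \<le> k x"
    "\<And>z s u t. norm z \<le> \<rho> \<Longrightarrow> 0 \<le> s \<Longrightarrow> s \<le> u \<Longrightarrow> u \<le> t \<Longrightarrow> t \<le> T \<Longrightarrow>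
       norm (\<phi> u t z - \<phi> s t z) \<le> integral {s..u} k"
proof -
  obtain r where r: "0 \<le> r" "r < 1"
    "\<And>z u t. norm z \<le> \<rho> \<Longrightarrow> 0 \<le> u \<Longrightarrow> u \<le> t \<Longrightarrow> t \<le> T \<Longrightarrow> norm (\<phi> u t z) \<le> r"
    using uniform_radius[OF T \<rho>] by blast
  obtain k where k: "k \<in> nonneg_Lspace d T"
    "\<And>z s u t. norm z \<le> r \<Longrightarrow> 0 \<le> s \<Longrightarrow> s \<le> u \<Longrightarrow> u \<le> t \<Longrightarrow> t \<le> T \<Longrightarrow>
       norm (\<phi> s u z - \<phi> s t z) \<le> integral {u..t} k"
    using uniform_bound[OF T r(2)] by blast
  show ?thesis
  proof (rule that[OF nonneg_Lspace_integrable(1,2)[OF k(1) d]])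
    fix z :: complex and s u t :: real assume z: "norm z \<le> \<rho>" and st: "0 \<le> s" "s \<le> u" "u \<le> t" "t \<le> T"
    have zD: "z \<in> unit_disc" using z \<rho> by auto
    have wr: "norm (\<phi> u t z) \<le> r" using st z by (intro r(3)) auto
    have "norm (\<phi> s s (\<phi> u t z) - \<phi> s u (\<phi> u t z)) \<le> integral {s..u} k"
      using st wr by (intro k(2)) auto
    moreover have "\<phi> s s (\<phi> u t z) = \<phi> u t z" using st zD by (intro refl in_disc) auto
    moreover have "\<phi> s u (\<phi> u t z) = \<phi> s t z" using comp[OF st(1-3) zD] by simp
    ultimately show "norm (\<phi> u t z - \<phi> s t z) \<le> integral {s..u} k" by simp
  qed auto
qed

lemma abs_continuous_in_s:
  assumes "0 \<le> t" "z \<in> unit_disc"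
  shows "abs_continuous_on {0..t} (\<lambda>s. \<phi> s t z)"
proof (cases "t = 0")
  case True
  have "norm (\<phi> y t z - \<phi> x t z) \<le> integral {x..y} (\<lambda>_. 0)" if "0 \<le> x" "x \<le> y" "y \<le> t" for x y
  proof -
    have "x = y" using that True by simp
    then show ?thesis by simp
  qed
  then show ?thesis by (rule abs_continuous_on_integral_bound[rotated 2]) auto
next
  case False
  then have t: "0 < t" using assms by simp
  obtain k where k: "k integrable_on {0..t}" "\<And>x. x \<in> {0..t} \<Longrightarrow> 0 \<le> k x"
    "\<And>z' s u t'. norm z' \<le> norm z \<Longrightarrow> 0 \<le> s \<Longrightarrow> s \<le> u \<Longrightarrow> u \<le> t' \<Longrightarrow> t' \<le> t \<Longrightarrow>
       norm (\<phi> u t' z' - \<phi> s t' z') \<le> integral {s..u} k"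
    using bound_in_s[OF t, of "norm z"] assms by auto
  show ?thesis by (rule abs_continuous_on_integral_bound[OF k(1,2)]) (use k(3) in auto)
qed

text \<open>
  If two trajectories meet, then just above the largest meeting time \<open>v\<close> they differ, but
  \<open>\<phi> v u\<close> is \<open>C\<^sup>1\<close>-close to the identity for \<open>u\<close> near \<open>v\<close>, hence injective.
\<close>

lemma univalent:
  assumes st: "0 \<le> s" "s \<le> t"
  shows "inj_on (\<phi> s t) unit_disc"
proof (rule inj_onI, rule ccontr)
  fix a b assume ab: "a \<in> unit_disc" "b \<in> unit_disc" "\<phi> s t a = \<phi> s t b" "a \<noteq> b"
  have "s \<noteq> t" using ab refl[of s a] refl[of s b] st by auto
  then have T: "0 < t" using st by simp
  define q where "q u = \<phi> u t a - \<phi> u t b" for u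
  have qc: "continuous_on {0..t} q"
    unfolding q_def using T ab
    by (intro continuous_intros abs_continuous_on_imp_continuous_on abs_continuous_in_s) auto
  define Z where "Z = {u \<in> {s..t}. q u = 0}"
  have "closed Z" unfolding Z_def
    by (rule continuous_closed_preimage_constant[OF continuous_on_subset[OF qc]]) (use st in auto)
  moreover have "s \<in> Z" using ab st by (simp add: Z_def q_def)
  moreover have bdd: "bdd_above Z" by (rule bdd_aboveI[of _ t]) (auto simp: Z_def)
  ultimately have v: "Sup Z \<in> Z" using closed_contains_Sup by blast
  define v where "v = Sup Z"
  have qv: "s \<le> v" "v \<le> t" "q v = 0" using v by (auto simp: Z_def v_def)
  have "q t = a - b" using refl[of t] ab T by (simp add: q_def)
  then have vt: "v < t" using qv ab by (cases "v = t") auto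
  have qnz: "q u \<noteq> 0" if "v < u" "u \<le> t" for u
    using cSup_upper[OF _ bdd, of u] that qv by (auto simp: Z_def v_def)
  obtain r where r: "0 \<le> r" "r < 1"
    "\<And>z u t'. norm z \<le> max (norm a) (norm b) \<Longrightarrow> 0 \<le> u \<Longrightarrow> u \<le> t' \<Longrightarrow> t' \<le> t \<Longrightarrow> norm (\<phi> u t' z) \<le> r"
    using uniform_radius[OF T, of "max (norm a) (norm b)"] ab by auto
  define R where "R = (1 + r) / 2"
  have R: "r < R" "R < 1" using r by (auto simp: R_def)
  obtain k where k: "k \<in> nonneg_Lspace d t"
    "\<And>z s u t'. norm z \<le> R \<Longrightarrow> 0 \<le> s \<Longrightarrow> s \<le> u \<Longrightarrow> u \<le> t' \<Longrightarrow> t' \<le> t \<Longrightarrow>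
       norm (\<phi> s u z - \<phi> s t' z) \<le> integral {u..t'} k"
    using uniform_bound[OF T R(2)] by blast
  note ki = nonneg_Lspace_integrable(1)[OF k(1) d]
  have v0: "0 \<le> v" using qv st by simp
  have "continuous_on {v..t} (\<lambda>u. integral {v..u} k)"
    by (rule indefinite_integral_continuous_1[OF integrable_on_subinterval_real[OF ki]]) (use v0 in auto)
  then have "((\<lambda>u. integral {v..u} k) \<longlongrightarrow> integral {v..v} k) (at v within {v..t})"
    unfolding continuous_on by (rule bspec) (use vt in simp)
  then have "\<forall>\<^sub>F u in at v within {v..t}. dist (integral {v..u} k) 0 < (R - r) / 2"
    using R by (intro tendstoD) auto
  then obtain \<delta> where \<delta>: "0 < \<delta>" "\<And>u. u \<in> {v..t} \<Longrightarrow> u \<noteq> v \<Longrightarrow> dist u v < \<delta> \<Longrightarrow> \<bar>integral {v..u} k\<bar> < (R - r) / 2"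
    by (auto simp: eventually_at)
  \<comment> \<open>At this \<open>u\<close> the displacement of \<open>\<phi> v u\<close> is below
    \<open>(R - r) / 2\<close> on \<open>cball 0 R\<close>. Cauchy's estimate makes it Lipschitz
    with constant \<open>1/2\<close> on \<open>cball 0 r\<close>, so \<open>\<phi> v u\<close>
    cannot identify \<open>a'\<close> and \<open>b'\<close>.\<close>
  define u where "u = min t (v + \<delta> / 2)"
  have u: "v < u" "u \<le> t" "dist u v < \<delta>" using vt \<delta>(1) by (auto simp: u_def dist_real_def)
  have e: "\<bar>integral {v..u} k\<bar> < (R - r) / 2" using u by (intro \<delta>(2)) auto
  define a' b' where "a' = \<phi> u t a" and "b' = \<phi> u t b"
  have ab': "norm a' \<le> r" "norm b' \<le> r" "a' \<noteq> b'"
    using r(3)[of a u t] r(3)[of b u t] qnz[OF u(1,2)] u v0 by (auto simp: a'_def b'_def q_def)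
  have eq: "\<phi> v u a' = \<phi> v u b'"
    using comp[of v u t a] comp[of v u t b] qv u v0 ab by (simp add: a'_def b'_def q_def)
  have "norm ((\<phi> v u a' - a') - (\<phi> v u b' - b')) \<le> integral {v..u} k / (R - r) * norm (a' - b')"
  proof (rule holomorphic_bounded_Lipschitz[OF _ R _ ab'(1,2)])
    show "(\<lambda>z. \<phi> v u z - z) holomorphic_on unit_disc" using u v0 by (intro holomorphic_intros holo) auto
    show "norm (\<phi> v u z - z) \<le> integral {v..u} k" if "norm z \<le> R" for z
      using k(2)[OF that v0, of v u] refl[OF v0, of z] that R u by (simp add: norm_minus_commute)
  qed
  also have "\<dots> \<le> (R - r) / 2 / (R - r) * norm (a' - b')"
    using e R by (intro mult_right_mono divide_right_mono) auto
  also have "(R - r) / 2 / (R - r) = 1 / 2" using R by (simp add: divide_divide_eq_left' del: divide_divide_eq_left)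
  also have "norm ((\<phi> v u a' - a') - (\<phi> v u b' - b')) = norm (a' - b')"
    using eq by (simp add: norm_minus_commute)
  finally show False using ab' by simp
qed

end

text \<open>The bounded intervals need no gluing: for each \<open>t\<close> one interval
  \<open>{0..real (Suc (m t))}\<close> is chosen in which \<open>t\<close> is not the right
  endpoint, and its derivative is the one within \<open>{0..}\<close>.\<close>

lemma locally_uniform_derivative_AE_atLeast0:
  fixes F :: "real \<Rightarrow> complex \<Rightarrow> complex"
  assumes hol: "\<And>t. 0 \<le> t \<Longrightarrow> F t holomorphic_on unit_disc"
    and bd: "\<And>r T. r < 1 \<Longrightarrow> 0 < T \<Longrightarrow> \<exists>k. k integrable_on {0..T} \<and> (\<forall>t\<in>{0..T}. 0 \<le> k t) \<and>
      (\<forall>z s t. norm z \<le> r \<and> 0 \<le> s \<and> s \<le> t \<and> t \<le> T \<longrightarrow> norm (F t z - F s z) \<le> integral {s..t} k)"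
  obtains N g where "negligible N"
    "\<And>t. 0 \<le> t \<Longrightarrow> t \<notin> N \<Longrightarrow> g t holomorphic_on unit_disc"
    "\<And>t r. 0 \<le> t \<Longrightarrow> t \<notin> N \<Longrightarrow> r < 1 \<Longrightarrow>
      uniform_limit (cball 0 r) (\<lambda>\<tau> z. (F \<tau> z - F t z) /\<^sub>R (\<tau> - t)) (g t) (at t within {0..})"
proof -
  define P where "P m N g \<longleftrightarrow> negligible N \<and>
    (\<forall>t\<in>{0..real (Suc m)} - N. g t holomorphic_on unit_disc \<and> (\<forall>r<1.
      uniform_limit (cball 0 r) (\<lambda>\<tau> z. (F \<tau> z - F t z) /\<^sub>R (\<tau> - t)) (g t) (at t within {0..real (Suc m)})))"
    for m :: nat and N g
  have "\<exists>N g. P m N g" for m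
  proof -
    have 1: "F t holomorphic_on unit_disc" if "t \<in> {0..real (Suc m)}" for t using hol that by simp
    have 2: "\<exists>k. k integrable_on {0..real (Suc m)} \<and> (\<forall>t\<in>{0..real (Suc m)}. 0 \<le> k t) \<and>
      (\<forall>z s t. norm z \<le> r \<and> 0 \<le> s \<and> s \<le> t \<and> t \<le> real (Suc m) \<longrightarrow> norm (F t z - F s z) \<le> integral {s..t} k)"
      if "r < 1" for r by (rule bd[OF that]) simp
    from locally_uniform_derivative_AE[OF 1 2] obtain N g where "negligible N" "real (Suc m) \<in> N"
      "\<And>t. t \<in> {0..real (Suc m)} - N \<Longrightarrow> g t holomorphic_on unit_disc"
      "\<And>t r. t \<in> {0..real (Suc m)} - N \<Longrightarrow> r < 1 \<Longrightarrow>
      uniform_limit (cball 0 r) (\<lambda>\<tau> z. (F \<tau> z - F t z) /\<^sub>R (\<tau> - t)) (g t) (at t within {0..real (Suc m)})"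
      by blast
    then have "P m N g" unfolding P_def by blast
    then show ?thesis by blast
  qed
  then obtain N g where P: "\<And>m. P m (N m) (g m)" by metis
  define m where "m t = nat \<lceil>t\<rceil>" for t :: real
  have m: "t \<in> {0..real (Suc (m t))}" "t < real (Suc (m t))" if "0 \<le> t" for t
  proof -
    have "t \<le> real (m t)" unfolding m_def by (rule real_nat_ceiling_ge)
    then show "t \<in> {0..real (Suc (m t))}" "t < real (Suc (m t))" using that by simp_all
  qed
  show ?thesis
  proof (rule that[of "\<Union>m. N m" "\<lambda>t. g (m t) t"])
    show "negligible (\<Union>m. N m)" using P by (intro negligible_Union_nat) (simp add: P_def)
    fix t :: real assume t: "0 \<le> t" "t \<notin> (\<Union>m. N m)"
    then have tm: "t \<in> {0..real (Suc (m t))} - N (m t)" using m[OF t(1)] by blast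
    then show "g (m t) t holomorphic_on unit_disc" using P[of "m t"] unfolding P_def by blast
    fix r :: real assume "r < 1"
    then have "uniform_limit (cball 0 r) (\<lambda>\<tau> z. (F \<tau> z - F t z) /\<^sub>R (\<tau> - t)) (g (m t) t) (at t within {0..real (Suc (m t))})"
      using P[of "m t"] tm unfolding P_def by blast
    moreover have "at t within {0..real (Suc (m t))} = at t within {0..}"
      by (rule at_within_nhd[of t "{..<real (Suc (m t))}"]) (use m[OF t(1)] in auto)
    ultimately show "uniform_limit (cball 0 r) (\<lambda>\<tau> z. (F \<tau> z - F t z) /\<^sub>R (\<tau> - t)) (g (m t) t) (at t within {0..})"
      by simp
  qed
qed

text \<open>Needed where time and point vary together, as in the slope of
  \<open>s \<mapsto> f\<^sub>s (\<phi> s t z)\<close>, written \<open>f s (\<phi> s t z)\<close> in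
  the code.\<close>

lemma uniform_limit_moving_point:
  fixes q :: "'a \<Rightarrow> 'b::metric_space \<Rightarrow> 'c::real_normed_vector"
  assumes q: "uniform_limit A q g F" and v: "(v \<longlongrightarrow> a) F" "\<forall>\<^sub>F y in F. v y \<in> A"
    and g: "continuous_on A g" "a \<in> A"
  shows "((\<lambda>y. q y (v y)) \<longlongrightarrow> g a) F"
proof -
  have "((\<lambda>y. q y (v y) - g (v y)) \<longlongrightarrow> 0) F"
  proof (rule tendstoI)
    fix e :: real assume "0 < e"
    from uniform_limitD[OF q this] v(2) show "\<forall>\<^sub>F y in F. dist (q y (v y) - g (v y)) 0 < e"
      by eventually_elim (auto simp: dist_norm)
  qed
  from tendsto_add[OF this continuous_on_tendsto_compose[OF g(1) v(1) g(2) v(2)]] show ?thesis by simp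
qed

text \<open>A chain rule read backwards: differentiability of \<open>v\<close> is deduced from that
  of \<open>f (v y)\<close>. The slope function \<open>h\<close> of \<open>f\<close> at
  \<open>v x\<close> is continuous with value \<open>c \<noteq> 0\<close>, so it can be divided out
  without a local inverse of \<open>f\<close>.\<close>

lemma has_vector_derivative_inverse_chain:
  fixes f :: "complex \<Rightarrow> complex"
  assumes f: "(f has_field_derivative c) (at (v x))" and c: "c \<noteq> 0"
    and v: "(v \<longlongrightarrow> v x) (at x within S)"
    and fv: "((\<lambda>y. f (v y)) has_vector_derivative D) (at x within S)"
  shows "(v has_vector_derivative D / c) (at x within S)"
proof -
  obtain h where h: "\<And>z. f z - f (v x) = h z * (z - v x)" "isCont h (v x)" "h (v x) = c"
    using f unfolding CARAT_DERIV by blast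
  have hv: "((\<lambda>y. h (v y)) \<longlongrightarrow> c) (at x within S)"
    using isCont_tendsto_compose[OF h(2) v] h(3) by simp
  have "((\<lambda>y. (f (v y) - f (v x)) /\<^sub>R (y - x) / h (v y)) \<longlongrightarrow> D / c) (at x within S)"
    using fv by (intro tendsto_divide hv c) (simp add: has_vector_derivative_iff_slope)
  moreover have "\<forall>\<^sub>F y in at x within S. h (v y) \<noteq> 0" by (rule tendsto_imp_eventually_ne[OF hv c])
  then have "\<forall>\<^sub>F y in at x within S. (f (v y) - f (v x)) /\<^sub>R (y - x) / h (v y) = (v y - v x) /\<^sub>R (y - x)"
    by eventually_elim (simp add: h(1) scaleR_conv_of_real)
  ultimately show ?thesis unfolding has_vector_derivative_iff_slope by (rule Lim_transform_eventually)
qed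

context reverse_evolution
begin

lemma bound_in_t:
  assumes "r < 1" "0 < T"
  shows "\<exists>k. k integrable_on {0..T} \<and> (\<forall>t\<in>{0..T}. 0 \<le> k t) \<and>
      (\<forall>z s t. norm z \<le> r \<and> 0 \<le> s \<and> s \<le> t \<and> t \<le> T \<longrightarrow> norm (\<phi> 0 t z - \<phi> 0 s z) \<le> integral {s..t} k)"
proof -
  obtain k where k: "k \<in> nonneg_Lspace d T"
    "\<And>z s u t. norm z \<le> r \<Longrightarrow> 0 \<le> s \<Longrightarrow> s \<le> u \<Longrightarrow> u \<le> t \<Longrightarrow> t \<le> T \<Longrightarrow>
       norm (\<phi> s u z - \<phi> s t z) \<le> integral {u..t} k"
    using uniform_bound[OF assms(2,1)] by blast
  show ?thesis
    using nonneg_Lspace_integrable(1,2)[OF k(1) d] k(2)[of _ 0]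
    by (intro exI[of _ k]) (auto simp: norm_minus_commute)
qed

lemma deriv_nonzero: "0 \<le> t \<Longrightarrow> z \<in> unit_disc \<Longrightarrow> deriv (\<phi> 0 t) z \<noteq> 0"
  using holomorphic_injective_imp_regular[OF holo open_ball univalent] by simp

lemma continuous_in_t:
  assumes s: "0 \<le> s" and z: "z \<in> unit_disc"
  shows "continuous_on {s..} (\<lambda>t. \<phi> s t z)"
proof -
  have c: "continuous_on {s..T} (\<lambda>t. \<phi> s t z)" if T: "0 < T" for T
  proof -
    obtain k where k: "k \<in> nonneg_Lspace d T"
      "\<And>s u t. 0 \<le> s \<Longrightarrow> s \<le> u \<Longrightarrow> u \<le> t \<Longrightarrow> t \<le> T \<Longrightarrow> norm (\<phi> s u z - \<phi> s t z) \<le> integral {u..t} k"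
      using pointwise_bound[OF z T] by blast
    show ?thesis
    proof (rule abs_continuous_on_imp_continuous_on, rule abs_continuous_on_integral_bound)
      show "k integrable_on {s..T}"
        using s by (intro integrable_on_subinterval_real[OF nonneg_Lspace_integrable(1)[OF k(1) d]]) auto
      show "norm (\<phi> s y z - \<phi> s x z) \<le> integral {x..y} k" if "s \<le> x" "x \<le> y" "y \<le> T" for x y
        using k(2)[of s x y] that s by (simp add: norm_minus_commute)
    qed (use nonneg_Lspace_integrable(2)[OF k(1) d] s in auto)
  qed
  show ?thesis
    unfolding continuous_on_def
  proof
    fix t assume t: "t \<in> {s..}"
    have "((\<lambda>t. \<phi> s t z) \<longlongrightarrow> \<phi> s t z) (at t within {s..t + 1})"
      using c[of "t + 1"] t s by (auto simp: continuous_on_def)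
    moreover have "at t within {s..t + 1} = at t within {s..}"
      by (rule at_within_nhd[of t "{..<t + 1}"]) auto
    ultimately show "((\<lambda>t. \<phi> s t z) \<longlongrightarrow> \<phi> s t z) (at t within {s..})" by simp
  qed
qed

end

section \<open>The Herglotz vector field generating a reverse evolution family\<close>

locale generating_field = reverse_evolution +
  fixes N :: "real set" and g :: "real \<Rightarrow> complex \<Rightarrow> complex"
  assumes N: "negligible N"
    and g_hol: "\<And>t. 0 \<le> t \<Longrightarrow> t \<notin> N \<Longrightarrow> g t holomorphic_on unit_disc"
    and g_lim: "\<And>t r. 0 \<le> t \<Longrightarrow> t \<notin> N \<Longrightarrow> r < 1 \<Longrightarrow>
      uniform_limit (cball 0 r) (\<lambda>\<tau> z. (\<phi> 0 \<tau> z - \<phi> 0 t z) /\<^sub>R (\<tau> - t)) (g t) (at t within {0..})"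
begin

text \<open>The PDE for \<open>F(z, t) = \<phi> 0 t z\<close>, solved for \<open>G\<close>.\<close>

definition field :: "complex \<Rightarrow> real \<Rightarrow> complex" where
  "field z t = (if t \<in> N then 0 else g t z / deriv (\<phi> 0 t) z)"

lemma derivative_in_t:
  assumes t: "0 \<le> t" "t \<notin> N" and z: "z \<in> unit_disc"
  shows "((\<lambda>\<tau>. \<phi> 0 \<tau> z) has_vector_derivative g t z) (at t within {0..})"
  unfolding has_vector_derivative_iff_slope
  using tendsto_uniform_limitI[OF g_lim[OF t, of "norm z"], of z] z by simp

text \<open>Differentiability in \<open>s\<close> is not known in advance, so the chain rule cannot
  be applied to the constant function \<open>\<phi> 0 y (\<phi> y t z)\<close> of \<open>y\<close>.
  Its slope is split instead: the part from the time derivative at the moving point converges to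
  \<open>g\<close>, hence the other part converges to \<open>- g\<close>, and the nonvanishing
  derivative of \<open>\<phi> 0 x\<close> is divided out.\<close>

lemma derivative_in_s:
  assumes t: "0 \<le> t" and z: "z \<in> unit_disc" and x: "x \<in> {0..t}" "x \<notin> N"
  shows "((\<lambda>s. \<phi> s t z) has_vector_derivative - field (\<phi> x t z) x) (at x within {0..t})"
proof -
  have T: "0 < t + 1" using t by simp
  obtain r where r: "0 \<le> r" "r < 1"
    "\<And>z' u t'. norm z' \<le> norm z \<Longrightarrow> 0 \<le> u \<Longrightarrow> u \<le> t' \<Longrightarrow> t' \<le> t + 1 \<Longrightarrow> norm (\<phi> u t' z') \<le> r"
    using uniform_radius[OF T, of "norm z"] z by auto
  let ?w = "\<lambda>s. \<phi> s t z"
  have wr: "?w s \<in> cball 0 r" if "s \<in> {0..t}" for s using r(3)[of z s t] that by simp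
  have sub: "cball 0 r \<subseteq> unit_disc" using r by auto
  have x0: "0 \<le> x" using x by simp
  have wc: "(?w \<longlongrightarrow> ?w x) (at x within {0..t})"
    using abs_continuous_on_imp_continuous_on[OF abs_continuous_in_s[OF t z]] x by (simp add: continuous_on_def)
  have "((\<lambda>y. (\<phi> 0 y (?w y) - \<phi> 0 x (?w y)) /\<^sub>R (y - x)) \<longlongrightarrow> g x (?w x)) (at x within {0..t})"
  proof (rule uniform_limit_moving_point[OF _ wc])
    show "uniform_limit (cball 0 r) (\<lambda>\<tau> z. (\<phi> 0 \<tau> z - \<phi> 0 x z) /\<^sub>R (\<tau> - x)) (g x) (at x within {0..t})"
      using g_lim[OF x0 x(2) r(2)] by (rule filterlim_mono) (auto intro: at_le)
    show "\<forall>\<^sub>F y in at x within {0..t}. ?w y \<in> cball 0 r" using wr by (simp add: eventually_at_filter)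
    show "continuous_on (cball 0 r) (g x)"
      by (rule continuous_on_subset[OF holomorphic_on_imp_continuous_on[OF g_hol[OF x0 x(2)]] sub])
    show "?w x \<in> cball 0 r" by (rule wr[OF x(1)])
  qed
  then have "((\<lambda>y. - ((\<phi> 0 y (?w y) - \<phi> 0 x (?w y)) /\<^sub>R (y - x))) \<longlongrightarrow> - g x (?w x)) (at x within {0..t})"
    by (rule tendsto_minus)
  moreover have "\<forall>\<^sub>F y in at x within {0..t}. - ((\<phi> 0 y (?w y) - \<phi> 0 x (?w y)) /\<^sub>R (y - x)) =
      (\<phi> 0 x (?w y) - \<phi> 0 x (?w x)) /\<^sub>R (y - x)"
  proof -
    have "\<phi> 0 y (?w y) = \<phi> 0 x (?w x)" if "y \<in> {0..t}" for y
      using comp[of 0 y t z] comp[of 0 x t z] x that z by simp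
    then have "- ((\<phi> 0 y (?w y) - \<phi> 0 x (?w y)) /\<^sub>R (y - x)) = (\<phi> 0 x (?w y) - \<phi> 0 x (?w x)) /\<^sub>R (y - x)"
      if "y \<in> {0..t}" for y using that by (simp flip: scaleR_minus_right)
    then show ?thesis by (simp add: eventually_at_filter)
  qed
  ultimately have "((\<lambda>y. \<phi> 0 x (?w y)) has_vector_derivative - g x (?w x)) (at x within {0..t})"
    unfolding has_vector_derivative_iff_slope by (rule Lim_transform_eventually)
  moreover have wD: "?w x \<in> unit_disc" using wr[OF x(1)] sub by blast
  then have "(\<phi> 0 x has_field_derivative deriv (\<phi> 0 x) (?w x)) (at (?w x))"
    by (intro holomorphic_derivI[OF holo]) (use x in auto)
  ultimately have "(?w has_vector_derivative - g x (?w x) / deriv (\<phi> 0 x) (?w x)) (at x within {0..t})"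
    using deriv_nonzero[OF x0 wD] wc by (intro has_vector_derivative_inverse_chain[where f="\<phi> 0 x"]) auto
  then show ?thesis using x by (simp add: field_def)
qed

text \<open>This presents \<open>field\<close> as a limit of displacements of the self-maps
  \<open>\<phi> t y\<close>. From here it inherits both the Berkson-Porta inequality and the bound
  of order \<open>d\<close>, neither of which is visible in the quotient that defines it.\<close>

lemma right_derivative:
  assumes t: "0 \<le> t" "t \<notin> N" and z: "z \<in> unit_disc"
  shows "((\<lambda>y. \<phi> t y z) has_vector_derivative field z t) (at t within {t..})"
proof -
  have tt: "\<phi> t t z = z" using refl t z by simp
  have "((\<lambda>y. \<phi> 0 y z) has_vector_derivative g t z) (at t within {t..})"
    by (rule has_vector_derivative_within_subset[OF derivative_in_t[OF t z]]) (use t in auto)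
  then have "((\<lambda>y. \<phi> 0 t (\<phi> t y z)) has_vector_derivative g t z) (at t within {t..})"
    by (rule has_vector_derivative_transform[rotated 2]) (use t z comp in auto)
  moreover have "((\<lambda>y. \<phi> t y z) \<longlongrightarrow> \<phi> t t z) (at t within {t..})"
    using continuous_in_t[OF t(1) z] by (simp add: continuous_on_def)
  moreover have "(\<phi> 0 t has_field_derivative deriv (\<phi> 0 t) z) (at (\<phi> t t z))"
    unfolding tt by (intro holomorphic_derivI[OF holo]) (use t z in auto)
  ultimately have "((\<lambda>y. \<phi> t y z) has_vector_derivative g t z / deriv (\<phi> 0 t) z) (at t within {t..})"
    using deriv_nonzero[OF t(1) z] by (intro has_vector_derivative_inverse_chain[where f="\<phi> 0 t"]) auto
  then show ?thesis using t by (simp add: field_def)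
qed

lemma field_inward: "inward_pointing (\<lambda>z. field z t)" if t: "0 \<le> t"
proof (cases "t \<in> N")
  case True
  then show ?thesis by (simp add: inward_pointing_def field_def)
next
  case False
  show ?thesis
  proof (rule inward_pointing_limit[of "\<lambda>h. \<phi> t (t + h)"])
    show "\<forall>\<^sub>F h in at_right 0. hol_self_map (\<phi> t (t + h))"
      using eventually_at_right_less by eventually_elim (use t in \<open>auto intro: self\<close>)
    fix z :: complex assume z: "z \<in> unit_disc"
    have "((\<lambda>y. (\<phi> t y z - \<phi> t t z) /\<^sub>R (y - t)) \<longlongrightarrow> field z t) (at t within {t..})"
      using right_derivative[OF t False z] by (simp add: has_vector_derivative_iff_slope)
    moreover have "filterlim (\<lambda>h. t + h) (at t within {t..}) (at_right 0)"
      unfolding filterlim_at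
    proof
      show "\<forall>\<^sub>F h in at_right 0. t + h \<in> {t..} \<and> t + h \<noteq> t"
        using eventually_at_right_less by eventually_elim auto
      have "((\<lambda>h. t + h) \<longlongrightarrow> t + 0) (at_right 0)" by (intro tendsto_intros)
      then show "((\<lambda>h. t + h) \<longlongrightarrow> t) (at_right 0)" by simp
    qed
    ultimately have "((\<lambda>h. (\<phi> t (t + h) z - \<phi> t t z) /\<^sub>R (t + h - t)) \<longlongrightarrow> field z t) (at_right 0)"
      by (rule filterlim_compose)
    then show "((\<lambda>h. (\<phi> t (t + h) z - z) /\<^sub>R h) \<longlongrightarrow> field z t) (at_right 0)"
      using refl[OF t z] by simp
  qed
qed

lemma field_holomorphic: "0 \<le> t \<Longrightarrow> (\<lambda>z. field z t) holomorphic_on unit_disc"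
proof (cases "t \<in> N")
  case False
  assume t: "0 \<le> t"
  have "(\<lambda>z. g t z / deriv (\<phi> 0 t) z) holomorphic_on unit_disc"
    using t False deriv_nonzero by (intro holomorphic_on_divide g_hol holomorphic_deriv holo open_ball) auto
  then show ?thesis using False by (simp add: field_def)
qed (simp add: field_def)

text \<open>Both the derivative in \<open>t\<close> and the derivative in \<open>z\<close> are
  limits along fixed sequences of quotients of functions that are continuous in \<open>t\<close>.
  The increments \<open>c n\<close> are small enough for \<open>z + c n\<close> to stay in the
  disc.\<close>

lemma field_measurable:
  assumes z: "z \<in> unit_disc"
  shows "(\<lambda>t. field z t) \<in> borel_measurable (lebesgue_on {0..})"
proof -
  let ?M = "lebesgue_on {0::real..}"
  have m: "(\<lambda>t. \<phi> 0 (t + c) v) \<in> borel_measurable ?M" if "v \<in> unit_disc" "0 \<le> c" for v c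
  proof (rule continuous_imp_measurable_on_sets_lebesgue)
    show "continuous_on {0..} (\<lambda>t. \<phi> 0 (t + c) v)"
      by (rule continuous_on_compose2[OF continuous_in_t[OF order_refl that(1)]])
        (use that in \<open>auto intro!: continuous_intros\<close>)
  qed simp
  have m0: "(\<lambda>t. \<phi> 0 t v) \<in> borel_measurable ?M" if "v \<in> unit_disc" for v
    using m[OF that, of 0] by simp
  define c where "c n = complex_of_real ((1 - norm z) / real (n + 2))" for n :: nat
  have c: "c n \<noteq> 0" "z + c n \<in> unit_disc" for n
  proof -
    have "0 < (1 - norm z) / real (n + 2)" using z by simp
    then show "c n \<noteq> 0" by (simp only: c_def of_real_eq_0_iff)
    have "(1 - norm z) / real (n + 2) < (1 - norm z) / 1"
      using z by (intro divide_strict_left_mono) auto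
    then have "norm (c n) < 1 - norm z"
      using \<open>0 < (1 - norm z) / real (n + 2)\<close> by (simp only: c_def norm_of_real abs_of_pos div_by_1)
    then show "z + c n \<in> unit_disc" using norm_triangle_ineq[of z "c n"] by simp
  qed
  have "(\<lambda>n. (1 - norm z) / real (n + 2)) \<longlonglongrightarrow> 0"
    using LIMSEQ_ignore_initial_segment[OF lim_const_over_n[of "1 - norm z"], of 2] by simp
  from tendsto_of_real[OF this, where 'a=complex] have clim: "c \<longlonglongrightarrow> 0" by (simp add: c_def[abs_def])
  have dm: "(\<lambda>t. deriv (\<phi> 0 t) z) \<in> borel_measurable ?M"
  proof (rule borel_measurable_LIMSEQ_metric)
    show "(\<lambda>t. (\<phi> 0 t (z + c n) - \<phi> 0 t z) / c n) \<in> borel_measurable ?M" for n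
      using m0[OF z] m0[OF c(2)] by measurable
    fix t assume "t \<in> space ?M"
    then have t: "0 \<le> t" by simp
    have "(\<phi> 0 t has_field_derivative deriv (\<phi> 0 t) z) (at z)"
      by (intro holomorphic_derivI[OF holo]) (use t z in auto)
    then have "((\<lambda>h. (\<phi> 0 t (z + h) - \<phi> 0 t z) / h) \<longlongrightarrow> deriv (\<phi> 0 t) z) (at 0)"
      by (simp add: DERIV_def)
    moreover have "filterlim c (at 0) sequentially"
      using clim c(1) by (simp add: filterlim_at)
    ultimately show "(\<lambda>n. (\<phi> 0 t (z + c n) - \<phi> 0 t z) / c n) \<longlonglongrightarrow> deriv (\<phi> 0 t) z"
      by (rule filterlim_compose)
  qed
  have "{t \<in> space ?M. t \<in> N} = N \<inter> {0..}" by auto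
  also have "\<dots> \<in> sets ?M"
    using negligible_imp_sets[OF N] by (auto simp: sets_restrict_space image_iff Int_commute)
  finally have Nm: "{t \<in> space ?M. t \<in> N} \<in> sets ?M" .
  show ?thesis
  proof (rule borel_measurable_LIMSEQ_metric)
    let ?h = "\<lambda>n::nat. 1 / real (Suc n)"
    show "(\<lambda>t. if t \<in> N then 0 else ((\<phi> 0 (t + ?h n) z - \<phi> 0 t z) /\<^sub>R ?h n) / deriv (\<phi> 0 t) z)
        \<in> borel_measurable ?M" for n
      using m[OF z, of "?h n"] m0[OF z] dm Nm by (intro measurable_If borel_measurable_divide) auto
    fix t assume "t \<in> space ?M"
    then have t: "0 \<le> t" by simp
    show "(\<lambda>n. if t \<in> N then 0 else ((\<phi> 0 (t + ?h n) z - \<phi> 0 t z) /\<^sub>R ?h n) / deriv (\<phi> 0 t) z) \<longlonglongrightarrow> field z t"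
    proof (cases "t \<in> N")
      case False
      have "((\<lambda>y. (\<phi> 0 y z - \<phi> 0 t z) /\<^sub>R (y - t)) \<longlongrightarrow> g t z) (at t within {0..})"
        using derivative_in_t[OF t False z] by (simp add: has_vector_derivative_iff_slope)
      moreover have "filterlim (\<lambda>n. t + ?h n) (at t within {0..}) sequentially"
        unfolding filterlim_at
      proof
        show "\<forall>\<^sub>F n in sequentially. t + ?h n \<in> {0..} \<and> t + ?h n \<noteq> t"
          using t by (intro always_eventually allI) (simp add: add_nonneg_nonneg)
        show "(\<lambda>n. t + ?h n) \<longlonglongrightarrow> t"
          using tendsto_add[OF tendsto_const LIMSEQ_Suc[OF lim_const_over_n[of "1::real"]], of t] by simp
      qed
      ultimately have "(\<lambda>n. (\<phi> 0 (t + ?h n) z - \<phi> 0 t z) /\<^sub>R (t + ?h n - t)) \<longlonglongrightarrow> g t z"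
        by (rule filterlim_compose)
      then have "(\<lambda>n. (\<phi> 0 (t + ?h n) z - \<phi> 0 t z) /\<^sub>R ?h n / deriv (\<phi> 0 t) z) \<longlonglongrightarrow> g t z / deriv (\<phi> 0 t) z"
        using deriv_nonzero[OF t z] by (intro tendsto_divide tendsto_const) auto
      then show ?thesis using False by (simp add: field_def)
    qed (simp add: field_def)
  qed
qed

text \<open>The right difference quotients of \<open>\<phi> t y z\<close> are bounded by the slopes
  of the indefinite integral of \<open>k\<close>. Where that integral has derivative
  \<open>k t\<close>, the same \<open>k\<close> bounds the field, so the order \<open>d\<close> is
  preserved.\<close>

lemma field_bound:
  assumes K: "compact K" "K \<subseteq> unit_disc" and T: "0 < T"
  shows "\<exists>k\<in>nonneg_Lspace d T. AE t in lebesgue_on {0..T}. \<forall>z\<in>K. norm (field z t) \<le> k t"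
proof -
  obtain r where r: "r < 1" "\<And>z. z \<in> K \<Longrightarrow> norm z \<le> r" using compact_subset_disc[OF K] by blast
  obtain k where k: "k \<in> nonneg_Lspace d T"
    "\<And>z s u t. norm z \<le> r \<Longrightarrow> 0 \<le> s \<Longrightarrow> s \<le> u \<Longrightarrow> u \<le> t \<Longrightarrow> t \<le> T \<Longrightarrow>
       norm (\<phi> s u z - \<phi> s t z) \<le> integral {u..t} k"
    using uniform_bound[OF T r(1)] by blast
  note ki = nonneg_Lspace_integrable(1)[OF k(1) d]
  obtain N' where N': "negligible N'" "\<And>x. x \<in> {0..T} - N' \<Longrightarrow>
      ((\<lambda>u. integral {0..u} k) has_vector_derivative k x) (at x within {0..T})"
    using indefinite_integral_differentiable_AE[OF ki] by blast
  \<comment> \<open>\<open>T\<close> is excluded because the slopes are compared on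
    \<open>{t<..<T}\<close>, which must accumulate at \<open>t\<close>.\<close>
  have le: "norm (field z t) \<le> k t" if z: "z \<in> K" and t: "t \<in> {0..T} - (N \<union> N' \<union> {T})" for z t
  proof (rule tendsto_le)
    have t': "0 \<le> t" "t < T" "t \<notin> N" using t by auto
    have zD: "z \<in> unit_disc" using z K by blast
    have sub: "{t<..<T} \<subseteq> {t..}" "{t<..<T} \<subseteq> {0..T}" using t' by auto
    show "at t within {t<..<T} \<noteq> bot" using t' by (simp add: trivial_limit_within islimpt_greaterThanLessThan1)
    have "((\<lambda>y. (\<phi> t y z - \<phi> t t z) /\<^sub>R (y - t)) \<longlongrightarrow> field z t) (at t within {t..})"
      using right_derivative[OF t'(1,3) zD] by (simp add: has_vector_derivative_iff_slope)
    then show "((\<lambda>y. norm ((\<phi> t y z - \<phi> t t z) /\<^sub>R (y - t))) \<longlongrightarrow> norm (field z t)) (at t within {t<..<T})"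
      by (intro tendsto_norm tendsto_within_subset[OF _ sub(1)])
    have "((\<lambda>y. (integral {0..y} k - integral {0..t} k) /\<^sub>R (y - t)) \<longlongrightarrow> k t) (at t within {0..T})"
      using N'(2)[of t] t by (simp add: has_vector_derivative_iff_slope)
    then show "((\<lambda>y. (integral {0..y} k - integral {0..t} k) /\<^sub>R (y - t)) \<longlongrightarrow> k t) (at t within {t<..<T})"
      by (rule tendsto_within_subset[OF _ sub(2)])
    have "norm ((\<phi> t y z - \<phi> t t z) /\<^sub>R (y - t)) \<le> (integral {0..y} k - integral {0..t} k) /\<^sub>R (y - t)"
      if y: "y \<in> {t<..<T}" for y
    proof -
      have "norm (\<phi> t y z - \<phi> t t z) \<le> integral {t..y} k"
        using k(2)[OF r(2)[OF z], of t t y] y t' by (simp add: norm_minus_commute)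
      also have "\<dots> = integral {0..y} k - integral {0..t} k"
        using Henstock_Kurzweil_Integration.integral_combine[of 0 t y k] y t'
          integrable_on_subinterval_real[OF ki, of 0 y] by simp
      finally show ?thesis using y by (simp add: divide_inverse mult_left_mono)
    qed
    then show "\<forall>\<^sub>F y in at t within {t<..<T}. norm ((\<phi> t y z - \<phi> t t z) /\<^sub>R (y - t)) \<le>
        (integral {0..y} k - integral {0..t} k) /\<^sub>R (y - t)"
      by (simp add: eventually_at_filter)
  qed
  have "AE t in lebesgue_on {0..T}. \<forall>z\<in>K. norm (field z t) \<le> k t"
    by (rule AE_lebesgue_onI[of "N \<union> N' \<union> {T}"]) (use N N' le in auto)
  then show ?thesis using k(1) by blast
qed

lemma field_Herglotz: "Herglotz_vector_field d field"
  unfolding Herglotz_vector_field_def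
proof (intro conjI ballI allI impI)
  show "(\<lambda>t. field z t) \<in> borel_measurable (lebesgue_on {0..})" if "z \<in> unit_disc" for z
    by (rule field_measurable[OF that])
  show "(\<lambda>z. field z t) holomorphic_on unit_disc" if "0 \<le> t" for t by (rule field_holomorphic[OF that])
  show "\<exists>k\<in>nonneg_Lspace d T. AE t in lebesgue_on {0..T}. \<forall>z\<in>K. norm (field z t) \<le> k t"
    if "compact K \<and> K \<subseteq> unit_disc \<and> 0 < T" for K T using field_bound that by blast
  have "\<exists>\<psi>. one_param_semigroup \<psi> \<and> infinitesimal_generator \<psi> (\<lambda>z. field z t)" if "0 \<le> t" for t
    using inward_pointing_imp_generator[OF field_holomorphic[OF that] field_inward[OF that]] by blast
  then show "AE t in lebesgue_on {0..}. \<exists>\<psi>. one_param_semigroup \<psi> \<and> infinitesimal_generator \<psi> (\<lambda>z. field z t)"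
    by (intro AE_I2) auto
qed

lemma field_corresponding: "LK_corresponding \<phi> field"
  unfolding LK_corresponding_def solves_LK_ODE_def
proof (intro allI ballI impI conjI)
  fix t :: real and z :: complex assume t: "0 \<le> t" and z: "z \<in> unit_disc"
  show "(\<lambda>s. \<phi> s t z) ` {0..t} \<subseteq> unit_disc" using in_disc z by auto
  show "locally_abs_continuous_on {0..t} (\<lambda>s. \<phi> s t z)"
    using abs_continuous_on_subset[OF abs_continuous_in_s[OF t z]] by (simp add: locally_abs_continuous_on_def)
  show "AE s in lebesgue_on {0..t}. ((\<lambda>s. \<phi> s t z) has_vector_derivative - field (\<phi> s t z) s) (at s within {0..t})"
    by (rule AE_lebesgue_onI[OF N]) (use derivative_in_s[OF t z] in auto)
  show "\<phi> t t z = z" by (rule refl[OF t z])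
qed

end

lemma (in reverse_evolution) generating_field_exists:
  obtains N g where "generating_field d \<phi> N g"
proof -
  obtain N g where "negligible N"
    "\<And>t. 0 \<le> t \<Longrightarrow> t \<notin> N \<Longrightarrow> g t holomorphic_on unit_disc"
    "\<And>t r. 0 \<le> t \<Longrightarrow> t \<notin> N \<Longrightarrow> r < 1 \<Longrightarrow>
      uniform_limit (cball 0 r) (\<lambda>\<tau> z. (\<phi> 0 \<tau> z - \<phi> 0 t z) /\<^sub>R (\<tau> - t)) (g t) (at t within {0..})"
    using locally_uniform_derivative_AE_atLeast0[of "\<phi> 0", OF holo[OF order_refl] bound_in_t] by blast
  then show ?thesis by (intro that[of N g]) unfold_locales
qed

subsection \<open>Uniqueness and solutions of the ODE\<close>

lemma eq_on_dense_imp_eq_on_open: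
  fixes h :: "'a::topological_space \<Rightarrow> 'b::t1_space"
  assumes U: "open U" and h: "continuous_on U h"
    and dense: "\<And>X. open X \<Longrightarrow> X \<noteq> {} \<Longrightarrow> \<exists>x\<in>D. x \<in> X"
    and eq: "\<And>x. x \<in> D \<inter> U \<Longrightarrow> h x = c" and x: "x \<in> U"
  shows "h x = c"
proof (rule ccontr)
  assume "h x \<noteq> c"
  have "open (U \<inter> h -` (- {c}))" by (rule continuous_open_preimage[OF h U]) auto
  moreover have "x \<in> U \<inter> h -` (- {c})" using x \<open>h x \<noteq> c\<close> by auto
  ultimately obtain y where "y \<in> D" "y \<in> U \<inter> h -` (- {c})" using dense by blast
  then show False using eq by auto
qed

context reverse_evolution
begin

text \<open>Only integer terminal times and a countable dense set of terminal values are used, so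
  the bad times form a null set. At any other time \<open>s\<close> the fields agree, by density and
  continuity, on the image of the disc under \<open>\<phi> s (real n)\<close>; univalence makes that
  image open, and the identity theorem extends the equality to the disc.\<close>

lemma corresponding_field_unique:
  assumes hol: "\<And>t. 0 \<le> t \<Longrightarrow> (\<lambda>z. G z t) holomorphic_on unit_disc"
      "\<And>t. 0 \<le> t \<Longrightarrow> (\<lambda>z. G' z t) holomorphic_on unit_disc"
    and corr: "LK_corresponding \<phi> G" "LK_corresponding \<phi> G'"
  obtains N where "negligible N" "\<And>t z. 0 \<le> t \<Longrightarrow> t \<notin> N \<Longrightarrow> z \<in> unit_disc \<Longrightarrow> G z t = G' z t"
proof -
  obtain D0 :: "complex set" where D0: "countable D0" "\<And>X. open X \<Longrightarrow> X \<noteq> {} \<Longrightarrow> \<exists>d\<in>D0. d \<in> X"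
    using countable_dense_setE by blast
  define bad where "bad H n z = {s \<in> {0..real n}.
    \<not> ((\<lambda>s. \<phi> s (real n) z) has_vector_derivative - H (\<phi> s (real n) z) s) (at s within {0..real n})}"
    for H :: "complex \<Rightarrow> real \<Rightarrow> complex" and n :: nat and z
  have bad: "negligible (bad H n z)" if H: "LK_corresponding \<phi> H" and z: "z \<in> unit_disc" for H n z
  proof -
    have "AE s in lebesgue_on {0..real n}.
        ((\<lambda>s. \<phi> s (real n) z) has_vector_derivative - H (\<phi> s (real n) z) s) (at s within {0..real n})"
      using H z unfolding LK_corresponding_def solves_LK_ODE_def by auto
    then show ?thesis unfolding bad_def by (subst (asm) AE_lebesgue_on_iff_negligible) auto
  qed
  define N where "N = (\<Union>n. \<Union>z\<in>D0 \<inter> unit_disc. bad G n z \<union> bad G' n z)"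
  have N: "negligible N"
    unfolding N_def
  proof (rule negligible_Union_nat, rule negligible_countable_Union)
    show "countable ((\<lambda>z. bad G n z \<union> bad G' n z) ` (D0 \<inter> unit_disc))" for n
      using D0(1) by (intro countable_image countable_Int1)
    show "negligible S" if "S \<in> (\<lambda>z. bad G n z \<union> bad G' n z) ` (D0 \<inter> unit_disc)" for n S
      using that bad corr by auto
  qed
  have "G z s = G' z s" if s: "0 \<le> s" "s \<notin> N" and z: "z \<in> unit_disc" for s z
  proof -
    obtain n :: nat where n: "s < real n" using reals_Archimedean2 by blast
    define h where "h z = G (\<phi> s (real n) z) s - G' (\<phi> s (real n) z) s" for z
    have sn: "s \<le> real n" using n by simp
    have h0: "h z = 0" if z: "z \<in> D0 \<inter> unit_disc" for z
    proof -
      have "s \<notin> bad G n z" "s \<notin> bad G' n z" using s(2) z by (auto simp: N_def)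
      then have "((\<lambda>s. \<phi> s (real n) z) has_vector_derivative - G (\<phi> s (real n) z) s) (at s within {0..real n})"
        "((\<lambda>s. \<phi> s (real n) z) has_vector_derivative - G' (\<phi> s (real n) z) s) (at s within {0..real n})"
        using s sn by (auto simp: bad_def)
      then have "- G (\<phi> s (real n) z) s = - G' (\<phi> s (real n) z) s"
        using s n by (intro vector_derivative_unique_within_closed_interval[of 0 "real n" s "\<lambda>s. \<phi> s (real n) z"])
          (auto simp: box_real)
      then show ?thesis by (simp add: h_def)
    qed
    have img: "\<phi> s (real n) ` unit_disc \<subseteq> unit_disc" using in_disc[OF s(1) sn] by blast
    have "continuous_on unit_disc h"
      unfolding h_def
      by (intro continuous_intros continuous_on_compose2[OF holomorphic_on_imp_continuous_on[OF hol(1)[OF s(1)]]]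
          continuous_on_compose2[OF holomorphic_on_imp_continuous_on[OF hol(2)[OF s(1)]]]
          holomorphic_on_imp_continuous_on holo s sn img)
    note hc = this
    have h: "h z = 0" if "z \<in> unit_disc" for z
      by (rule eq_on_dense_imp_eq_on_open[OF open_ball hc D0(2) _ that]) (use h0 in auto)
    have opn: "open (\<phi> s (real n) ` unit_disc)"
      by (rule open_mapping_thm3[OF holo[OF s(1) sn] open_ball univalent[OF s(1) sn]])
    have "G z s - G' z s = 0"
    proof (rule analytic_continuation[where f="\<lambda>z. G z s - G' z s" and S=unit_disc and U="\<phi> s (real n) ` unit_disc"])
      show "(\<lambda>z. G z s - G' z s) holomorphic_on unit_disc" by (intro holomorphic_intros hol s)
      show "\<phi> s (real n) 0 \<in> unit_disc" by (rule in_disc[OF s(1) sn]) simp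
      have "\<phi> s (real n) 0 \<in> \<phi> s (real n) ` unit_disc" by auto
      then show "\<phi> s (real n) 0 islimpt \<phi> s (real n) ` unit_disc"
        using opn interior_limit_point interior_open by blast
      show "G w s - G' w s = 0" if "w \<in> \<phi> s (real n) ` unit_disc" for w using that h by (auto simp: h_def)
    qed (use z img in auto)
    then show ?thesis by simp
  qed
  then show ?thesis using that N by blast
qed

end

section \<open>From Herglotz vector fields to reverse evolution families\<close>

lemma solves_LK_ODE_cong_AE:
  assumes w: "solves_LK_ODE G t z w" and N: "negligible N"
    and eq: "\<And>s z. 0 \<le> s \<Longrightarrow> s \<notin> N \<Longrightarrow> z \<in> unit_disc \<Longrightarrow> G z s = G' z s"
  shows "solves_LK_ODE G' t z w"
proof -
  have wD: "w s \<in> unit_disc" if "s \<in> {0..t}" for s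
    using w that unfolding solves_LK_ODE_def by blast
  obtain N' where N': "negligible N'"
    "\<And>s. s \<in> {0..t} \<Longrightarrow> s \<notin> N' \<Longrightarrow> (w has_vector_derivative - G (w s) s) (at s within {0..t})"
    using w by (auto simp: solves_LK_ODE_def elim: AE_lebesgue_onE)
  have "AE s in lebesgue_on {0..t}. (w has_vector_derivative - G' (w s) s) (at s within {0..t})"
  proof (rule AE_lebesgue_onI)
    show "negligible (N' \<union> N)" using N N' by simp
    fix s assume "s \<in> {0..t}" "s \<notin> N' \<union> N"
    then show "(w has_vector_derivative - G' (w s) s) (at s within {0..t})"
      using N'(2)[of s] eq[of s "w s"] wD[of s] by auto
  qed simp
  then show ?thesis using w by (simp add: solves_LK_ODE_def)
qed

lemma Herglotz_ODE_unique_solution: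
  assumes d: "1 \<le> d" and G: "Herglotz_vector_field d G" and t: "0 < t" and z: "z \<in> unit_disc"
  shows "\<exists>w. solves_LK_ODE G t z w \<and> (\<forall>w'. solves_LK_ODE G t z w' \<longrightarrow> (\<forall>s\<in>{0..t}. w' s = w s))"
proof -
  obtain N where N: "negligible N" "inward_field (\<lambda>z t. if t \<in> N then 0 else G z t)"
    using Herglotz_inward_field[OF d G] .
  interpret inward_field "\<lambda>z t. if t \<in> N then 0 else G z t" by (rule N(2))
  have t0: "0 \<le> t" using t by simp
  obtain w where w: "solves_LK_ODE (\<lambda>z t. if t \<in> N then 0 else G z t) t z w"
    using solution_exists[OF t0 z] .
  have to: "solves_LK_ODE (\<lambda>z t. if t \<in> N then 0 else G z t) t z w'" if "solves_LK_ODE G t z w'" for w'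
    by (rule solves_LK_ODE_cong_AE[OF that N(1)]) simp
  have "solves_LK_ODE G t z w" by (rule solves_LK_ODE_cong_AE[OF w N(1)]) simp
  then show ?thesis
  proof (intro exI conjI allI impI ballI)
    show "w' s = w s" if "solves_LK_ODE G t z w'" "s \<in> {0..t}" for w' s
      using solution_unique[OF to[OF that(1)] w] that(2) by simp
  qed
qed

text \<open>The composition rule is uniqueness of solutions. For the integral bound, the
  displacement of \<open>z\<close> under \<open>\<phi> u t\<close> is the integral of the field
  along a trajectory that \<open>uniform_radius\<close> confines to one disc; Schwarz-Pick for
  \<open>\<phi> s u\<close> carries the estimate to arbitrary \<open>s\<close>.\<close>

lemma Herglotz_solution_family_reverse_evolution:
  assumes d: "1 \<le> d" and G: "Herglotz_vector_field d G"
    and w: "\<And>t z. 0 \<le> t \<Longrightarrow> z \<in> unit_disc \<Longrightarrow> solves_LK_ODE G t z (w z t)"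
    and \<phi>: "\<And>s t z. z \<in> unit_disc \<Longrightarrow> 0 \<le> s \<Longrightarrow> s \<le> t \<Longrightarrow> \<phi> s t z = w z t s"
  shows "reverse_evolution_family d \<phi>"
proof -
  obtain N where N: "negligible N" "inward_field (\<lambda>z t. if t \<in> N then 0 else G z t)"
    using Herglotz_inward_field[OF d G] .
  define G0 where "G0 = (\<lambda>z t. if t \<in> N then 0 else G z t)"
  interpret inward_field G0 unfolding G0_def by (rule N(2))
  have w0: "solves_LK_ODE G0 t z (w z t)" if "0 \<le> t" "z \<in> unit_disc" for t z
    by (rule solves_LK_ODE_cong_AE[OF w[OF that] N(1)]) (simp add: G0_def)
  have wt: "w z t t = z" if "0 \<le> t" "z \<in> unit_disc" for t z using w[OF that] unfolding solves_LK_ODE_def by blast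
  have wD: "w z t s \<in> unit_disc" if "0 \<le> s" "s \<le> t" "z \<in> unit_disc" for s t z
    using w[of t z] that unfolding solves_LK_ODE_def by force
  have self: "hol_self_map (\<phi> s t)" if st: "0 \<le> s" "s \<le> t" for s t
    unfolding hol_self_map_def
  proof
    have "(\<lambda>z. w z t s) holomorphic_on unit_disc"
      by (rule solution_holomorphic[OF w0 st]) (use st in auto)
    then show "\<phi> s t holomorphic_on unit_disc"
      by (rule holomorphic_transform) (use \<phi> st in auto)
    show "\<phi> s t ` unit_disc \<subseteq> unit_disc" using \<phi> wD st by auto
  qed
  have comp: "\<phi> s t z = \<phi> s u (\<phi> u t z)" if st: "0 \<le> s" "s \<le> u" "u \<le> t" and z: "z \<in> unit_disc" for s u t z
  proof -
    have t: "0 \<le> t" "0 \<le> u" using st by auto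
    have wu: "w z t u \<in> unit_disc" using wD st z t by blast
    have "w z t s = w (w z t u) u s"
      by (rule solution_unique[OF solves_LK_ODE_restrict[OF w0[OF t(1) z] t(2) st(3)] w0[OF t(2) wu] st(1,2)])
    then show ?thesis using \<phi>[OF z, of s t] \<phi>[OF z, of u t] \<phi>[OF wu, of s u] st by auto
  qed
  have bd: "\<exists>k\<in>nonneg_Lspace d T. \<forall>s u t. 0 \<le> s \<and> s \<le> u \<and> u \<le> t \<and> t \<le> T \<longrightarrow>
      norm (\<phi> s u z - \<phi> s t z) \<le> (LINT \<xi>:{u..t}|lebesgue. k \<xi>)"
    if z: "z \<in> unit_disc" and T: "0 < T" for z T
  proof -
    have z1: "norm z < 1" using z by simp
    obtain r where r: "0 \<le> r" "r < 1"
      "\<And>t z' w s. solves_LK_ODE G0 t z' w \<Longrightarrow> norm z' \<le> norm z \<Longrightarrow> 0 \<le> s \<Longrightarrow> s \<le> t \<Longrightarrow> t \<le> T \<Longrightarrow> norm (w s) \<le> r"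
      using uniform_radius[OF z1, of T] by blast
    obtain k M where k: "k \<in> nonneg_Lspace d T" and M: "negligible M"
      "\<And>t z. t \<in> {0..T} \<Longrightarrow> t \<notin> M \<Longrightarrow> norm z \<le> r \<Longrightarrow> norm (G z t) \<le> k t"
      using Herglotz_bound[OF G T r(2)] by blast
    note ki = nonneg_Lspace_integrable[OF k d]
    have disp: "norm (z - \<phi> u t z) \<le> integral {u..t} k" if ut: "0 \<le> u" "u \<le> t" "t \<le> T" for u t
    proof -
      have t: "0 \<le> t" using ut by simp
      \<comment> \<open>The bound on the field fails on the null set \<open>M\<close>, while
        comparison of integrals asks for it at every point; putting \<open>0\<close> there leaves
        the integral unchanged.\<close>
      define h where "h \<sigma> = (if \<sigma> \<in> M then 0 else G0 (w z t \<sigma>) \<sigma>)" for \<sigma>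
      have "((\<lambda>\<sigma>. G0 (w z t \<sigma>) \<sigma>) has_integral (w z t u - w z t t)) {u..t}"
        by (rule solution_integral_eq[OF w0[OF t z] ut(1,2) order_refl])
      then have h: "(h has_integral (w z t u - w z t t)) {u..t}"
        by (rule has_integral_spike[OF M(1), rotated]) (simp add: h_def)
      have "norm (integral {u..t} h) \<le> integral {u..t} k"
      proof (rule integral_norm_bound_integral)
        show "h integrable_on {u..t}" using h by blast
        show "k integrable_on {u..t}" using ut by (intro integrable_on_subinterval_real[OF ki(1)]) auto
        fix x assume x: "x \<in> {u..t}"
        have "norm (w z t x) \<le> r" using x ut by (intro r(3)[OF w0[OF t z]]) auto
        then show "norm (h x) \<le> k x" using x ut ki(2)[of x] M(2)[of x "w z t x"] by (auto simp: h_def G0_def)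
      qed
      then have "norm (w z t u - w z t t) \<le> integral {u..t} k" using h by (simp add: integral_unique)
      then show ?thesis using wt[OF t z] \<phi>[OF z ut(1,2)] by (simp add: norm_minus_commute)
    qed
    define c where "c = 2 / (1 - norm z)"
    have c: "0 \<le> c" using z1 by (simp add: c_def)
    \<comment> \<open>The summand \<open>0\<close> brings the multiple of \<open>k\<close> into the
      form of \<open>nonneg_Lspace_cmult_add\<close>, with the zero function as second
      member.\<close>
    define k' where "k' x = c * (k x + 0)" for x
    have k': "k' \<in> nonneg_Lspace d T"
      unfolding k'_def by (rule nonneg_Lspace_cmult_add[OF k(1) zero_nonneg_Lspace[OF d] d c])
    show ?thesis
    proof (rule bexI[OF _ k'], intro allI impI)
      fix s u t assume "0 \<le> s \<and> s \<le> u \<and> u \<le> t \<and> t \<le> T"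
      then have st: "0 \<le> s" "s \<le> u" "u \<le> t" "t \<le> T" "0 \<le> u" by auto
      have "norm (\<phi> s u z - \<phi> s t z) = norm (\<phi> s u z - \<phi> s u (\<phi> u t z))" using comp[OF st(1-3) z] by simp
      also have "\<dots> \<le> c * norm (z - \<phi> u t z)"
      proof -
        have "\<phi> u t z \<in> unit_disc" using self[OF st(5,3)] z unfolding hol_self_map_def by blast
        then show ?thesis
          unfolding c_def by (rule hol_self_map_Lipschitz[OF self[OF st(1,2)] order_refl z1])
      qed
      also have "\<dots> \<le> c * integral {u..t} k" using c by (intro mult_left_mono disp st)
      also have "\<dots> = integral {u..t} k'" by (simp add: k'_def[abs_def])
      also have "\<dots> = (LINT \<xi>:{u..t}|lebesgue. k' \<xi>)"
        by (rule nonneg_Lspace_integrable(3)[OF k' d, symmetric]) (use st in auto)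
      finally show "norm (\<phi> s u z - \<phi> s t z) \<le> (LINT \<xi>:{u..t}|lebesgue. k' \<xi>)" .
    qed
  qed
  show ?thesis
    unfolding reverse_evolution_family_def
  proof (intro conjI allI impI ballI)
    show "\<phi> s s z = z" if "0 \<le> s" "z \<in> unit_disc" for s z using \<phi>[of z s s] wt that by simp
  qed (use self comp bd in auto)
qed

lemma abs_continuous_on_cong:
  assumes f: "abs_continuous_on S f" and eq: "\<And>x. x \<in> S \<Longrightarrow> g x = f x"
  shows "abs_continuous_on S g"
proof (rule abs_continuous_on_dominated[OF f f, of _ 1])
  fix x y assume "x \<in> S" "y \<in> S"
  then show "norm (g y - g x) \<le> 1 * (norm (f y - f x) + norm (f y - f x))" using eq[of x] eq[of y] by simp
qed

lemma solves_LK_PDE_cong: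
  assumes F: "solves_LK_PDE G E F" and eq: "\<And>z t. z \<in> unit_disc \<Longrightarrow> t \<in> E \<Longrightarrow> F' z t = F z t"
  shows "solves_LK_PDE G E F'"
  unfolding solves_LK_PDE_def
proof (intro conjI ballI)
  have "continuous_on (unit_disc \<times> E) (\<lambda>(z, t). F z t)" using F by (simp add: solves_LK_PDE_def)
  then show "continuous_on (unit_disc \<times> E) (\<lambda>(z, t). F' z t)"
    by (rule continuous_on_eq) (use eq in auto)
  show "(\<lambda>z. F' z t) holomorphic_on unit_disc" if t: "t \<in> E" for t
  proof -
    have "(\<lambda>z. F z t) holomorphic_on unit_disc" using F t by (simp add: solves_LK_PDE_def)
    then show ?thesis by (rule holomorphic_transform) (use eq t in auto)
  qed
  fix z assume z: "z \<in> unit_disc"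
  show "locally_abs_continuous_on E (\<lambda>t. F' z t)"
    using F z eq unfolding solves_LK_PDE_def locally_abs_continuous_on_def
    by (meson abs_continuous_on_cong subsetD)
  have "AE t in lebesgue_on E. ((\<lambda>\<tau>. F z \<tau>) has_vector_derivative deriv (\<lambda>\<zeta>. F \<zeta> t) z * G z t) (at t within E)"
    using F z by (simp add: solves_LK_PDE_def)
  then show "AE t in lebesgue_on E. ((\<lambda>\<tau>. F' z \<tau>) has_vector_derivative deriv (\<lambda>\<zeta>. F' \<zeta> t) z * G z t) (at t within E)"
    using AE_space
  proof eventually_elim
    case (elim t)
    then have t: "t \<in> E" by simp
    have "\<forall>\<^sub>F \<zeta> in nhds z. F' \<zeta> t = F \<zeta> t"
      using eventually_nhds_in_open[OF open_ball z] by eventually_elim (use eq t in auto)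
    then have "deriv (\<lambda>\<zeta>. F' \<zeta> t) z = deriv (\<lambda>\<zeta>. F \<zeta> t) z" by (rule deriv_cong_ev) simp
    then show ?case
      using elim(1) by (auto intro: has_vector_derivative_transform[OF t, rotated] simp: eq[OF z])
  qed
qed

subsection \<open>The Loewner-Kufarev PDE\<close>

text \<open>Since \<open>f 0\<close> is the identity on the disc, association at
  \<open>s = 0\<close> already determines \<open>f\<close>. Conversely, univalence of
  \<open>\<phi> 0 t\<close> is what allows the inverses at the other times to be taken.\<close>

lemma associated_decreasing_chain_iff:
  assumes d: "1 \<le> d" and ref: "reverse_evolution_family d \<phi>"
    and f: "\<And>t. 0 \<le> t \<Longrightarrow> f t holomorphic_on unit_disc"
  shows "decreasing_Loewner_chain d f \<and> associated f \<phi> \<longleftrightarrow> (\<forall>t\<ge>0. \<forall>z\<in>unit_disc. f t z = \<phi> 0 t z)"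
proof
  interpret reverse_evolution d \<phi> by unfold_locales (rule d ref)+
  assume A: "decreasing_Loewner_chain d f \<and> associated f \<phi>"
  show "\<forall>t\<ge>0. \<forall>z\<in>unit_disc. f t z = \<phi> 0 t z"
  proof (intro allI impI ballI)
    fix t :: real and z :: complex assume t: "0 \<le> t" and z: "z \<in> unit_disc"
    have f0: "inj_on (f 0) unit_disc" "\<And>v. v \<in> unit_disc \<Longrightarrow> f 0 v = v" "hol_self_map (f t)"
      using A t by (auto simp: decreasing_Loewner_chain_def)
    then have ft: "f t z \<in> unit_disc" using z unfolding hol_self_map_def by blast
    have "\<phi> 0 t z = inv_into unit_disc (f 0) (f t z)" using A t z unfolding associated_def by simp
    also have "\<dots> = inv_into unit_disc (f 0) (f 0 (f t z))" using f0(2)[OF ft] by simp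
    also have "\<dots> = f t z" by (rule inv_into_f_f[OF f0(1) ft])
    finally show "f t z = \<phi> 0 t z" by simp
  qed
next
  interpret reverse_evolution d \<phi> by unfold_locales (rule d ref)+
  assume "\<forall>t\<ge>0. \<forall>z\<in>unit_disc. f t z = \<phi> 0 t z"
  then have eq: "f t z = \<phi> 0 t z" if "0 \<le> t" "z \<in> unit_disc" for t z using that by blast
  have inj: "inj_on (f t) unit_disc" if t: "0 \<le> t" for t
    using univalent[OF order_refl t] eq[OF t] by (simp add: inj_on_def)
  have ff: "f t z = f s (\<phi> s t z)" if "0 \<le> s" "s \<le> t" "z \<in> unit_disc" for s t z
    using comp[of 0 s t z] eq[of t z] eq[of s "\<phi> s t z"] in_disc[of s t z] that by simp
  have "decreasing_Loewner_chain d f"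
    unfolding decreasing_Loewner_chain_def
  proof (intro conjI allI impI ballI)
    show "hol_self_map (f t)" if t: "0 \<le> t" for t
      unfolding hol_self_map_def using f[OF t] eq[OF t] in_disc[OF order_refl t] by auto
    show "inj_on (f t) unit_disc" if "0 \<le> t" for t by (rule inj[OF that])
    show "f 0 z = z" if "z \<in> unit_disc" for z using eq[OF order_refl that] refl[OF order_refl that] by simp
    show "f t ` unit_disc \<subseteq> f s ` unit_disc" if st: "0 \<le> s \<and> s \<le> t" for s t
    proof
      fix y assume "y \<in> f t ` unit_disc"
      then obtain z where "z \<in> unit_disc" "y = f t z" by blast
      then show "y \<in> f s ` unit_disc" using ff[of s t z] in_disc[of s t z] st by auto
    qed
    fix K T assume KT: "compact K \<and> K \<subseteq> unit_disc \<and> (0::real) < T"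
    obtain r where r: "r < 1" "\<And>z. z \<in> K \<Longrightarrow> norm z \<le> r" using compact_subset_disc[of K] KT by blast
    obtain k where k: "k \<in> nonneg_Lspace d T"
      "\<And>z s u t. norm z \<le> r \<Longrightarrow> 0 \<le> s \<Longrightarrow> s \<le> u \<Longrightarrow> u \<le> t \<Longrightarrow> t \<le> T \<Longrightarrow>
         norm (\<phi> s u z - \<phi> s t z) \<le> integral {u..t} k"
      using uniform_bound[OF conjunct2[OF conjunct2[OF KT]] r(1)] by blast
    show "\<exists>k\<in>nonneg_Lspace d T. \<forall>z\<in>K. \<forall>s t. 0 \<le> s \<and> s \<le> t \<and> t \<le> T \<longrightarrow>
          norm (f s z - f t z) \<le> (LINT \<xi>:{s..t}|lebesgue. k \<xi>)"
    proof (rule bexI[OF _ k(1)], intro ballI allI impI)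
      fix z and s t :: real assume z: "z \<in> K" and st: "0 \<le> s \<and> s \<le> t \<and> t \<le> T"
      have zD: "z \<in> unit_disc" using z KT by blast
      have "norm (f s z - f t z) \<le> integral {s..t} k"
        using k(2)[OF r(2)[OF z] order_refl, of s t] eq[OF _ zD, of s] eq[OF _ zD, of t] st by simp
      also have "\<dots> = (LINT \<xi>:{s..t}|lebesgue. k \<xi>)"
        by (rule nonneg_Lspace_integrable(3)[OF k(1) d, symmetric]) (use st in auto)
      finally show "norm (f s z - f t z) \<le> (LINT \<xi>:{s..t}|lebesgue. k \<xi>)" .
    qed
  qed
  moreover have "associated f \<phi>"
    unfolding associated_def
  proof (intro allI impI ballI)
    fix s t :: real and z :: complex assume st: "0 \<le> s \<and> s \<le> t" and z: "z \<in> unit_disc"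
    have "inv_into unit_disc (f s) (f t z) = inv_into unit_disc (f s) (f s (\<phi> s t z))"
      using ff[of s t z] st z by simp
    also have "\<dots> = \<phi> s t z" using st z by (intro inv_into_f_f inj in_disc) auto
    finally show "\<phi> s t z = inv_into unit_disc (f s) (f t z)" by simp
  qed
  ultimately show "decreasing_Loewner_chain d f \<and> associated f \<phi>" by simp
qed

context reverse_evolution
begin

lemma abs_continuous_in_t:
  assumes a: "0 \<le> a" and z: "z \<in> unit_disc"
  shows "abs_continuous_on {a..b} (\<lambda>t. \<phi> 0 t z)"
proof -
  have T: "0 < max 1 b" by simp
  obtain k where k: "k \<in> nonneg_Lspace d (max 1 b)"
    "\<And>s u t. 0 \<le> s \<Longrightarrow> s \<le> u \<Longrightarrow> u \<le> t \<Longrightarrow> t \<le> max 1 b \<Longrightarrow> norm (\<phi> s u z - \<phi> s t z) \<le> integral {u..t} k"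
    using pointwise_bound[OF z T] by blast
  show ?thesis
  proof (rule abs_continuous_on_integral_bound)
    show "k integrable_on {a..b}"
      using a by (intro integrable_on_subinterval_real[OF nonneg_Lspace_integrable(1)[OF k(1) d]]) auto
    show "0 \<le> k x" if "x \<in> {a..b}" for x using nonneg_Lspace_integrable(2)[OF k(1) d, of x] that a by auto
    show "norm (\<phi> 0 y z - \<phi> 0 x z) \<le> integral {x..y} k" if "a \<le> x" "x \<le> y" "y \<le> b" for x y
      using k(2)[of 0 x y] that a by (simp add: norm_minus_commute)
  qed
qed

text \<open>Schwarz-Pick gives a Lipschitz bound in \<open>z\<close> near \<open>z0\<close> that is
  the same for all times, so continuity in time at the single point \<open>z0\<close>
  suffices.\<close>

lemma chain_jointly_continuous: "continuous_on (unit_disc \<times> {0..}) (\<lambda>(z, t). \<phi> 0 t z)"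
  unfolding continuous_on_def
proof
  fix p :: "complex \<times> real" assume p: "p \<in> unit_disc \<times> {0..}"
  obtain z0 t0 where p0: "p = (z0, t0)" by fastforce
  have z0: "norm z0 < 1" "z0 \<in> unit_disc" and t0: "0 \<le> t0" using p p0 by auto
  let ?F = "at p within (unit_disc \<times> {0..})"
  let ?b = "\<lambda>q. 2 / (1 - norm z0) * norm (z0 - fst q) + norm (\<phi> 0 (snd q) z0 - \<phi> 0 t0 z0)"
  have "continuous_on (unit_disc \<times> {0..}) ?b"
    by (intro continuous_intros continuous_on_compose2[OF continuous_in_t[OF order_refl z0(2)]]) auto
  then have "(?b \<longlongrightarrow> ?b p) ?F" using p unfolding continuous_on_def by (rule bspec)
  then have b0: "(?b \<longlongrightarrow> 0) ?F" by (simp add: p0)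
  have "norm (\<phi> 0 (snd q) (fst q) - \<phi> 0 t0 z0) \<le> ?b q" if q: "q \<in> unit_disc \<times> {0..}" for q
  proof -
    have qD: "fst q \<in> unit_disc" "0 \<le> snd q" using q by auto
    have "norm (\<phi> 0 (snd q) z0 - \<phi> 0 (snd q) (fst q)) \<le> 2 / (1 - norm z0) * norm (z0 - fst q)"
      by (rule hol_self_map_Lipschitz[OF self[OF order_refl qD(2)] order_refl z0(1) qD(1)])
    moreover have "norm (\<phi> 0 (snd q) (fst q) - \<phi> 0 t0 z0) \<le>
        norm (\<phi> 0 (snd q) z0 - \<phi> 0 (snd q) (fst q)) + norm (\<phi> 0 (snd q) z0 - \<phi> 0 t0 z0)"
      using norm_triangle_ineq4[of "\<phi> 0 (snd q) z0 - \<phi> 0 t0 z0" "\<phi> 0 (snd q) z0 - \<phi> 0 (snd q) (fst q)"] by simp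
    ultimately show ?thesis by linarith
  qed
  then have "\<forall>\<^sub>F q in ?F. norm (\<phi> 0 (snd q) (fst q) - \<phi> 0 t0 z0) \<le> ?b q" by (simp add: eventually_at_filter)
  from LIM_zero_cancel[OF Lim_null_comparison[OF this b0]]
  show "((\<lambda>(z, t). \<phi> 0 t z) \<longlongrightarrow> (case p of (z, t) \<Rightarrow> \<phi> 0 t z)) ?F"
    by (simp add: p0 case_prod_unfold)
qed

text \<open>For the constructed \<open>field\<close> the PDE holds by definition; the given
  \<open>G\<close> agrees with it off a null set because both correspond to
  \<open>\<phi>\<close>.\<close>

lemma chain_solves_PDE:
  assumes G: "Herglotz_vector_field d G" and corr: "LK_corresponding \<phi> G"
  shows "solves_LK_PDE G {0..} (\<lambda>z t. \<phi> 0 t z)"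
proof -
  obtain N g where "generating_field d \<phi> N g" using generating_field_exists .
  then interpret generating_field d \<phi> N g .
  obtain N' where N': "negligible N'" "\<And>t z. 0 \<le> t \<Longrightarrow> t \<notin> N' \<Longrightarrow> z \<in> unit_disc \<Longrightarrow> field z t = G z t"
    using corresponding_field_unique[OF field_holomorphic _ field_corresponding corr] G
    unfolding Herglotz_vector_field_def by blast
  show ?thesis
    unfolding solves_LK_PDE_def
  proof (intro conjI ballI chain_jointly_continuous)
    show "(\<lambda>z. \<phi> 0 t z) holomorphic_on unit_disc" if "t \<in> {0..}" for t using holo[of 0 t] that by simp
    fix z assume z: "z \<in> unit_disc"
    show "locally_abs_continuous_on {0..} (\<lambda>t. \<phi> 0 t z)"
      unfolding locally_abs_continuous_on_def
    proof (intro allI impI)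
      fix a b :: real assume ab: "{a..b} \<subseteq> {0..}"
      have "{a..b} \<subseteq> {max 0 a..b}" using ab by auto
      then show "abs_continuous_on {a..b} (\<lambda>t. \<phi> 0 t z)"
        by (rule abs_continuous_on_subset[rotated]) (rule abs_continuous_in_t[OF _ z], simp)
    qed
    have "((\<lambda>\<tau>. \<phi> 0 \<tau> z) has_vector_derivative deriv (\<phi> 0 t) z * G z t) (at t within {0..})"
      if t: "0 \<le> t" "t \<notin> N \<union> N'" for t
    proof -
      have "deriv (\<phi> 0 t) z * G z t = g t z"
        using N'(2)[of t z] t z deriv_nonzero[OF t(1) z] by (simp add: field_def flip: N'(2))
      then show ?thesis using derivative_in_t[of t z] t z by simp
    qed
    then show "AE t in lebesgue_on {0..}.
        ((\<lambda>\<tau>. \<phi> 0 \<tau> z) has_vector_derivative deriv (\<lambda>\<zeta>. \<phi> 0 t \<zeta>) z * G z t) (at t within {0..})"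
      by (intro AE_lebesgue_onI[of "N \<union> N'"]) (use N N' in auto)
  qed
qed

text \<open>The null set on which the PDE may fail depends on \<open>z\<close>, so the equation
  cannot be inserted directly along \<open>\<phi> s t z\<close>. It is first upgraded to a
  derivative that is locally uniform in \<open>z\<close> off one null set; then
  \<open>f s (\<phi> s t z)\<close> has zero derivative almost everywhere and is absolutely
  continuous, so its values at \<open>s = 0\<close> and \<open>s = t\<close> agree.\<close>

lemma PDE_solution_eq_chain:
  assumes G: "Herglotz_vector_field d G" and corr: "LK_corresponding \<phi> G"
    and pde: "solves_LK_PDE G {0..} (\<lambda>z t. f t z)" and f0: "\<And>z. z \<in> unit_disc \<Longrightarrow> f 0 z = z"
    and t: "0 \<le> t" and z: "z \<in> unit_disc"
  shows "f t z = \<phi> 0 t z"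
proof -
  have cont: "continuous_on (unit_disc \<times> {0..}) (\<lambda>(z, t). f t z)"
    and hol: "\<And>t. 0 \<le> t \<Longrightarrow> f t holomorphic_on unit_disc"
    and ac: "\<And>z. z \<in> unit_disc \<Longrightarrow> locally_abs_continuous_on {0..} (\<lambda>t. f t z)"
    using pde by (simp_all add: solves_LK_PDE_def)
  have G_hol: "(\<lambda>z. G z t) holomorphic_on unit_disc" if "0 \<le> t" for t
    using G that by (simp add: Herglotz_vector_field_def)
  define bad where "bad z = {t \<in> {0..}. \<not> ((\<lambda>\<tau>. f \<tau> z) has_vector_derivative deriv (f t) z * G z t) (at t within {0..})}" for z
  have bad: "negligible (bad z)" if z: "z \<in> unit_disc" for z
  proof -
    have "AE t in lebesgue_on {0..}. ((\<lambda>\<tau>. f \<tau> z) has_vector_derivative deriv (f t) z * G z t) (at t within {0..})"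
      using pde z by (simp add: solves_LK_PDE_def)
    then show ?thesis unfolding bad_def by (subst (asm) AE_lebesgue_on_iff_negligible) auto
  qed
  have der: "((\<lambda>\<tau>. f \<tau> z) has_vector_derivative deriv (f t) z * G z t) (at t within {0..})"
    if "0 \<le> t" "t \<notin> bad z" for t z using that by (simp add: bad_def)
  have f_bd: "\<exists>B. \<forall>z t. norm z \<le> r \<and> t \<in> {0..T} \<longrightarrow> norm (f t z) \<le> B" if r: "r < 1" for r T
  proof -
    have "compact ((\<lambda>(z, t). f t z) ` (cball 0 r \<times> {0..T}))"
      using r by (intro compact_continuous_image continuous_on_subset[OF cont] compact_Times) auto
    then obtain B where "\<forall>x\<in>(\<lambda>(z, t). f t z) ` (cball 0 r \<times> {0..T}). norm x \<le> B"
      using compact_imp_bounded bounded_iff by metis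
    then show ?thesis by (intro exI[of _ B]) force
  qed
  \<comment> \<open>The PDE is integrated in time at fixed \<open>z\<close>: Cauchy's estimate
    bounds the derivative of \<open>f\<close> in \<open>z\<close> by a constant \<open>C\<close>,
    and the Herglotz condition bounds \<open>G\<close> by an integrable function.\<close>
  have bd: "\<exists>k. k integrable_on {0..T} \<and> (\<forall>t\<in>{0..T}. 0 \<le> k t) \<and>
      (\<forall>z s t. norm z \<le> r \<and> 0 \<le> s \<and> s \<le> t \<and> t \<le> T \<longrightarrow> norm (f t z - f s z) \<le> integral {s..t} k)"
    if r: "r < 1" and T: "0 < T" for r T
  proof -
    define R where "R = (1 + r) / 2"
    have R: "r < R" "R < 1" using r by (auto simp: R_def)
    obtain B where B: "\<And>z t. norm z \<le> R \<Longrightarrow> t \<in> {0..T} \<Longrightarrow> norm (f t z) \<le> B" using f_bd[OF R(2)] by blast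
    define C where "C = max 0 (B / (R - r))"
    have C: "0 \<le> C" by (simp add: C_def)
    have dC: "norm (deriv (f t) z) \<le> C" if "norm z \<le> r" "t \<in> {0..T}" for z t
      using holomorphic_bounded_deriv[OF hol R B[OF _ that(2)] that(1)] that(2) by (simp add: C_def)
    obtain k M where k: "k \<in> nonneg_Lspace d T" and M: "negligible M"
      "\<And>t z. t \<in> {0..T} \<Longrightarrow> t \<notin> M \<Longrightarrow> norm z \<le> r \<Longrightarrow> norm (G z t) \<le> k t"
      using Herglotz_bound[OF G T r] by blast
    note ki = nonneg_Lspace_integrable[OF k d]
    have "norm (f t z - f s z) \<le> integral {s..t} (\<lambda>x. C * k x)"
      if z: "norm z \<le> r" and st: "0 \<le> s" "s \<le> t" "t \<le> T" for z s t
    proof -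
      have zD: "z \<in> unit_disc" using z r by auto
      define h where "h \<tau> = (if \<tau> \<in> M then 0 else deriv (f \<tau>) z * G z \<tau>)" for \<tau>
      have "((\<lambda>\<tau>. deriv (f \<tau>) z * G z \<tau>) has_integral (f t z - f s z)) {s..t}"
      proof (rule fundamental_theorem_of_calculus_abs_continuous[OF st(2) _ bad[OF zD]])
        show "abs_continuous_on {s..t} (\<lambda>\<tau>. f \<tau> z)"
          using ac[OF zD] st by (auto simp: locally_abs_continuous_on_def)
        fix x assume x: "x \<in> {s..t} - bad z"
        show "((\<lambda>\<tau>. f \<tau> z) has_vector_derivative deriv (f x) z * G z x) (at x within {s..t})"
          by (rule has_vector_derivative_within_subset[OF der]) (use x st in auto)
      qed
      then have h: "(h has_integral (f t z - f s z)) {s..t}"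
        by (rule has_integral_spike[OF M(1), rotated]) (simp add: h_def)
      have "norm (integral {s..t} h) \<le> integral {s..t} (\<lambda>x. C * k x)"
      proof (rule integral_norm_bound_integral)
        show "h integrable_on {s..t}" using h by blast
        show "(\<lambda>x. C * k x) integrable_on {s..t}"
          using st by (intro integrable_on_mult_right integrable_on_subinterval_real[OF ki(1)]) auto
        fix x assume "x \<in> {s..t}"
        then have x: "x \<in> {0..T}" using st by auto
        show "norm (h x) \<le> C * k x"
        proof (cases "x \<in> M")
          case True
          then show ?thesis using C ki(2)[OF x] by (simp add: h_def)
        next
          case False
          then have "norm (G z x) \<le> k x" using M(2)[OF x _ z] by simp
          then have "norm (deriv (f x) z * G z x) \<le> C * k x"
            unfolding norm_mult using dC[OF z x] C by (intro mult_mono) auto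
          then show ?thesis using False by (simp add: h_def)
        qed
      qed
      then show ?thesis using h by (simp add: integral_unique)
    qed
    then show ?thesis
      using ki(1,2) C by (intro exI[of _ "\<lambda>x. C * k x"]) (auto intro: integrable_on_mult_right)
  qed
  obtain N g where N: "negligible N"
    "\<And>t. 0 \<le> t \<Longrightarrow> t \<notin> N \<Longrightarrow> g t holomorphic_on unit_disc"
    "\<And>t r. 0 \<le> t \<Longrightarrow> t \<notin> N \<Longrightarrow> r < 1 \<Longrightarrow>
      uniform_limit (cball 0 r) (\<lambda>\<tau> z. (f \<tau> z - f t z) /\<^sub>R (\<tau> - t)) (g t) (at t within {0..})"
    using locally_uniform_derivative_AE_atLeast0[of f, OF hol bd] by blast
  obtain D0 :: "complex set" where D0: "countable D0" "\<And>X. open X \<Longrightarrow> X \<noteq> {} \<Longrightarrow> \<exists>d\<in>D0. d \<in> X"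
    using countable_dense_setE by blast
  define N3 where "N3 = (\<Union>z\<in>D0 \<inter> unit_disc. bad z)"
  have N3: "negligible N3"
    unfolding N3_def using D0(1) bad by (intro negligible_countable_Union countable_image countable_Int1) auto
  \<comment> \<open>Both sides are continuous in \<open>v\<close>, so it is enough to compare them
    at the dense points, whose exceptional times are collected in \<open>N3\<close>.\<close>
  have g_eq: "g x v = deriv (f x) v * G v x" if x: "0 \<le> x" "x \<notin> N" "x \<notin> N3" and v: "v \<in> unit_disc" for x v
  proof -
    have "g x v - deriv (f x) v * G v x = 0"
    proof (rule eq_on_dense_imp_eq_on_open[OF open_ball _ D0(2) _ v])
      show "continuous_on unit_disc (\<lambda>v. g x v - deriv (f x) v * G v x)"
        by (intro continuous_intros holomorphic_on_imp_continuous_on N(2) G_hol holomorphic_deriv hol open_ball x)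
      fix v assume v: "v \<in> D0 \<inter> unit_disc"
      have "((\<lambda>\<tau>. f \<tau> v) has_vector_derivative deriv (f x) v * G v x) (at x within {0..})"
        using v x by (intro der) (auto simp: N3_def)
      then have "((\<lambda>\<tau>. (f \<tau> v - f x v) /\<^sub>R (\<tau> - x)) \<longlongrightarrow> deriv (f x) v * G v x) (at x within {0..})"
        by (simp add: has_vector_derivative_iff_slope)
      moreover have "((\<lambda>\<tau>. (f \<tau> v - f x v) /\<^sub>R (\<tau> - x)) \<longlongrightarrow> g x v) (at x within {0..})"
        using tendsto_uniform_limitI[OF N(3)[OF x(1,2), of "norm v"], of v] v by simp
      moreover have "at x within {0..} \<noteq> bot"
      proof -
        have "at_right x \<le> at x within {0..}" using x by (intro at_le) auto
        then show ?thesis using trivial_limit_at_right_real[of x] by (metis bot.extremum_uniqueI trivial_limit_def)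
      qed
      ultimately show "g x v - deriv (f x) v * G v x = 0" using tendsto_unique by fastforce
    qed
    then show ?thesis by simp
  qed
  show ?thesis
  proof (cases "t = 0")
    case True
    then show ?thesis using f0 z refl by simp
  next
    case False
    then have T: "0 < t" using t by simp
    let ?w = "\<lambda>s. \<phi> s t z"
    obtain r where r: "0 \<le> r" "r < 1"
      "\<And>z' u t'. norm z' \<le> norm z \<Longrightarrow> 0 \<le> u \<Longrightarrow> u \<le> t' \<Longrightarrow> t' \<le> t \<Longrightarrow> norm (\<phi> u t' z') \<le> r"
      using uniform_radius[OF T, of "norm z"] z by auto
    have wr: "norm (?w s) \<le> r" if "s \<in> {0..t}" for s using r(3)[of z s t] that by simp
    have wD: "?w s \<in> unit_disc" if "s \<in> {0..t}" for s using wr[OF that] r by simp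
    have sub: "cball 0 r \<subseteq> unit_disc" using r by auto
    define R where "R = (1 + r) / 2"
    have R: "r < R" "R < 1" using r by (auto simp: R_def)
    obtain B where B: "\<And>z' s. norm z' \<le> R \<Longrightarrow> s \<in> {0..t} \<Longrightarrow> norm (f s z') \<le> B" using f_bd[OF R(2)] by blast
    obtain k where k: "k integrable_on {0..t}" "\<And>s. s \<in> {0..t} \<Longrightarrow> 0 \<le> k s"
      "\<And>z s u. norm z \<le> r \<Longrightarrow> 0 \<le> s \<Longrightarrow> s \<le> u \<Longrightarrow> u \<le> t \<Longrightarrow> norm (f u z - f s z) \<le> integral {s..u} k"
      using bd[OF r(2) T] by blast
    have kn: "norm (k x) \<le> k x" if "x \<in> {0..t}" for x using k(2)[OF that] by simp
    note ktail = tail_integral[OF k(1) k(1) kn]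
    have wac: "abs_continuous_on {0..t} ?w" by (rule abs_continuous_in_s[OF t z])
    \<comment> \<open>The increment of \<open>u\<close> is split into a change of time at a fixed
      point, bounded by an integral of \<open>k\<close>, and a change of point at a fixed time,
      bounded by Cauchy's estimate; the \<open>max\<close> lets one constant cover both
      coefficients.\<close>
    define C where "C = max 1 (B / (R - r))"
    define u where "u s = f s (?w s)" for s
    have uac: "abs_continuous_on {0..t} u"
    proof (rule abs_continuous_on_dominated[OF ktail(3) wac])
      fix x y assume xy: "x \<in> {0..t}" "y \<in> {0..t}" "x \<le> y"
      have "u y - u x = (f y (?w y) - f x (?w y)) + (f x (?w y) - f x (?w x))" by (simp add: u_def)
      also have "norm \<dots> \<le> norm (f y (?w y) - f x (?w y)) + norm (f x (?w y) - f x (?w x))" by (rule norm_triangle_ineq)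
      also have "norm (f y (?w y) - f x (?w y)) \<le> integral {x..y} k" using xy by (intro k(3) wr) auto
      also have "integral {x..y} k = integral {x..t} k - integral {y..t} k" using ktail(1)[of x y] xy by simp
      also have "\<dots> \<le> norm (integral {y..t} k - integral {x..t} k)" by simp
      also have "norm (f x (?w y) - f x (?w x)) \<le> B / (R - r) * norm (?w y - ?w x)"
        using xy by (intro holomorphic_bounded_Lipschitz[OF hol R B] wr) auto
      also have "\<dots> \<le> C * norm (?w y - ?w x)" by (intro mult_right_mono) (auto simp: C_def)
      also have "norm (integral {y..t} k - integral {x..t} k) \<le> C * norm (integral {y..t} k - integral {x..t} k)"
        using mult_right_mono[of 1 C "norm (integral {y..t} k - integral {x..t} k)"] by (simp add: C_def)
      finally show "norm (u y - u x) \<le> C * (norm (integral {y..t} k - integral {x..t} k) + norm (?w y - ?w x))"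
        by (simp add: distrib_left)
    qed
    have "solves_LK_ODE G t z ?w" using corr t z by (simp add: LK_corresponding_def)
    then obtain Nw where Nw: "negligible Nw"
      "\<And>s. s \<in> {0..t} - Nw \<Longrightarrow> (?w has_vector_derivative - G (?w s) s) (at s within {0..t})"
      using solves_LK_ODE_props[OF _ t] by metis
    have "u 0 = u t"
    proof (rule abs_continuous_zero_derivative_imp_eq[OF t uac])
      show "negligible (N \<union> N3 \<union> Nw)" using N(1) N3 Nw(1) by simp
      fix x assume "x \<in> {0..t} - (N \<union> N3 \<union> Nw)"
      then have x: "x \<in> {0..t}" "0 \<le> x" "x \<notin> N" "x \<notin> N3" "x \<in> {0..t} - Nw" by auto
      have wc: "(?w \<longlongrightarrow> ?w x) (at x within {0..t})"
        using abs_continuous_on_imp_continuous_on[OF wac] x by (simp add: continuous_on_def)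
      have 1: "((\<lambda>y. (f y (?w y) - f x (?w y)) /\<^sub>R (y - x)) \<longlongrightarrow> g x (?w x)) (at x within {0..t})"
      proof (rule uniform_limit_moving_point[OF _ wc])
        show "uniform_limit (cball 0 r) (\<lambda>\<tau> z. (f \<tau> z - f x z) /\<^sub>R (\<tau> - x)) (g x) (at x within {0..t})"
          using N(3)[OF x(2,3) r(2)] by (rule filterlim_mono) (auto intro: at_le)
        show "\<forall>\<^sub>F y in at x within {0..t}. ?w y \<in> cball 0 r" using wr by (simp add: eventually_at_filter)
        show "continuous_on (cball 0 r) (g x)"
          by (rule continuous_on_subset[OF holomorphic_on_imp_continuous_on[OF N(2)[OF x(2,3)]] sub])
        show "?w x \<in> cball 0 r" using wr[OF x(1)] by simp
      qed
      have "(f x has_field_derivative deriv (f x) (?w x)) (at (?w x) within ?w ` {0..t})"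
        by (rule has_field_derivative_at_within, rule holomorphic_derivI[OF hol[OF x(2)] open_ball wD[OF x(1)]])
      from field_vector_diff_chain_within[OF Nw(2)[OF x(5)] this]
      have 2: "((\<lambda>y. (f x (?w y) - f x (?w x)) /\<^sub>R (y - x)) \<longlongrightarrow> - G (?w x) x * deriv (f x) (?w x)) (at x within {0..t})"
        by (simp add: has_vector_derivative_iff_slope o_def)
      have "(f y (?w y) - f x (?w y)) /\<^sub>R (y - x) + (f x (?w y) - f x (?w x)) /\<^sub>R (y - x) = (u y - u x) /\<^sub>R (y - x)" for y
        by (simp add: u_def flip: scaleR_add_right)
      moreover have "g x (?w x) + - G (?w x) x * deriv (f x) (?w x) = 0"
        using g_eq[OF x(2-4) wD[OF x(1)]] by simp
      ultimately show "(u has_vector_derivative 0) (at x within {0..t})"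
        using tendsto_add[OF 1 2] by (simp add: has_vector_derivative_iff_slope)
    qed
    moreover have "u 0 = \<phi> 0 t z" using f0 wD[of 0] t by (simp add: u_def)
    moreover have "u t = f t z" using refl[OF t z] by (simp add: u_def)
    ultimately show ?thesis by simp
  qed
qed

end

theorem theorem4p2:
  fixes d :: ereal
  assumes "1 \<le> d"
  shows
    "(\<forall>\<phi>. reverse_evolution_family d \<phi> \<longrightarrow>
        (\<exists>G. Herglotz_vector_field d G \<and> LK_corresponding \<phi> G \<and>
          (\<forall>G'. Herglotz_vector_field d G' \<and> LK_corresponding \<phi> G' \<longrightarrow>
            (AE t in lebesgue_on {0..}. \<forall>z\<in>unit_disc. G' z t = G z t))))
     \<and>
     (\<forall>G. Herglotz_vector_field d G \<longrightarrow>
        (\<forall>t>0. \<forall>z\<in>unit_disc.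
          (\<exists>w. solves_LK_ODE G t z w \<and>
            (\<forall>w'. solves_LK_ODE G t z w' \<longrightarrow> (\<forall>s\<in>{0..t}. w' s = w s)))) \<and>
        (\<forall>w \<phi>. (\<forall>t\<ge>0. \<forall>z\<in>unit_disc. solves_LK_ODE G t z (w z t)) \<and>
               (\<forall>s t. \<forall>z\<in>unit_disc. 0 \<le> s \<and> s \<le> t \<longrightarrow> \<phi> s t z = w z t s) \<longrightarrow>
          reverse_evolution_family d \<phi>))
     \<and>
     (\<forall>\<phi> G. reverse_evolution_family d \<phi> \<and> Herglotz_vector_field d G \<and> LK_corresponding \<phi> G \<longrightarrow>
        (\<forall>f. (\<forall>t\<ge>0. f t holomorphic_on unit_disc) \<longrightarrow>
          (decreasing_Loewner_chain d f \<and> associated f \<phi> \<longleftrightarrow>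
           solves_LK_PDE G {0..} (\<lambda>z t. f t z) \<and> (\<forall>z\<in>unit_disc. f 0 z = z))))"
proof (intro conjI allI impI)
  fix \<phi> assume ref: "reverse_evolution_family d \<phi>"
  interpret reverse_evolution d \<phi> by unfold_locales (rule assms ref)+
  obtain N g where "generating_field d \<phi> N g" using generating_field_exists .
  then interpret generating_field d \<phi> N g .
  show "\<exists>G. Herglotz_vector_field d G \<and> LK_corresponding \<phi> G \<and>
          (\<forall>G'. Herglotz_vector_field d G' \<and> LK_corresponding \<phi> G' \<longrightarrow>
            (AE t in lebesgue_on {0..}. \<forall>z\<in>unit_disc. G' z t = G z t))"
  proof (intro exI conjI allI impI)
    show "Herglotz_vector_field d field" by (rule field_Herglotz)
    show "LK_corresponding \<phi> field" by (rule field_corresponding)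
    fix G' assume G': "Herglotz_vector_field d G' \<and> LK_corresponding \<phi> G'"
    then have "\<And>t. 0 \<le> t \<Longrightarrow> (\<lambda>z. G' z t) holomorphic_on unit_disc" by (simp add: Herglotz_vector_field_def)
    then obtain N' where N': "negligible N'"
      "\<And>t z. 0 \<le> t \<Longrightarrow> t \<notin> N' \<Longrightarrow> z \<in> unit_disc \<Longrightarrow> G' z t = field z t"
      using corresponding_field_unique[OF _ field_holomorphic _ field_corresponding] G' by blast
    show "AE t in lebesgue_on {0..}. \<forall>z\<in>unit_disc. G' z t = field z t"
      by (rule AE_lebesgue_onI[OF N'(1)]) (use N'(2) in auto)
  qed
next
  fix G assume G: "Herglotz_vector_field d G"
  show "\<forall>z\<in>unit_disc. \<exists>w. solves_LK_ODE G t z w \<and>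
      (\<forall>w'. solves_LK_ODE G t z w' \<longrightarrow> (\<forall>s\<in>{0..t}. w' s = w s))" if "0 < t" for t
    using Herglotz_ODE_unique_solution[OF assms G that] by blast
  fix w \<phi> assume "(\<forall>t\<ge>0. \<forall>z\<in>unit_disc. solves_LK_ODE G t z (w z t)) \<and>
      (\<forall>s t. \<forall>z\<in>unit_disc. 0 \<le> s \<and> s \<le> t \<longrightarrow> \<phi> s t z = w z t s)"
  then show "reverse_evolution_family d \<phi>"
    by (intro Herglotz_solution_family_reverse_evolution[OF assms G, of w]) auto
next
  fix \<phi> G and f :: "real \<Rightarrow> complex \<Rightarrow> complex"
  assume A: "reverse_evolution_family d \<phi> \<and> Herglotz_vector_field d G \<and> LK_corresponding \<phi> G"
    and f: "\<forall>t\<ge>0. f t holomorphic_on unit_disc"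
  then have ref: "reverse_evolution_family d \<phi>" and G: "Herglotz_vector_field d G" and corr: "LK_corresponding \<phi> G"
    by auto
  interpret reverse_evolution d \<phi> by unfold_locales (rule assms ref)+
  \<comment> \<open>Both sides of the required equivalence are compared with the single condition
    that \<open>f t\<close> is \<open>\<phi> 0 t\<close> on the disc.\<close>
  have "(\<forall>t\<ge>0. \<forall>z\<in>unit_disc. f t z = \<phi> 0 t z) \<longleftrightarrow>
      solves_LK_PDE G {0..} (\<lambda>z t. f t z) \<and> (\<forall>z\<in>unit_disc. f 0 z = z)"
  proof
    assume eq: "\<forall>t\<ge>0. \<forall>z\<in>unit_disc. f t z = \<phi> 0 t z"
    have "solves_LK_PDE G {0..} (\<lambda>z t. f t z)"
      by (rule solves_LK_PDE_cong[OF chain_solves_PDE[OF G corr]]) (use eq in auto)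
    moreover have "\<forall>z\<in>unit_disc. f 0 z = z" using eq refl[OF order_refl] by auto
    ultimately show "solves_LK_PDE G {0..} (\<lambda>z t. f t z) \<and> (\<forall>z\<in>unit_disc. f 0 z = z)" by blast
  next
    assume "solves_LK_PDE G {0..} (\<lambda>z t. f t z) \<and> (\<forall>z\<in>unit_disc. f 0 z = z)"
    then show "\<forall>t\<ge>0. \<forall>z\<in>unit_disc. f t z = \<phi> 0 t z"
      using PDE_solution_eq_chain[OF G corr, of f] by blast
  qed
  moreover have "decreasing_Loewner_chain d f \<and> associated f \<phi> \<longleftrightarrow> (\<forall>t\<ge>0. \<forall>z\<in>unit_disc. f t z = \<phi> 0 t z)"
    using f by (intro associated_decreasing_chain_iff[OF assms ref]) auto
  ultimately show "decreasing_Loewner_chain d f \<and> associated f \<phi> \<longleftrightarrow>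
      solves_LK_PDE G {0..} (\<lambda>z t. f t z) \<and> (\<forall>z\<in>unit_disc. f 0 z = z)" by simp
qed

end
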